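(* The group $\mathrm{PPSL}(2,\mathbb{Z})$ is generated by the flip $\alpha$ on the doe and the transformation $\beta$ which moves the doe one edge counter-clockwise in the triangle to its left. A presentation in these generators is given by the following relations: $\alpha^4$, $\beta^3$, $(\alpha\beta)^5$ and the two commutators $$[\beta\alpha\beta,\ \alpha^2\,\beta\alpha\beta\,\alpha^2]\qquad\text{and}\qquad [\beta\alpha\beta,\ \alpha^2\beta^2\alpha^2\,\beta\alpha\beta\,\alpha^2\beta\alpha^2]$$ (each listed word being set equal to $1$).
   Context: $\mathrm{PPSL}(2,\mathbb{Z})$ is the group of all piecewise-$\mathrm{PSL}(2,\mathbb{Z})$ (orientation-preserving) homeomorphisms of the circle $S^1=\partial\mathbb{D}$ with finitely many breakpoints among the rational points of $S^1$ (the points corresponding to $\mathbb{Q}\cup\{\infty\}$ under the Cayley transform). A tesselation $\tau$ of the Poincaré disk $\mathbb{D}$ is a locally finite collection of geodesics (edges) decomposing $\mathbb{D}$ into ideal triangles; a doe (distinguished oriented edge) is a chosen edge of $\tau$ together with an orientation. ${\mathcal Tess}$ is the space of $\mathrm{PSL}(2,\mathbb{R})$-orbits of tesselations with doe. Let the doe run from ideal point $S$ to ideal point $N$, let $W$ be the third vertex of the triangle to the left of the doe and $E$ the third vertex of the triangle to its right. The move $\alpha$ (flip on the doe) removes the doe and replaces it by the other diagonal of the ideal quadrilateral $S,E,N,W$; the new doe is this diagonal oriented from $E$ to $W$. The move $\beta$ leaves the tesselation unchanged and replaces the doe by the edge from $N$ to $W$. Words in $\alpha,\beta$ act from right to left (the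 rightmost letter is applied first). $\mathrm{PPSL}(2,\mathbb{Z})$ acts faithfully on ${\mathcal Tess}$ as follows, and $\alpha,\beta$ are regarded as elements of it through this action. Let $\tau_*$ be the Farey tesselation with a fixed doe $e_*$. Every tesselation with doe is $h(\tau_*,e_* )$ for a unique orientation-preserving homeomorphism $h$ of $S^1$ (acting on geodesics through their endpoints), and $f\in\mathrm{PPSL}(2,\mathbb{Z})$ sends the class of $h(\tau_*,e_* )$ to the class of $(h\circ f^{-1})(\tau_*,e_* )$. The move $\alpha$ (respectively $\beta$) is the action of the element $f$ of $\mathrm{PPSL}(2,\mathbb{Z})$ for which $f^{-1}(\tau_*,e_* )$ is the result of applying the move $\alpha$ (respectively $\beta$) to $(\tau_*,e_* )$. Square brackets denote group commutators, $[x,y]=xyx^{-1}y^{-1}$. *)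

theory Defs
  imports
    "HOL-Analysis.Analysis"
    "HOL-Algebra.Bij"
    "HOL-Algebra.Generated_Groups"
begin

section \<open>The group PPSL(2,Z)\<close>

abbreviation S1 :: "complex set" where
  "S1 \<equiv> sphere 0 1"

text \<open>The Cayley transform \<open>z \<mapsto> (z - \<i>) / (z + \<i>)\<close> on the boundary of the upper half plane, in
  projective coordinates: \<open>cayley p q\<close> is the image of \<open>p / q\<close>, and of \<open>\<infinity>\<close> if \<open>q = 0\<close>. Every point
  of \<open>S1\<close> has this form with \<open>(p, q) \<noteq> (0, 0)\<close>, where \<open>(p, q)\<close> is unique up to a nonzero factor.
  The pair \<open>(0, 0)\<close> gives the junk value 0, which is not in \<open>S1\<close>.\<close>

definition cayley :: "real \<Rightarrow> real \<Rightarrow> complex" where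
  "cayley p q = (of_real p - \<i> * of_real q) / (of_real p + \<i> * of_real q)"

definition rational_points :: "complex set" where
  "rational_points = {cayley (of_int p) (of_int q) | p q :: int. (p, q) \<noteq> (0, 0)}"

text \<open>\<open>z\<close> lies to the left of the directed line from \<open>x\<close> to \<open>y\<close>; for three points of \<open>S1\<close>, this says
  that \<open>x, y, z\<close> are distinct and in counter-clockwise cyclic order.\<close>

definition ccw :: "complex \<Rightarrow> complex \<Rightarrow> complex \<Rightarrow> bool" where
  "ccw x y z \<longleftrightarrow> Im ((z - x) * cnj (y - x)) > 0"

definition orientation_preserving :: "(complex \<Rightarrow> complex) \<Rightarrow> bool" where
  "orientation_preserving f \<longleftrightarrow>
     (\<forall>x\<in>S1. \<forall>y\<in>S1. \<forall>z\<in>S1. ccw x y z \<longrightarrow> ccw (f x) (f y) (f z))"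

definition agrees_with_PSL2Z :: "(complex \<Rightarrow> complex) \<Rightarrow> complex set \<Rightarrow> bool" where
  "agrees_with_PSL2Z f A \<longleftrightarrow>
     (\<exists>a b c d :: int. a * d - b * c = 1 \<and>
        (\<forall>p q :: real. (p, q) \<noteq> (0, 0) \<longrightarrow> cayley p q \<in> A \<longrightarrow>
           f (cayley p q) = cayley (of_int a * p + of_int b * q) (of_int c * p + of_int d * q)))"

definition piecewise_PSL2Z :: "(complex \<Rightarrow> complex) \<Rightarrow> bool" where
  "piecewise_PSL2Z f \<longleftrightarrow>
     (\<exists>B. finite B \<and> B \<subseteq> rational_points \<and> (\<forall>C \<in> components (S1 - B). agrees_with_PSL2Z f C))"

text \<open>The product is composition, \<open>f \<otimes> g = f \<circ> g\<close> on \<open>S1\<close>; off \<open>S1\<close> all elements are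
  \<open>undefined\<close> (they lie in \<^term>\<open>extensional S1\<close>), so that equality is equality on \<open>S1\<close>.\<close>

definition PPSL2Z :: "(complex \<Rightarrow> complex) monoid" where
  "PPSL2Z = BijGroup S1
     \<lparr>carrier := {f \<in> Bij S1. homeomorphism S1 S1 f (inv_into S1 f) \<and>
                     orientation_preserving f \<and> piecewise_PSL2Z f}\<rparr>"


section \<open>Tesselations with distinguished oriented edge\<close>

text \<open>A geodesic of the disk is represented by the set of its two endpoints on \<open>S1\<close>, an oriented one
  by the pair (initial point, terminal point).\<close>

type_synonym geodesic = "complex set"
type_synonym oriented_geodesic = "complex \<times> complex"
type_synonym marked_tesselation = "geodesic set \<times> oriented_geodesic"

fun is_doe :: "geodesic set \<Rightarrow> oriented_geodesic \<Rightarrow> bool" where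
  "is_doe \<tau> (S, N) \<longleftrightarrow> {S, N} \<in> \<tau>"

definition farey :: "geodesic set" where
  "farey = {{cayley (of_int p) (of_int q), cayley (of_int r) (of_int s)} | p q r s :: int.
              \<bar>p * s - q * r\<bar> = 1}"

fun map_marked :: "(complex \<Rightarrow> complex) \<Rightarrow> marked_tesselation \<Rightarrow> marked_tesselation" where
  "map_marked h (\<tau>, (S, N)) = ((\<lambda>g. h ` g) ` \<tau>, (h S, h N))"

text \<open>The third vertex of the triangle of \<open>\<tau>\<close> to the left of its edge from \<open>S\<close> to \<open>N\<close>. Edges of a
  tesselation do not cross, so three edges forming an ideal triangle bound one of its pieces.\<close>

definition left_vertex :: "geodesic set \<Rightarrow> complex \<Rightarrow> complex \<Rightarrow> complex" where
  "left_vertex \<tau> S N = (THE W. W \<in> S1 \<and> ccw S N W \<and> {N, W} \<in> \<tau> \<and> {W, S} \<in> \<tau>)"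

fun flip_move :: "marked_tesselation \<Rightarrow> marked_tesselation" where
  "flip_move (\<tau>, (S, N)) =
     (let W = left_vertex \<tau> S N; E = left_vertex \<tau> N S
      in (insert {E, W} (\<tau> - {{S, N}}), (E, W)))"

fun rotate_move :: "marked_tesselation \<Rightarrow> marked_tesselation" where
  "rotate_move (\<tau>, (S, N)) = (\<tau>, (N, left_vertex \<tau> S N))"

text \<open>An element \<open>f\<close> of PPSL(2,Z) sends the class of \<open>h (\<tau>, e)\<close>, where \<open>\<tau>\<close> is the Farey tesselation
  with doe \<open>e\<close>, to the class of \<open>(h \<circ> f\<inverse>) (\<tau>, e)\<close>. The moves commute with orientation-preserving
  homeomorphisms \<open>h\<close>, so a move is the action of the \<open>f\<close> for which \<open>f\<inverse> (\<tau>, e)\<close> is the result of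
  the move on \<open>(\<tau>, e)\<close>.\<close>

definition element_of_move ::
    "(marked_tesselation \<Rightarrow> marked_tesselation) \<Rightarrow> oriented_geodesic \<Rightarrow> complex \<Rightarrow> complex" where
  "element_of_move m e =
     (THE f. f \<in> carrier PPSL2Z \<and> map_marked (inv_into S1 f) (farey, e) = m (farey, e))"

definition alpha :: "oriented_geodesic \<Rightarrow> complex \<Rightarrow> complex" where
  "alpha = element_of_move flip_move"

definition beta :: "oriented_geodesic \<Rightarrow> complex \<Rightarrow> complex" where
  "beta = element_of_move rotate_move"


section \<open>Free groups and presentations\<close>

text \<open>Words in the letters \<open>x\<close>, encoded as \<open>(x, True)\<close>, and \<open>x\<inverse>\<close>, encoded as \<open>(x, False)\<close>.\<close>

type_synonym 'x word = "('x \<times> bool) list"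

definition letter :: "'x \<Rightarrow> 'x word" where
  "letter x = [(x, True)]"

definition word_power :: "'x word \<Rightarrow> nat \<Rightarrow> 'x word" where
  "word_power w n = concat (replicate n w)"

definition word_inverse :: "'x word \<Rightarrow> 'x word" where
  "word_inverse w = rev (map (\<lambda>(x, s). (x, \<not> s)) w)"

definition word_commutator :: "'x word \<Rightarrow> 'x word \<Rightarrow> 'x word" where
  "word_commutator u v = u @ v @ word_inverse u @ word_inverse v"

inductive cancels :: "'x word \<Rightarrow> 'x word \<Rightarrow> bool" where
  "cancels (u @ [(x, s), (x, \<not> s)] @ v) (u @ v)"

definition free_rel :: "('x word \<times> 'x word) set" where
  "free_rel = {(u, v). equivclp cancels u v}"

definition free_class :: "'x word \<Rightarrow> 'x word set" where
  "free_class w = free_rel `` {w}"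

text \<open>The free group on the type \<open>'x\<close>.\<close>

definition free_group :: "'x word set monoid" where
  "free_group =
     \<lparr>carrier = UNIV // free_rel,
      mult = (\<lambda>X Y. \<Union>u\<in>X. \<Union>v\<in>Y. free_class (u @ v)),
      one = free_class []\<rparr>"

definition normal_closure :: "('g, 'm) monoid_scheme \<Rightarrow> 'g set \<Rightarrow> 'g set" where
  "normal_closure G R = \<Inter>{N. N \<lhd> G \<and> R \<subseteq> N}"

text \<open>\<open>G\<close> is presented by the generators \<open>\<gamma> x\<close>, for \<open>x\<close> in the type \<open>'x\<close>, and the relators \<open>R\<close>:
  sending the class of \<open>x\<close> to \<open>\<gamma> x\<close> defines an isomorphism from the quotient of the free group by
  the normal closure of \<open>R\<close> to \<open>G\<close>.\<close>

definition has_presentation ::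
    "('g, 'm) monoid_scheme \<Rightarrow> ('x \<Rightarrow> 'g) \<Rightarrow> 'x word set \<Rightarrow> bool" where
  "has_presentation G \<gamma> R \<longleftrightarrow>
     (let K = normal_closure free_group (free_class ` R)
      in \<exists>\<phi> \<in> iso (free_group Mod K) G.
           \<forall>x. \<phi> (K #>\<^bsub>free_group\<^esub> free_class (letter x)) = \<gamma> x)"

lemma equiv_free_rel: "equiv UNIV free_rel"
  unfolding free_rel_def
proof (rule equivI)
  show "refl {(u, v). equivclp cancels u v}"
    by (simp add: refl_on_def)
  show "sym {(u, v). equivclp cancels u v}"
    by (simp add: sym_def equivclp_sym)
  show "trans {(u, v). equivclp cancels u v}"
    unfolding trans_def by (simp, meson equivclp_trans)
qed simp

lemma free_class_eq_iff: "free_class u = free_class v \<longleftrightarrow> equivclp cancels u v"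
  unfolding free_class_def
  by (subst eq_equiv_class_iff[OF equiv_free_rel]) (auto simp: free_rel_def)

lemma mem_free_class: "u \<in> free_class w \<longleftrightarrow> equivclp cancels w u"
  by (simp add: free_class_def free_rel_def)

lemma equivclp_cancels_append:
  assumes "equivclp cancels u v"
  shows "equivclp cancels (p @ u @ q) (p @ v @ q)"
  using assms
proof (induction rule: equivclp_induct)
  case base
  show ?case by simp
next
  case (step y z)
  have "cancels (p @ y @ q) (p @ z @ q)" if "cancels y z" for y z
    using that cancels.intros[of "p @ _" _ _ "_ @ q"] by cases auto
  with step.hyps have "equivclp cancels (p @ y @ q) (p @ z @ q)"
    by (meson r_into_equivclp equivclp_sym)
  with step.IH show ?case
    by (rule equivclp_trans)
qed

lemma free_class_append_cong:
  assumes "free_class u = free_class u'" "free_class v = free_class v'"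
  shows "free_class (u @ v) = free_class (u' @ v')"
proof -
  have "equivclp cancels (u @ v) (u' @ v)"
    using equivclp_cancels_append[of u u' "[]" v] assms(1) by (simp add: free_class_eq_iff)
  moreover have "equivclp cancels (u' @ v) (u' @ v')"
    using equivclp_cancels_append[of v v' u' "[]"] assms(2) by (simp add: free_class_eq_iff)
  ultimately show ?thesis
    unfolding free_class_eq_iff by (rule equivclp_trans)
qed

lemma mult_free_class: "free_class u \<otimes>\<^bsub>free_group\<^esub> free_class v = free_class (u @ v)"
proof -
  have "free_class (u' @ v') = free_class (u @ v)"
    if "u' \<in> free_class u" "v' \<in> free_class v" for u' v'
  proof (rule free_class_append_cong)
    show "free_class u' = free_class u" "free_class v' = free_class v"
      using that[unfolded mem_free_class, THEN equivclp_sym]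
      unfolding free_class_eq_iff by blast+
  qed
  moreover have "u \<in> free_class u" "v \<in> free_class v"
    by (simp_all add: mem_free_class)
  ultimately have "(\<Union>u'\<in>free_class u. \<Union>v'\<in>free_class v. free_class (u' @ v')) = free_class (u @ v)"
    by blast
  then show ?thesis
    by (simp add: free_group_def)
qed

lemma carrier_free_group: "carrier free_group = range free_class"
  by (auto simp: free_group_def quotient_def free_class_def)

lemma free_class_word_inverse: "free_class (word_inverse w @ w) = free_class []"
proof (induction w)
  case Nil
  show ?case by (simp add: word_inverse_def)
next
  case (Cons l w)
  obtain x s where l: "l = (x, s)" by force
  have "cancels (word_inverse w @ [(x, \<not> s), (x, \<not> \<not> s)] @ w) (word_inverse w @ w)"
    by (rule cancels.intros)
  then have "free_class (word_inverse (l # w) @ l # w) = free_class (word_inverse w @ w)"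
    by (simp add: word_inverse_def l free_class_eq_iff r_into_equivclp)
  with Cons.IH show ?case by simp
qed

lemma group_free_group: "group free_group"
proof (rule groupI)
  have one: "\<one>\<^bsub>free_group\<^esub> = free_class []"
    by (simp add: free_group_def)
  show "\<one>\<^bsub>free_group\<^esub> \<in> carrier (free_group :: 'a word set monoid)"
    by (simp add: one carrier_free_group)
  fix x y z :: "'a word set"
  assume x: "x \<in> carrier free_group"
  show "\<one>\<^bsub>free_group\<^esub> \<otimes>\<^bsub>free_group\<^esub> x = x"
    using x by (auto simp: one carrier_free_group mult_free_class)
  show "\<exists>y\<in>carrier free_group. y \<otimes>\<^bsub>free_group\<^esub> x = \<one>\<^bsub>free_group\<^esub>"
  proof -
    from x obtain w where "x = free_class w"
      by (auto simp: carrier_free_group)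
    then have "free_class (word_inverse w) \<otimes>\<^bsub>free_group\<^esub> x = \<one>\<^bsub>free_group\<^esub>"
      by (simp add: one mult_free_class free_class_word_inverse)
    then show ?thesis
      by (auto simp: carrier_free_group)
  qed
  assume y: "y \<in> carrier free_group"
  show "x \<otimes>\<^bsub>free_group\<^esub> y \<in> carrier free_group"
    using x y by (auto simp: carrier_free_group mult_free_class)
  assume z: "z \<in> carrier free_group"
  show "x \<otimes>\<^bsub>free_group\<^esub> y \<otimes>\<^bsub>free_group\<^esub> z = x \<otimes>\<^bsub>free_group\<^esub> (y \<otimes>\<^bsub>free_group\<^esub> z)"
    using x y z by (auto simp: carrier_free_group mult_free_class)
qed

datatype generator = Gen_alpha | Gen_beta

definition PPSL2Z_relators :: "generator word set" where
  "PPSL2Z_relators =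
     (let a = letter Gen_alpha; b = letter Gen_beta; a2 = word_power a 2; b2 = word_power b 2
      in {word_power a 4,
          word_power b 3,
          word_power (a @ b) 5,
          word_commutator (b @ a @ b) (a2 @ b @ a @ b @ a2),
          word_commutator (b @ a @ b) (a2 @ b2 @ a2 @ b @ a @ b @ a2 @ b @ a2)})"

end

theory Submission
  imports Defs
begin

text \<open>Conjugating by an element of PSL(2,Z) reduces the claim to one doe, for which \<open>\<beta>\<close> is the turn of an
  ideal triangle and \<open>\<alpha>\<close> the piecewise quarter turn of an ideal quadrilateral. Both the relators and the
  generators translate into the presentation of Thompson's group \<open>T\<close> by Cannon, Floyd and Parry: the
  relations bring every word to a normal form \<open>p D\<^sub>n\<^sup>m q\<^sup>-\<^sup>1\<close> with \<open>p, q\<close> positive words, and an element of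
  such a form that acts trivially on the circle is trivial. So no further relations are needed.

  For generation, multiply a given homeomorphism by elements of the generated subgroup, which contains
  PSL(2,Z), until it fixes \<open>\<infinity>\<close>, is affine near \<open>\<infinity>\<close>, has integral breakpoints, and finally takes integral
  values at the integers. What remains is piecewise a translation, hence a translation.\<close>

section \<open>An algebraic normal form\<close>

text \<open>The substitution is \<open>A\<close> = \<beta>\<alpha>^2, \<open>B\<close> = \<beta>^-1
  \<alpha>, \<open>C\<close> = \<beta>^-1. For the doe from \<infinity> to 0, \<open>A\<close>
  becomes the translation x + 1, \<open>B\<close> agrees with it for x \<le> -1 and is the identity
  for x \<ge> 1, and \<open>C\<close> is the turn x -> 1/(1 - x). Moreover \<beta>^-1 and
  \<alpha>^-1 are the first two members \<open>D 0\<close>, \<open>D 1\<close> of a family of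
  torsion elements. Both have finite order, so every element is a product of these two, and normal
  forms only have to survive left multiplication by some \<open>D j\<close>.

  The group defined by the presentation is not known in advance to act faithfully. The normal form
  is therefore derived in an arbitrary group with the relations, and faithfulness uses just a few
  facts about the action at \<infinity>, 1 and their translates.

  Generation is a descent on denominators: the inverse of \<open>B\<close> stretches [0, 1] over
  [-1, 1], cut at the mediant 1/2, and lowers the denominator of each rational strictly between 0
  and 1. The obstacle is that composing with it may create a new break inside a unit interval; the
  determinant condition on Farey intervals excludes this.\<close>

context group
begin

lemma inv_cancel_left:
  "x \<in> carrier G \<Longrightarrow> y \<in> carrier G \<Longrightarrow> inv x \<otimes> (x \<otimes> y) = y"
  "x \<in> carrier G \<Longrightarrow> y \<in> carrier G \<Longrightarrow> x \<otimes> (inv x \<otimes> y) = y"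
  by (simp_all flip: m_assoc)

lemmas word_simps = m_assoc inv_mult_group inv_cancel_left

lemma pow_Suc_left: "x \<in> carrier G \<Longrightarrow> x [^] Suc n = x \<otimes> x [^] (n::nat)"
  using nat_pow_Suc2 by simp

lemma inv_conj_swap:
  assumes [simp]: "x \<in> carrier G" "y \<in> carrier G" "z \<in> carrier G"
    and "x \<otimes> y = y \<otimes> z"
  shows "inv y \<otimes> x = z \<otimes> inv y"
proof -
  have "inv y \<otimes> x = inv y \<otimes> (x \<otimes> y) \<otimes> inv y"
    by (simp add: word_simps)
  also have "\<dots> = z \<otimes> inv y"
    by (simp add: assms(4)) (simp add: word_simps)
  finally show ?thesis .
qed

lemma conj_inv_swap:
  assumes [simp]: "x \<in> carrier G" "y \<in> carrier G" "z \<in> carrier G"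
    and "x \<otimes> y = y \<otimes> z"
  shows "inv x \<otimes> y = y \<otimes> inv z"
proof -
  have "inv x \<otimes> y = inv x \<otimes> (y \<otimes> z) \<otimes> inv z"
    by (simp add: word_simps)
  also have "\<dots> = y \<otimes> inv z"
    by (simp flip: assms(4)) (simp add: word_simps)
  finally show ?thesis .
qed

end

text \<open>The products are bracketed as the recursions for \<open>Y\<close> and \<open>D\<close>
  unfold: \<open>inv A \<otimes> B \<otimes> A\<close> is \<open>Y 1\<close> and
  \<open>inv A \<otimes> C \<otimes> B\<close> is \<open>D 1\<close>. Each of the six relations is
  then a base case for one of the infinite families of relations below.\<close>

locale thompson_relations = group G for G (structure) +
  fixes A B C
  assumes closed [simp]: "A \<in> carrier G" "B \<in> carrier G" "C \<in> carrier G"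
  assumes comm2: "A \<otimes> inv B \<otimes> (inv A \<otimes> B \<otimes> A) = (inv A \<otimes> B \<otimes> A) \<otimes> (A \<otimes> inv B)"
    and comm3: "A \<otimes> inv B \<otimes> (inv A \<otimes> (inv A \<otimes> B \<otimes> A) \<otimes> A) =
      (inv A \<otimes> (inv A \<otimes> B \<otimes> A) \<otimes> A) \<otimes> (A \<otimes> inv B)"
    and C_expand: "C = B \<otimes> (inv A \<otimes> C \<otimes> B)"
    and C2_B: "(inv A \<otimes> C \<otimes> B) \<otimes> (inv A \<otimes> B \<otimes> A) = B \<otimes> (inv A \<otimes> (inv A \<otimes> C \<otimes> B) \<otimes> B)"
    and C_A: "C \<otimes> A = (inv A \<otimes> C \<otimes> B) \<otimes> (inv A \<otimes> C \<otimes> B)"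
    and C_cube: "C \<otimes> (C \<otimes> C) = \<one>"
begin

text \<open>In the notation of Cannon, Floyd and Parry, \<open>Y n\<close> is \<open>X\<^sub>n\<^sub>+\<^sub>1\<close> and \<open>D n\<close> is \<open>C\<^sub>n\<^sub>+\<^sub>1\<close>.\<close>

primrec Y :: "nat \<Rightarrow> 'a" where
  "Y 0 = B"
| "Y (Suc n) = inv A \<otimes> Y n \<otimes> A"

definition X :: "nat \<Rightarrow> 'a" where
  "X n = (case n of 0 \<Rightarrow> A | Suc k \<Rightarrow> Y k)"

primrec D :: "nat \<Rightarrow> 'a" where
  "D 0 = C"
| "D (Suc n) = inv A \<otimes> D n \<otimes> B"

lemma Y_closed [simp]: "Y n \<in> carrier G"
  by (induction n) auto

lemma X_closed [simp]: "X n \<in> carrier G"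
  by (simp add: X_def split: nat.split)

lemma D_closed [simp]: "D n \<in> carrier G"
  by (induction n) auto

declare Y.simps(2) [simp del] D.simps(2) [simp del]

lemma X_0 [simp]: "X 0 = A" and X_Suc: "X (Suc n) = Y n"
  by (simp_all add: X_def)

lemma Y_A: "Y m \<otimes> A = A \<otimes> Y (Suc m)"
  by (simp add: Y.simps(2) word_simps)

text \<open>That \<open>A \<otimes> inv B\<close> commutes with \<open>Y m\<close> means that
  conjugation by \<open>A\<close> and by \<open>B\<close> have the same effect on
  \<open>Y m\<close>; for \<open>A\<close> this effect is the recursion.\<close>

lemma Y_B_of_comm:
  assumes "A \<otimes> inv B \<otimes> Y m = Y m \<otimes> (A \<otimes> inv B)"
  shows "Y m \<otimes> B = B \<otimes> Y (Suc m)"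
proof -
  have "B \<otimes> Y (Suc m) = B \<otimes> inv A \<otimes> (Y m \<otimes> (A \<otimes> inv B)) \<otimes> B"
    by (simp add: Y.simps(2) word_simps)
  also have "\<dots> = Y m \<otimes> B"
    by (simp flip: assms add: word_simps)
  finally show ?thesis by simp
qed

lemma Y_conj:
  assumes "Y m \<otimes> Y k = Y k \<otimes> Y n"
  shows "Y (Suc m) \<otimes> Y (Suc k) = Y (Suc k) \<otimes> Y (Suc n)"
proof -
  have "Y (Suc m) \<otimes> Y (Suc k) = inv A \<otimes> (Y m \<otimes> Y k) \<otimes> A"
    by (simp add: Y.simps(2) word_simps)
  also have "\<dots> = Y (Suc k) \<otimes> Y (Suc n)"
    by (simp add: assms) (simp add: Y.simps(2) word_simps)
  finally show ?thesis .
qed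

text \<open>Only m = 1 and m = 2 are given. For m = l + 2 with l \<ge> 1 the case l yields
  \<open>Y l \<otimes> B = B \<otimes> Y (Suc l)\<close>; conjugated by \<open>A\<close>, this
  exhibits \<open>Y m\<close> as the conjugate of \<open>Y (Suc l)\<close> by \<open>Y 1\<close>,
  and these two commute with \<open>A \<otimes> inv B\<close> by induction.\<close>

lemma Y_comm: "m \<ge> 1 \<Longrightarrow> A \<otimes> inv B \<otimes> Y m = Y m \<otimes> (A \<otimes> inv B)"
proof (induction m rule: less_induct)
  case (less m)
  consider "m = 1" | "m = 2" | l where "m = Suc (Suc l)" "l \<ge> 1"
  proof -
    have "m = 1 \<or> m = 2 \<or> (\<exists>l\<ge>1. m = Suc (Suc l))"
      using less.prems by (cases m; cases "m - 1") auto
    with that show thesis by blast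
  qed
  then show ?case
  proof cases
    case 1
    then show ?thesis using comm2 by (simp add: Y.simps(2))
  next
    case 2
    then show ?thesis using comm3 by (simp add: numeral_2_eq_2 Y.simps(2))
  next
    case 3
    let ?u = "A \<otimes> inv B"
    have "Y l \<otimes> Y 0 = Y 0 \<otimes> Y (Suc l)"
      using less.IH[of l] 3 Y_B_of_comm[of l] by simp
    then have "Y (Suc l) \<otimes> Y 1 = Y 1 \<otimes> Y m"
      using Y_conj[of l 0 "Suc l"] 3 by simp
    then have Ym: "Y m = inv (Y 1) \<otimes> (Y (Suc l) \<otimes> Y 1)"
      by (simp only: inv_cancel_left Y_closed)
    have 1: "?u \<otimes> Y 1 = Y 1 \<otimes> ?u"
      using less.IH[of 1] 3 by simp
    then have 2: "?u \<otimes> inv (Y 1) = inv (Y 1) \<otimes> ?u"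
      using inv_conj_swap[of ?u "Y 1" ?u] by simp
    have 3: "?u \<otimes> Y (Suc l) = Y (Suc l) \<otimes> ?u"
      using less.IH[of "Suc l"] 3 by simp
    have cl: "?u \<in> carrier G" by simp
    have "?u \<otimes> Y m = (?u \<otimes> inv (Y 1)) \<otimes> Y (Suc l) \<otimes> Y 1"
      unfolding Ym using cl by (simp only: m_assoc Y_closed inv_closed m_closed)
    also have "\<dots> = inv (Y 1) \<otimes> (?u \<otimes> Y (Suc l)) \<otimes> Y 1"
      unfolding 2 using cl by (simp only: m_assoc Y_closed inv_closed m_closed)
    also have "\<dots> = inv (Y 1) \<otimes> Y (Suc l) \<otimes> (?u \<otimes> Y 1)"
      unfolding 3 using cl by (simp only: m_assoc Y_closed inv_closed m_closed)
    also have "\<dots> = Y m \<otimes> ?u"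
      unfolding 1 Ym using cl by (simp only: m_assoc Y_closed inv_closed m_closed)
    finally show ?thesis .
  qed
qed

lemma Y_Y: "k < m \<Longrightarrow> Y m \<otimes> Y k = Y k \<otimes> Y (Suc m)"
proof (induction k arbitrary: m)
  case 0
  then show ?case using Y_comm Y_B_of_comm by simp
next
  case (Suc k)
  then obtain m' where "m = Suc m'" "k < m'" by (metis Suc_less_eq2)
  then show ?case using Suc.IH Y_conj by blast
qed

lemma X_X: "k < m \<Longrightarrow> X m \<otimes> X k = X k \<otimes> X (Suc m)"
  by (cases m; cases k) (simp_all add: X_Suc Y_Y Y_A)

text \<open>The map t -> A^-1 t B raises the index of \<open>D\<close>; inserting A A^-1 between the
  two factors lets it raise the index of \<open>X\<close> as well.\<close>

lemma D_expand: "D n = X (Suc n) \<otimes> D (Suc n)"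
proof (induction n)
  case 0
  show ?case unfolding X_Suc Y.simps D.simps by (rule C_expand)
next
  case (Suc n)
  have "X (Suc (Suc n)) \<otimes> D (Suc (Suc n)) = inv A \<otimes> (X (Suc n) \<otimes> D (Suc n)) \<otimes> B"
    by (simp add: X_Suc D.simps(2) Y.simps(2) word_simps)
  also have "\<dots> = D (Suc n)"
    unfolding Suc.IH [symmetric] by (simp add: D.simps(2))
  finally show ?case by (rule sym)
qed

lemma D_X1: "D n \<otimes> X 1 = A \<otimes> D (Suc n)"
  by (simp add: X_Suc D.simps(2) word_simps)

lemma X_B: "k \<ge> 2 \<Longrightarrow> X k \<otimes> B = B \<otimes> X (Suc k)"
  using X_X[of 1 k] by (simp add: X_Suc)

text \<open>The base case is the relation \<open>C2_B\<close>. In the step, \<open>D_expand\<close>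
  splits off an inverse \<open>X\<close> on the left, which then slides past \<open>X 1\<close> at
  the cost of one index.\<close>

lemma D_X2: "D (Suc n) \<otimes> X 2 = X 1 \<otimes> D (Suc (Suc n))"
proof (induction n)
  case 0
  have "X 2 = inv A \<otimes> B \<otimes> A"
    by (simp add: X_Suc numeral_2_eq_2 Y.simps(2))
  then show ?case
    by (simp only: D.simps C2_B) (simp add: X_Suc)
next
  case (Suc n)
  have D_eq: "D (Suc k) = inv (X (Suc k)) \<otimes> D k" for k
    using D_expand[of k] inv_cancel_left(1)[of "X (Suc k)" "D (Suc k)"] by simp
  have swap: "inv (X (Suc (Suc n))) \<otimes> X 1 = X 1 \<otimes> inv (X (Suc (Suc (Suc n))))"
    using X_X[of 1 "Suc (Suc n)"] by (intro conj_inv_swap) simp_all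
  have "D (Suc (Suc n)) \<otimes> X 2 = inv (X (Suc (Suc n))) \<otimes> (D (Suc n) \<otimes> X 2)"
    by (simp add: D_eq[of "Suc n"] m_assoc)
  also have "\<dots> = (inv (X (Suc (Suc n))) \<otimes> X 1) \<otimes> D (Suc (Suc n))"
    by (simp add: Suc.IH m_assoc)
  also have "\<dots> = X 1 \<otimes> D (Suc (Suc (Suc n)))"
    unfolding swap by (simp add: D_eq[of "Suc (Suc n)"] m_assoc)
  finally show ?case .
qed

text \<open>For k \<ge> 2 write \<open>D n\<close> as A^-1 D B with the index of \<open>D\<close>
  lowered. Then \<open>B\<close> slides past \<open>X (Suc k)\<close> and lowers its index, so the
  claim for k - 1 and n - 1 applies, and conjugation by \<open>A\<close> restores the index.\<close>

lemma D_X: "k \<le> n \<Longrightarrow> D n \<otimes> X (Suc k) = X k \<otimes> D (Suc n)"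
proof (induction k arbitrary: n rule: less_induct)
  case (less k)
  consider "k = 0" | "k = 1" | l where "k = Suc (Suc l)"
    by (cases k; cases "k - 1") auto
  then show ?case
  proof cases
    case 1
    then show ?thesis using D_X1 by simp
  next
    case 2
    with less.prems obtain n' where "n = Suc n'" by (cases n) auto
    with 2 show ?thesis using D_X2[of n'] by (simp add: numeral_2_eq_2)
  next
    case 3
    with less.prems obtain n' where n: "n = Suc n'" "Suc l \<le> n'" by (cases n) auto
    have "D n \<otimes> X (Suc k) = inv A \<otimes> (D n' \<otimes> (B \<otimes> X (Suc k)))"
      by (simp add: n D.simps(2) m_assoc)
    also have "\<dots> = inv A \<otimes> (D n' \<otimes> X k) \<otimes> B"
      using X_B[of k] 3 by (simp add: m_assoc)
    also have "\<dots> = inv A \<otimes> X (Suc l) \<otimes> (D n \<otimes> B)"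
      using less.IH[of "Suc l" n'] 3 n by (simp add: m_assoc)
    also have "\<dots> = inv A \<otimes> (X (Suc l) \<otimes> A) \<otimes> D (Suc n)"
      using D_X1[of n] by (simp add: X_Suc m_assoc)
    also have "\<dots> = X k \<otimes> D (Suc n)"
      using Y_A[of l] 3 by (simp add: X_Suc word_simps)
    finally show ?thesis .
  qed
qed

lemma D_A: "D n \<otimes> A = D (Suc n) \<otimes> D (Suc n)"
proof (induction n)
  case 0
  show ?case unfolding X_0 D.simps by (rule C_A)
next
  case (Suc n)
  have D_eq: "D (Suc k) = inv (X (Suc k)) \<otimes> D k" for k
    using D_expand[of k] inv_cancel_left(1)[of "X (Suc k)" "D (Suc k)"] by simp
  have "D (Suc n) \<otimes> A = inv (X (Suc n)) \<otimes> (D n \<otimes> A)"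
    by (simp add: D_eq[of n] m_assoc)
  also have "\<dots> = inv (X (Suc n)) \<otimes> (D (Suc n) \<otimes> X (Suc (Suc n))) \<otimes> D (Suc (Suc n))"
    unfolding Suc.IH using D_expand[of "Suc n"] by (simp add: m_assoc)
  also have "\<dots> = D (Suc (Suc n)) \<otimes> D (Suc (Suc n))"
    using D_X[of "Suc n" "Suc n"] by (simp add: word_simps)
  finally show ?case .
qed

section \<open>Powers of the torsion elements\<close>

lemma D_pow_X:
  "m \<le> k \<Longrightarrow> k \<le> Suc n \<Longrightarrow> D n [^] m \<otimes> X k = X (k - m) \<otimes> D (Suc n) [^] m"
proof (induction m)
  case 0
  then show ?case by simp
next
  case (Suc m)
  have "D n [^] Suc m \<otimes> X k = D n \<otimes> (D n [^] m \<otimes> X k)"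
    unfolding pow_Suc_left[OF D_closed] by (simp add: m_assoc)
  also have "\<dots> = (D n \<otimes> X (Suc (k - Suc m))) \<otimes> D (Suc n) [^] m"
    using Suc by (simp add: m_assoc Suc_diff_Suc)
  also have "\<dots> = X (k - Suc m) \<otimes> D (Suc n) [^] Suc m"
    using D_X[of "k - Suc m" n] Suc.prems
    unfolding pow_Suc_left[OF D_closed] by (simp add: m_assoc)
  finally show ?case .
qed

text \<open>On the circle \<open>D n\<close> turns the ideal polygon with the n + 3 vertices
  \<infinity>, -n, ..., 0, 1 by one step. Passing to \<open>D (Suc n)\<close> adds a vertex; this
  lemma pays for it on the range side of the power, and \<open>D_pow_expand_right\<close> on the
  domain side.\<close>

lemma D_pow_expand_left:
  assumes "1 \<le> m" "m \<le> n + 2"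
  shows "D n [^] m = X (n + 2 - m) \<otimes> D (Suc n) [^] m"
proof -
  obtain l where m: "m = Suc l" using assms by (cases m) auto
  have "D n [^] m = (D n [^] l \<otimes> X (Suc n)) \<otimes> D (Suc n)"
    using D_expand[of n] m by (simp add: m_assoc)
  also have "\<dots> = X (n + 2 - m) \<otimes> D (Suc n) [^] m"
    using D_pow_X[of l "Suc n" n] assms m by (simp add: m_assoc)
  finally show ?thesis .
qed

lemma D_pow_expand_right:
  assumes "1 \<le> m" "m \<le> n + 2"
  shows "D n [^] m \<otimes> X (m - 1) = D (Suc n) [^] Suc m"
proof -
  obtain l where m: "m = Suc l" using assms by (cases m) auto
  have "D n [^] m \<otimes> X (m - 1) = D n \<otimes> (D n [^] l \<otimes> X l)"
    unfolding m pow_Suc_left[OF D_closed] by (simp add: m_assoc)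
  also have "\<dots> = (D n \<otimes> A) \<otimes> D (Suc n) [^] l"
    using D_pow_X[of l l n] assms m by (simp add: m_assoc)
  also have "\<dots> = D (Suc n) [^] Suc m"
    unfolding D_A m pow_Suc_left[OF D_closed] by (simp add: m_assoc)
  finally show ?thesis .
qed

text \<open>With N = n + 2, the left expansion gives \<open>D (Suc n)\<close>^N = A^-1
  \<open>D n\<close>^N, and \<open>D_A\<close> gives \<open>D (Suc n)\<close>^2 = \<open>D n\<close>
  A. Hence the power of \<open>D (Suc n)\<close> with exponent n + 4 is the conjugate by
  \<open>A\<close> of the power of \<open>D n\<close> with exponent n + 3.\<close>

lemma D_pow_order: "D n [^] (n + 3) = \<one>"
proof (induction n)
  case 0
  show ?case using C_cube by (simp add: numeral_3_eq_3 m_assoc)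
next
  case (Suc n)
  have "D n [^] (n + 2) = A \<otimes> D (Suc n) [^] (n + 2)"
    using D_pow_expand_left[of "n + 2" n] by simp
  then have *: "D (Suc n) [^] (n + 2) = inv A \<otimes> D n [^] (n + 2)"
    using inv_cancel_left(1)[of A "D (Suc n) [^] (n + 2)"] by simp
  have "D (Suc n) [^] (n + 2 + Suc (Suc 0)) = D (Suc n) [^] (n + 2) \<otimes> (D (Suc n) \<otimes> D (Suc n))"
    unfolding nat_pow_mult [OF D_closed, symmetric] by simp
  also have "\<dots> = inv A \<otimes> (D n [^] (n + 2) \<otimes> D n) \<otimes> A"
    unfolding D_A [symmetric] * by (simp only: m_assoc closed D_closed inv_closed nat_pow_closed m_closed)
  also have "D n [^] (n + 2) \<otimes> D n = D n [^] (n + 3)"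
    unfolding nat_pow_Suc [symmetric] by (simp add: eval_nat_numeral)
  finally have "D (Suc n) [^] (n + 2 + Suc (Suc 0)) = \<one>"
    unfolding Suc.IH by simp
  moreover have "n + 2 + Suc (Suc 0) = Suc n + 3"
    by simp
  ultimately show ?case
    by metis
qed

lemma D_pow_mod: "D n [^] m = D n [^] (m mod (n + 3))"
proof -
  have "D n [^] m = D n [^] ((n + 3) * (m div (n + 3)) + m mod (n + 3))"
    by simp
  also have "\<dots> = (D n [^] (n + 3)) [^] (m div (n + 3)) \<otimes> D n [^] (m mod (n + 3))"
    by (simp only: nat_pow_mult nat_pow_pow D_closed nat_pow_closed)
  also have "\<dots> = D n [^] (m mod (n + 3))"
    unfolding D_pow_order by simp
  finally show ?thesis .
qed

section \<open>Positive words and multiplication of normal forms\<close>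

inductive_set positive :: "'a set" where
  positive_one: "\<one> \<in> positive"
| positive_X: "p \<in> positive \<Longrightarrow> X k \<otimes> p \<in> positive"

lemma positive_closed [simp]: "p \<in> positive \<Longrightarrow> p \<in> carrier G"
  by (induction rule: positive.induct) auto

lemma positive_mult: "p \<in> positive \<Longrightarrow> q \<in> positive \<Longrightarrow> p \<otimes> q \<in> positive"
  by (induction rule: positive.induct) (auto simp: m_assoc intro: positive.intros)

lemma X_positive: "X k \<in> positive"
  using positive_X[OF positive_one, of k] by simp

text \<open>Raising the index to a common level is what allows powers of different
  \<open>D n\<close> to be multiplied. One level is gained at a time; the exponent is first reduced
  modulo the order, since the expansion is available exactly for exponents from 1 to N + 2.\<close>

lemma D_pow_raise_left:
  "n \<le> N \<Longrightarrow> \<exists>p\<in>positive. \<exists>m'. D n [^] (m::nat) = p \<otimes> D N [^] (m'::nat)"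
proof (induction N rule: dec_induct)
  case base
  show ?case by (intro bexI[of _ \<one>] exI[of _ m]) (auto intro: positive_one)
next
  case (step N)
  then obtain p m' where p: "p \<in> positive" "D n [^] m = p \<otimes> D N [^] (m'::nat)"
    by blast
  define l where "l = m' mod (N + 3)"
  have l: "D n [^] m = p \<otimes> D N [^] l"
    unfolding l_def using p(2) D_pow_mod[of N m'] by metis
  show ?case
  proof (cases "l = 0")
    case True
    then show ?thesis using l p(1) by (intro bexI[of _ p] exI[of _ 0]) auto
  next
    case False
    have "l < N + 3" unfolding l_def by simp
    then have "D n [^] m = (p \<otimes> X (N + 2 - l)) \<otimes> D (Suc N) [^] l"
      using l D_pow_expand_left[of l N] False p(1) by (simp add: m_assoc)
    then show ?thesis using p(1) X_positive positive_mult by blast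
  qed
qed

lemma D_pow_raise_right:
  "n \<le> N \<Longrightarrow> \<exists>q\<in>positive. \<exists>m'. D n [^] (m::nat) = D N [^] (m'::nat) \<otimes> inv q"
proof (induction N rule: dec_induct)
  case base
  show ?case by (intro bexI[of _ \<one>] exI[of _ m]) (auto intro: positive_one)
next
  case (step N)
  then obtain q m' where q: "q \<in> positive" "D n [^] m = D N [^] (m'::nat) \<otimes> inv q"
    by blast
  define l where "l = m' mod (N + 3)"
  have l: "D n [^] m = D N [^] l \<otimes> inv q"
    unfolding l_def using q(2) D_pow_mod[of N m'] by metis
  show ?case
  proof (cases "l = 0")
    case True
    then show ?thesis using l q(1) by (intro bexI[of _ q] exI[of _ 0]) auto
  next
    case False
    have "l < N + 3" unfolding l_def by simp
    have "D N [^] l = D (Suc N) [^] Suc l \<otimes> inv (X (l - 1))"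
    proof -
      have "D N [^] l = D N [^] l \<otimes> X (l - 1) \<otimes> inv (X (l - 1))"
        by (simp add: word_simps)
      with D_pow_expand_right[of l N] False \<open>l < N + 3\<close> show ?thesis
        by (simp del: nat_pow_Suc)
    qed
    then have "D n [^] m = D (Suc N) [^] Suc l \<otimes> inv (q \<otimes> X (l - 1))"
      using l(1) q(1) by (simp add: inv_mult_group m_assoc del: nat_pow_Suc)
    then show ?thesis using q(1) X_positive positive_mult by blast
  qed
qed

text \<open>After raising the level to at least k, an exponent l \<le> k lets \<open>X k\<close>
  slide through the power. If l > k, the last k + 1 factors swallow \<open>X k\<close> and become k
  + 2 factors of the next level, to which the remaining ones are then raised.\<close>

lemma D_pow_mult_X: "\<exists>p\<in>positive. \<exists>n' m'. D n [^] (m::nat) \<otimes> X k = p \<otimes> D n' [^] (m'::nat)"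
proof -
  obtain p m' where p: "p \<in> positive" "D n [^] m = p \<otimes> D (max n k) [^] (m'::nat)"
    using D_pow_raise_left[of n "max n k" m] by auto
  define N where "N = max n k"
  define l where "l = m' mod (N + 3)"
  have l: "D n [^] m = p \<otimes> D N [^] l" "l \<le> N + 2"
  proof -
    show "D n [^] m = p \<otimes> D N [^] l"
      using p(2) D_pow_mod[of N m'] unfolding l_def N_def by metis
    show "l \<le> N + 2"
      using mod_less_divisor[of "N + 3" m'] unfolding l_def by linarith
  qed
  have k: "k \<le> Suc N" unfolding N_def by simp
  show ?thesis
  proof (cases "l \<le> k")
    case True
    then have "D n [^] m \<otimes> X k = (p \<otimes> X (k - l)) \<otimes> D (Suc N) [^] l"
      using l D_pow_X[of l k N] k p(1) by (simp add: m_assoc)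
    then show ?thesis using p(1) X_positive positive_mult by blast
  next
    case False
    define j where "j = l - Suc k"
    have l_eq: "l = j + Suc k" using False by (simp add: j_def)
    have "D N [^] l \<otimes> X k = D N [^] j \<otimes> (D N [^] Suc k \<otimes> X (Suc k - 1))"
      unfolding l_eq nat_pow_mult [OF D_closed, symmetric] by (simp add: m_assoc del: nat_pow_Suc)
    also have "\<dots> = D N [^] j \<otimes> D (Suc N) [^] Suc (Suc k)"
      using D_pow_expand_right[of "Suc k" N] l l_eq by (simp del: nat_pow_Suc)
    finally have *: "D N [^] l \<otimes> X k = D N [^] j \<otimes> D (Suc N) [^] Suc (Suc k)" .
    obtain p' j' where p': "p' \<in> positive" "D N [^] j = p' \<otimes> D (Suc N) [^] (j'::nat)"
      using D_pow_raise_left[of N "Suc N" j] by auto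
    have "D n [^] m \<otimes> X k = (p \<otimes> p') \<otimes> D (Suc N) [^] (j' + Suc (Suc k))"
    proof -
      have "D n [^] m \<otimes> X k = p \<otimes> (D N [^] l \<otimes> X k)"
        unfolding l using p(1) by (simp add: m_assoc)
      then show ?thesis
        unfolding * p' nat_pow_mult [OF D_closed, symmetric]
        using p(1) p'(1) by (simp only: m_assoc positive_closed D_closed m_closed nat_pow_closed)
    qed
    then show ?thesis using p(1) p'(1) positive_mult by blast
  qed
qed

lemma D_pow_mult_positive:
  "p \<in> positive \<Longrightarrow> \<exists>p'\<in>positive. \<exists>n' m'. D n [^] (m::nat) \<otimes> p = p' \<otimes> D n' [^] (m'::nat)"
proof (induction arbitrary: n m rule: positive.induct)
  case positive_one
  show ?case by (intro bexI[of _ \<one>] exI[of _ n] exI[of _ m]) (auto intro: positive.intros)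
next
  case (positive_X p k)
  obtain p1 n1 m1 where 1: "p1 \<in> positive" "D n [^] m \<otimes> X k = p1 \<otimes> D n1 [^] (m1::nat)"
    using D_pow_mult_X by blast
  obtain p2 n2 m2 where 2: "p2 \<in> positive" "D n1 [^] m1 \<otimes> p = p2 \<otimes> D n2 [^] (m2::nat)"
    using positive_X.IH by blast
  have "D n [^] m \<otimes> (X k \<otimes> p) = (D n [^] m \<otimes> X k) \<otimes> p"
    using positive_X.hyps by (simp add: m_assoc)
  also have "\<dots> = p1 \<otimes> (D n1 [^] m1 \<otimes> p)"
    unfolding 1 using 1(1) positive_X.hyps by (simp add: m_assoc)
  also have "\<dots> = (p1 \<otimes> p2) \<otimes> D n2 [^] m2"
    unfolding 2 using 1(1) 2(1) by (simp add: m_assoc)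
  finally show ?case using 1(1) 2(1) positive_mult by blast
qed

definition normal_forms :: "'a set" where
  "normal_forms = {p \<otimes> D n [^] (m::nat) \<otimes> inv q | p q n m. p \<in> positive \<and> q \<in> positive}"

lemma one_normal_form: "\<one> \<in> normal_forms"
  unfolding normal_forms_def
  by (rule CollectI, intro exI[of _ \<one>] exI[of _ 0]) (auto intro: positive_one)

text \<open>The new \<open>D j\<close> is pushed through the positive word p. The power it leaves
  and the old power are raised to a common level, the former shedding a positive factor to the left,
  the latter an inverse positive factor to the right, and the exponents add up.\<close>

lemma D_mult_normal_form:
  assumes "x \<in> normal_forms"
  shows "D j \<otimes> x \<in> normal_forms"
proof -
  obtain p q n m where x: "p \<in> positive" "q \<in> positive" "x = p \<otimes> D n [^] (m::nat) \<otimes> inv q"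
    using assms unfolding normal_forms_def by blast
  obtain p1 n1 m1 where 1: "p1 \<in> positive" "D j \<otimes> p = p1 \<otimes> D n1 [^] (m1::nat)"
    using D_pow_mult_positive[OF x(1), of j 1] by auto
  define N where "N = max n1 n"
  obtain p2 m2 where 2: "p2 \<in> positive" "D n1 [^] m1 = p2 \<otimes> D N [^] (m2::nat)"
    using D_pow_raise_left[of n1 N m1] unfolding N_def by auto
  obtain q3 m3 where 3: "q3 \<in> positive" "D n [^] m = D N [^] (m3::nat) \<otimes> inv q3"
    using D_pow_raise_right[of n N m] unfolding N_def by auto
  have "D j \<otimes> x = (D j \<otimes> p) \<otimes> (D n [^] m \<otimes> inv q)"
    using x by (simp add: m_assoc)
  also have "\<dots> = p1 \<otimes> D n1 [^] m1 \<otimes> (D n [^] m \<otimes> inv q)"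
    unfolding 1 ..
  also have "\<dots> = (p1 \<otimes> p2) \<otimes> D N [^] (m2 + m3) \<otimes> inv (q \<otimes> q3)"
    unfolding 2 3 using x(1,2) 1(1) 2(1) 3(1) by (simp add: m_assoc inv_mult_group flip: nat_pow_mult)
  finally show ?thesis
    unfolding normal_forms_def using x(1,2) 1(1) 2(1) 3(1) positive_mult by blast
qed

end

section \<open>Actions that detect nontrivial normal forms\<close>

lemma (in group) conj_pow:
  assumes [simp]: "x \<in> carrier G" "y \<in> carrier G"
  shows "(inv y \<otimes> x \<otimes> y) [^] (d::nat) = inv y \<otimes> x [^] d \<otimes> y"
  by (induction d) (simp_all add: word_simps)

text \<open>The model is the circle with \<open>v0\<close> = \<infinity> and \<open>v1\<close> = 1.
  There \<open>A\<close> and \<open>B\<close> fix \<infinity> while \<open>C\<close> moves it;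
  \<open>B\<close> fixes 1, 2, 3, ...; and no positive power of \<open>A\<close> fixes 1 or of
  \<open>B\<close> fixes 0, the point \<open>act (inv A) v1\<close>.\<close>

locale thompson_action = thompson_relations +
  fixes act :: "'a \<Rightarrow> 'p \<Rightarrow> 'p" and P :: "'p set" and v0 v1 :: 'p
  assumes act_closed [simp]: "x \<in> carrier G \<Longrightarrow> p \<in> P \<Longrightarrow> act x p \<in> P"
    and act_one [simp]: "p \<in> P \<Longrightarrow> act \<one> p = p"
    and act_mult [simp]: "x \<in> carrier G \<Longrightarrow> y \<in> carrier G \<Longrightarrow> p \<in> P \<Longrightarrow> act (x \<otimes> y) p = act x (act y p)"
    and v0 [simp]: "v0 \<in> P" and v1 [simp]: "v1 \<in> P"
    and A_v0: "act A v0 = v0" and B_v0: "act B v0 = v0" and C_v0: "act C v0 \<noteq> v0"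
    and B_A_pow_v1: "act B (act (A [^] (i::nat)) v1) = act (A [^] i) v1"
    and A_pow_v1: "d > 0 \<Longrightarrow> act (A [^] (d::nat)) v1 \<noteq> v1"
    and B_pow_v2: "d > 0 \<Longrightarrow> act (B [^] (d::nat)) (act (inv A) v1) \<noteq> act (inv A) v1"
begin

lemma act_inv_cancel [simp]:
  assumes "x \<in> carrier G" "p \<in> P"
  shows "act (inv x) (act x p) = p" "act x (act (inv x) p) = p"
  using act_mult[of "inv x" x p] act_mult[of x "inv x" p] assms by (simp_all del: act_mult)

lemma act_inv_fixed: "x \<in> carrier G \<Longrightarrow> p \<in> P \<Longrightarrow> act x p = p \<Longrightarrow> act (inv x) p = p"
  by (metis act_inv_cancel(1))

lemma act_inj: "x \<in> carrier G \<Longrightarrow> p \<in> P \<Longrightarrow> q \<in> P \<Longrightarrow> act x p = act x q \<longleftrightarrow> p = q"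
  by (metis act_inv_cancel(1))

text \<open>On the circle \<open>w j\<close> is the point 1 - j, so that \<open>v\<close> runs
  through \<infinity>, 1, 0, -1, -2, .... The generator \<open>X k\<close> fixes the first k + 1 of
  these points and none of its positive powers fixes the next one.\<close>

primrec w :: "nat \<Rightarrow> 'p" where
  "w 0 = v1"
| "w (Suc j) = act (inv A) (w j)"

definition v :: "nat \<Rightarrow> 'p" where
  "v j = (case j of 0 \<Rightarrow> v0 | Suc i \<Rightarrow> w i)"

lemma w_closed [simp]: "w j \<in> P"
  by (induction j) auto

lemma v_closed [simp]: "v j \<in> P"
  by (simp add: v_def split: nat.split)

lemma Y_A_pow_v1: "act (Y k) (act (A [^] (i::nat)) v1) = act (A [^] i) v1"
proof (induction k arbitrary: i)
  case 0
  then show ?case using B_A_pow_v1 by simp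
next
  case (Suc k)
  have eq: "act A (act (A [^] i) v1) = act (A [^] Suc i) v1"
    unfolding pow_Suc_left[OF closed(1)] by simp
  have "act (Y (Suc k)) (act (A [^] i) v1) = act (inv A) (act (Y k) (act A (act (A [^] i) v1)))"
    by (simp add: Y.simps(2))
  also have "\<dots> = act (inv A) (act A (act (A [^] i) v1))"
    unfolding eq Suc.IH ..
  finally show ?case by simp
qed

lemma Y_w: "j \<le> k \<Longrightarrow> act (Y k) (w j) = w j"
proof (induction k arbitrary: j)
  case 0
  then show ?case using Y_A_pow_v1[of 0 0] by simp
next
  case (Suc k)
  show ?case
  proof (cases j)
    case 0
    then show ?thesis using Y_A_pow_v1[of "Suc k" 0] by simp
  next
    case (Suc i)
    then show ?thesis using Suc.IH[of i] Suc.prems by (simp add: Y.simps(2))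
  qed
qed

lemma Y_pow_w: "d > 0 \<Longrightarrow> act (Y k [^] (d::nat)) (w (Suc k)) \<noteq> w (Suc k)"
proof (induction k)
  case 0
  then show ?case using B_pow_v2 by simp
next
  case (Suc k)
  have "act (Y (Suc k) [^] d) (w (Suc (Suc k))) = act (inv A) (act (Y k [^] d) (w (Suc k)))"
    by (simp add: Y.simps(2) conj_pow)
  then show ?case using Suc by (simp add: act_inj)
qed

lemma Y_v0: "act (Y k) v0 = v0"
  by (induction k) (simp_all add: Y.simps(2) A_v0 B_v0 act_inv_fixed)

lemma X_v: "j \<le> k \<Longrightarrow> act (X k) (v j) = v j"
  by (cases k; cases j) (simp_all add: v_def X_Suc A_v0 Y_v0 Y_w)

lemma X_pow_v: "d > 0 \<Longrightarrow> act (X k [^] (d::nat)) (v (Suc k)) \<noteq> v (Suc k)"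
  by (cases k) (simp_all add: v_def X_Suc A_pow_v1 Y_pow_w del: w.simps(2))

lemma X_v0: "act (X k) v0 = v0"
  using X_v[of 0 k] by (simp add: v_def)

lemma positive_v0: "p \<in> positive \<Longrightarrow> act p v0 = v0"
  by (induction rule: positive.induct) (simp_all add: X_v0)

text \<open>Words with increasing indices, the classical normal form for the positive monoid of
  Thompson's group F. Zero exponents are allowed, so that gaps between the indices need no rule of
  their own.\<close>

inductive sorted_from :: "nat \<Rightarrow> 'a \<Rightarrow> bool" where
  sorted_one: "sorted_from n \<one>"
| sorted_pow: "sorted_from (Suc n) x \<Longrightarrow> sorted_from n (X n [^] (i::nat) \<otimes> x)"

lemma sorted_closed [simp]: "sorted_from n x \<Longrightarrow> x \<in> carrier G"
  by (induction rule: sorted_from.induct) auto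

lemma sorted_cases:
  assumes "sorted_from n x"
  obtains i :: nat and y where "sorted_from (Suc n) y" "x = X n [^] i \<otimes> y"
proof (cases "x = \<one>")
  case True
  then show ?thesis using that[of \<one> 0] by (simp add: sorted_one)
next
  case False
  from assms show ?thesis
    by (cases rule: sorted_from.cases) (use False that in auto)
qed

lemma sorted_X: "n \<le> k \<Longrightarrow> sorted_from n (X k)"
proof (induction n rule: inc_induct)
  case base
  then show ?case using sorted_pow[OF sorted_one, of k 1] by simp
next
  case (step n)
  then show ?case using sorted_pow[of n "X k" 0] by simp
qed

lemma X_X_pow: "k < m \<Longrightarrow> X m \<otimes> X k [^] (i::nat) = X k [^] i \<otimes> X (m + i)"
proof (induction i)
  case (Suc i)
  have "X m \<otimes> X k [^] Suc i = (X m \<otimes> X k [^] i) \<otimes> X k"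
    by (simp add: m_assoc)
  also have "\<dots> = X k [^] i \<otimes> (X (m + i) \<otimes> X k)"
    by (simp add: Suc m_assoc)
  also have "\<dots> = X k [^] Suc i \<otimes> X (m + Suc i)"
    using Suc.prems by (simp add: X_X m_assoc)
  finally show ?case .
qed simp

text \<open>Insertion into a sorted word: a letter with k > n slides to the right past the leading
  power of \<open>X n\<close>, its index growing by the exponent. It stays above n, so the insertion
  continues in the remaining word.\<close>

lemma sorted_X_mult: "sorted_from n x \<Longrightarrow> n \<le> k \<Longrightarrow> sorted_from n (X k \<otimes> x)"
proof (induction arbitrary: k rule: sorted_from.induct)
  case (sorted_one n)
  then show ?case by (simp add: sorted_X)
next
  case (sorted_pow n x i)
  show ?case
  proof (cases "k = n")
    case True
    have "X k \<otimes> (X n [^] i \<otimes> x) = X n [^] Suc i \<otimes> x"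
      unfolding True pow_Suc_left[OF X_closed] using sorted_pow.hyps by (simp add: m_assoc)
    then show ?thesis
      using sorted_from.sorted_pow[OF sorted_pow.hyps, of "Suc i"] by simp
  next
    case False
    have "X k \<otimes> (X n [^] i \<otimes> x) = X n [^] i \<otimes> (X (k + i) \<otimes> x)"
      using X_X_pow[of n k i] False sorted_pow by (simp flip: m_assoc)
    moreover have "sorted_from (Suc n) (X (k + i) \<otimes> x)"
      using sorted_pow.IH sorted_pow.prems False by simp
    ultimately show ?thesis
      using sorted_from.sorted_pow by simp
  qed
qed

lemma positive_sorted: "p \<in> positive \<Longrightarrow> sorted_from 0 p"
  by (induction rule: positive.induct) (auto intro: sorted_one sorted_X_mult)

lemma sorted_v: "sorted_from n x \<Longrightarrow> j \<le> n \<Longrightarrow> act x (v j) = v j"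
proof (induction rule: sorted_from.induct)
  case (sorted_pow n x i)
  have "act (X n [^] i) (v j) = v j"
    by (induction i) (simp_all add: X_v sorted_pow.prems)
  then show ?case using sorted_pow by simp
qed simp

text \<open>The exponent of the first letter is read off at \<open>v (Suc n)\<close>, which all later letters fix.\<close>

lemma sorted_exponent_le:
  assumes "sorted_from (Suc n) x" "sorted_from (Suc n) y"
    and "act (X n [^] (i::nat) \<otimes> x) (v (Suc n)) = act (X n [^] (j::nat) \<otimes> y) (v (Suc n))"
  shows "i \<le> j"
proof (rule ccontr)
  assume "\<not> i \<le> j"
  then obtain d where d: "d > 0" "i = j + d"
    by (metis less_imp_add_positive not_le)
  have "act (X n [^] j) (act (X n [^] d) (v (Suc n))) = act (X n [^] j) (v (Suc n))"
    using assms(3) sorted_v[OF assms(1)] sorted_v[OF assms(2)] assms(1,2)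
    by (simp add: d flip: nat_pow_mult)
  then show False
    using X_pow_v[OF d(1)] by (simp add: act_inj)
qed

lemma sorted_eqI:
  assumes "sorted_from n x" "sorted_from n y" and "\<And>p. p \<in> P \<Longrightarrow> act x p = act y p"
  shows "x = y"
  using assms
proof (induction arbitrary: y rule: sorted_from.induct)
  case (sorted_one n)
  have "act y p = p" if "p \<in> P" for p
    using sorted_one.prems(2)[OF that] that by simp
  with sorted_one.prems(1) show ?case
  proof (induction rule: sorted_from.induct)
    case (sorted_pow n x i)
    have "i \<le> 0"
      using sorted_pow.hyps sorted_pow.prems[of "v (Suc n)"]
      by (intro sorted_exponent_le[of n x \<one> i 0]) (auto intro: sorted_from.sorted_one)
    moreover from this have "act x p = p" if "p \<in> P" for p
      using sorted_pow.prems[OF that] sorted_pow.hyps that by simp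
    ultimately show ?case
      using sorted_pow.IH sorted_pow.hyps by (metis le_zero_eq nat_pow_0 one_closed l_one)
  qed simp
next
  case (sorted_pow n x i)
  obtain j :: nat and z where z: "sorted_from (Suc n) z" "y = X n [^] j \<otimes> z"
    using sorted_cases[OF sorted_pow.prems(1)] by blast
  have eq: "act (X n [^] i \<otimes> x) p = act (X n [^] j \<otimes> z) p" if "p \<in> P" for p
    using sorted_pow.prems(2)[OF that] z(2) by simp
  have "i = j"
    using sorted_exponent_le[OF sorted_pow.hyps z(1) eq] sorted_exponent_le[OF z(1) sorted_pow.hyps eq[symmetric]]
    by simp
  then have "act x p = act z p" if "p \<in> P" for p
    using eq[OF that] that z(1) sorted_pow.hyps by (simp add: act_inj)
  then have "x = z"
    using sorted_pow.IH z(1) by blast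
  then show ?case
    using \<open>i = j\<close> z by simp
qed

text \<open>The orbit of \<open>v0\<close> under \<open>D n\<close> has full length n + 3. As every
  \<open>X k\<close> fixes \<open>v0\<close>, the left expansion transfers the claim to the next
  level for exponents up to n + 2; the one new exponent gives the inverse of
  \<open>D (Suc n)\<close>, and fixing \<open>v0\<close> is inherited by inverses.\<close>

lemma D_pow_v0: "1 \<le> m \<Longrightarrow> m \<le> n + 2 \<Longrightarrow> act (D n [^] (m::nat)) v0 \<noteq> v0"
proof (induction n arbitrary: m)
  case 0
  then consider "m = 1" | "m = 2" by linarith
  then show ?case
  proof cases
    case 1
    then show ?thesis using C_v0 by simp
  next
    case 2
    have "act C (act C (act C v0)) = v0"
      using arg_cong[OF C_cube, of "\<lambda>x. act x v0"] by simp
    with 2 show ?thesis using C_v0 by (auto simp: numeral_2_eq_2)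
  qed
next
  case (Suc n)
  have le: "act (D (Suc n) [^] m) v0 \<noteq> v0" if "1 \<le> m" "m \<le> n + 2" for m :: nat
  proof
    assume "act (D (Suc n) [^] m) v0 = v0"
    then have "act (D n [^] m) v0 = v0"
      unfolding D_pow_expand_left[OF that] using X_v[of 0] by (simp add: v_def)
    then show False using Suc.IH that by blast
  qed
  show ?case
  proof (cases "m \<le> n + 2")
    case True
    then show ?thesis using le Suc.prems by blast
  next
    case False
    then have m: "m = n + 3" using Suc.prems by simp
    show ?thesis
    proof
      assume fixed: "act (D (Suc n) [^] m) v0 = v0"
      have "D (Suc n) \<otimes> D (Suc n) [^] m = \<one>"
        using D_pow_order[of "Suc n"] unfolding m pow_Suc_left[OF D_closed, symmetric] by simp
      then have "act (D (Suc n)) v0 = v0"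
        using fixed act_mult[of "D (Suc n)" "D (Suc n) [^] m" v0] by (simp del: act_mult)
      then show False using le[of 1] by simp
    qed
  qed
qed

theorem normal_form_faithful:
  assumes "x \<in> normal_forms" and triv: "\<And>p. p \<in> P \<Longrightarrow> act x p = p"
  shows "x = \<one>"
proof -
  obtain p q n m where x: "p \<in> positive" "q \<in> positive" "x = p \<otimes> D n [^] (m::nat) \<otimes> inv q"
    using assms(1) unfolding normal_forms_def by blast
  define l where "l = m mod (n + 3)"
  have xl: "x = p \<otimes> D n [^] l \<otimes> inv q" and "l \<le> n + 2"
  proof -
    show "x = p \<otimes> D n [^] l \<otimes> inv q"
      unfolding l_def x(3) D_pow_mod[of n m, symmetric] ..
    show "l \<le> n + 2"
      using mod_less_divisor[of "n + 3" m] unfolding l_def by linarith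
  qed
  have cl: "p \<in> carrier G" "q \<in> carrier G"
    using x by simp_all
  \<comment> \<open>Both positive words fix \<open>v0\<close>, so the power of \<open>D n\<close>
    between them has to fix it too and must be trivial. What is left compares two positive
    words.\<close>
  have "act p (act (D n [^] l) (act (inv q) v0)) = v0"
    using triv[of v0] cl unfolding xl by simp
  then have "act p (act (D n [^] l) v0) = act p v0"
    using positive_v0[OF x(1)] act_inv_fixed[OF cl(2) v0 positive_v0[OF x(2)]] by simp
  then have "act (D n [^] l) v0 = v0"
    using cl by (simp add: act_inj)
  then have "l = 0"
    using D_pow_v0[of l n] \<open>l \<le> n + 2\<close> by fastforce
  then have xpq: "x = p \<otimes> inv q"
    using cl by (simp add: xl)
  have "act p z = act q z" if "z \<in> P" for z
    using triv[of "act q z"] that cl unfolding xpq by simp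
  then have "p = q"
    using sorted_eqI positive_sorted x(1,2) by blast
  then show ?thesis
    using cl by (simp add: xpq)
qed

end

section \<open>Projective coordinates on the circle\<close>

declare mem_sphere [simp del] mem_sphere_0 [simp del]

lemma cayley_denom_nonzero:
  "(p, q) \<noteq> (0, 0) \<Longrightarrow> complex_of_real p + \<i> * of_real q \<noteq> 0"
  by (auto simp: complex_eq_iff)

lemma norm_conj_denom: "cmod (complex_of_real p - \<i> * of_real q) = cmod (complex_of_real p + \<i> * of_real q)"
  by (simp add: cmod_def)

lemma cayley_in_S1 [simp]: "(p, q) \<noteq> (0, 0) \<Longrightarrow> cayley p q \<in> S1"
  using cayley_denom_nonzero[of p q] by (simp add: mem_sphere_0 cayley_def norm_divide norm_conj_denom)

lemma cayley_scale: "k \<noteq> 0 \<Longrightarrow> cayley (k * p) (k * q) = cayley p q"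
proof -
  assume "k \<noteq> 0"
  have "cayley (k * p) (k * q) = (of_real k * (of_real p - \<i> * of_real q)) / (of_real k * (of_real p + \<i> * of_real q))"
    unfolding cayley_def by (simp add: algebra_simps)
  then show ?thesis
    using \<open>k \<noteq> 0\<close> by (simp add: cayley_def)
qed

lemma cayley_minus: "cayley (- p) (- q) = cayley p q"
  using cayley_scale[of "-1" p q] by simp

text \<open>A chord is a determinant times a factor that does not vanish. Both the test for equality
  of points and the formula for the orientation come from this identity.\<close>

lemma cayley_diff:
  assumes "(p, q) \<noteq> (0, 0)" "(r, s) \<noteq> (0, 0)"
  shows "cayley p q - cayley r s =
    2 * \<i> * of_real (p * s - q * r) / ((of_real p + \<i> * of_real q) * (of_real r + \<i> * of_real s))"
  using cayley_denom_nonzero[OF assms(1)] cayley_denom_nonzero[OF assms(2)]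
  unfolding cayley_def by (simp add: diff_frac_eq) (simp add: algebra_simps)

lemma cayley_eq_iff:
  assumes "(p, q) \<noteq> (0, 0)" "(r, s) \<noteq> (0, 0)"
  shows "cayley p q = cayley r s \<longleftrightarrow> p * s = q * r"
proof -
  have "cayley p q = cayley r s \<longleftrightarrow> cayley p q - cayley r s = 0"
    by simp
  also have "\<dots> \<longleftrightarrow> complex_of_real (p * s - q * r) = 0"
    unfolding cayley_diff[OF assms]
    using cayley_denom_nonzero[OF assms(1)] cayley_denom_nonzero[OF assms(2)] by simp
  finally show ?thesis
    unfolding of_real_eq_0_iff by simp
qed

text \<open>After clearing denominators only squared moduli remain in them, so the sign is that of
  the product of \<open>a\<close>, \<open>b\<close> and \<open>Im (cnj U * R)\<close>; the last
  factor is a determinant as well.\<close>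

lemma Im_chord_product:
  assumes "P \<noteq> 0" "R \<noteq> 0" "U \<noteq> 0"
  shows "Im (2 * \<i> * of_real a / (U * P) * cnj (2 * \<i> * of_real b / (R * P))) =
    4 * a * b / ((cmod P)\<^sup>2 * (cmod R)\<^sup>2 * (cmod U)\<^sup>2) * Im (cnj U * R)"
proof -
  have "2 * \<i> * of_real a / (U * P) * cnj (2 * \<i> * of_real b / (R * P)) =
      4 * of_real a * of_real b / ((P * cnj P) * (R * cnj R) * (U * cnj U)) * (cnj U * R)"
    using assms by (simp add: field_simps)
  also have "\<dots> = of_real (4 * a * b / ((cmod P)\<^sup>2 * (cmod R)\<^sup>2 * (cmod U)\<^sup>2)) * (cnj U * R)"
    unfolding of_real_divide of_real_mult complex_norm_square by simp
  finally show ?thesis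
    by (simp only: Im_complex_of_real Re_complex_of_real times_complex.sel)
qed

text \<open>Each pair of coordinates occurs in two of the three determinants, so the sign does not
  depend on the choice of homogeneous coordinates.\<close>

lemma ccw_cayley:
  assumes "(p, q) \<noteq> (0, 0)" "(r, s) \<noteq> (0, 0)" "(u, v) \<noteq> (0, 0)"
  shows "ccw (cayley p q) (cayley r s) (cayley u v) \<longleftrightarrow>
    0 < (p * s - q * r) * (r * v - s * u) * (u * q - v * p)"
proof -
  let ?P = "complex_of_real p + \<i> * of_real q" and ?R = "complex_of_real r + \<i> * of_real s"
    and ?U = "complex_of_real u + \<i> * of_real v"
  have nz: "?P \<noteq> 0" "?R \<noteq> 0" "?U \<noteq> 0"
    using assms cayley_denom_nonzero by blast+
  have "Im ((cayley u v - cayley p q) * cnj (cayley r s - cayley p q)) =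
      4 * (u * q - v * p) * (r * q - s * p) / ((cmod ?P)\<^sup>2 * (cmod ?R)\<^sup>2 * (cmod ?U)\<^sup>2) * Im (cnj ?U * ?R)"
    unfolding cayley_diff[OF assms(3) assms(1)] cayley_diff[OF assms(2) assms(1)]
    by (rule Im_chord_product[OF nz])
  also have "Im (cnj ?U * ?R) = u * s - v * r"
    by simp
  also have "4 * (u * q - v * p) * (r * q - s * p) / ((cmod ?P)\<^sup>2 * (cmod ?R)\<^sup>2 * (cmod ?U)\<^sup>2) * (u * s - v * r) =
      4 / ((cmod ?P)\<^sup>2 * (cmod ?R)\<^sup>2 * (cmod ?U)\<^sup>2) * ((p * s - q * r) * (r * v - s * u) * (u * q - v * p))"
    (is "?a / ?n * ?b = 4 / ?n * ?c")
  proof -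
    have "?a * ?b = 4 * ?c" by (simp add: algebra_simps)
    then show ?thesis by (metis times_divide_eq_left)
  qed
  finally have *: "Im ((cayley u v - cayley p q) * cnj (cayley r s - cayley p q)) =
    4 / ((cmod ?P)\<^sup>2 * (cmod ?R)\<^sup>2 * (cmod ?U)\<^sup>2) * ((p * s - q * r) * (r * v - s * u) * (u * q - v * p))" .
  have pos: "4 / ((cmod ?P)\<^sup>2 * (cmod ?R)\<^sup>2 * (cmod ?U)\<^sup>2) > 0"
    using nz by simp
  show ?thesis
    unfolding ccw_def * using zero_less_mult_pos[OF _ pos] mult_pos_pos[OF pos] by blast
qed

section \<open>The real coordinate and the cyclic order\<close>

definition pt :: "real \<Rightarrow> complex" where "pt x = cayley x 1"

definition ptinf :: complex where "ptinf = cayley 1 0"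

lemma pt_in_S1 [simp]: "pt x \<in> S1" and ptinf_in_S1 [simp]: "ptinf \<in> S1"
  unfolding pt_def ptinf_def by (rule cayley_in_S1; simp)+

lemma pt_eq_iff [simp]: "pt x = pt y \<longleftrightarrow> x = y"
  by (simp add: pt_def cayley_eq_iff)

lemma pt_neq_inf [simp]: "pt x \<noteq> ptinf" "ptinf \<noteq> pt x"
  by (simp_all add: pt_def ptinf_def cayley_eq_iff)

lemma cayley_inf: "p \<noteq> 0 \<Longrightarrow> cayley p 0 = ptinf"
  by (simp add: ptinf_def cayley_eq_iff)

lemma cayley_pt: "q \<noteq> 0 \<Longrightarrow> cayley p q = pt (p / q)"
  by (simp add: pt_def cayley_eq_iff)

lemma S1_cases:
  assumes "z \<in> S1"
  obtains "z = ptinf" | x where "z = pt x"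
proof (cases "z = 1")
  case True
  then have "z = ptinf" by (simp add: ptinf_def cayley_def)
  then show ?thesis using that by blast
next
  case False
  \<comment> \<open>Stereographic projection from 1, which is the image of \<infinity>: this is z =
    (x - \<i>)/(x + \<i>) solved for x.\<close>
  define x where "x = - Im z / (1 - Re z)"
  have n: "(Re z)\<^sup>2 + (Im z)\<^sup>2 = 1"
    using assms by (simp add: mem_sphere_0 cmod_def)
  have "Re z \<noteq> 1"
    using n False by (auto simp: complex_eq_iff)
  then have d: "1 - Re z \<noteq> 0" by simp
  have eq: "(Im z)\<^sup>2 = (1 - Re z) * (1 + Re z)"
    using n by (simp add: algebra_simps power2_eq_square)
  have xx: "x * (1 - Re z) = - Im z"
    unfolding x_def using d by simp
  have "(1 - Re z) * (x * Im z) = (x * (1 - Re z)) * Im z"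
    by simp
  also have "\<dots> = - (Im z)\<^sup>2"
    unfolding xx by (simp add: power2_eq_square)
  also have "\<dots> = (1 - Re z) * (- (1 + Re z))"
    unfolding eq by (simp only: mult_minus_right)
  finally have xy: "x * Im z = - (1 + Re z)"
    using mult_left_cancel[OF d] by blast
  have "z * (of_real x + \<i>) = of_real x - \<i>"
    using xx xy by (simp add: complex_eq_iff algebra_simps)
  moreover have "of_real x + \<i> \<noteq> 0"
    by (auto simp: complex_eq_iff)
  ultimately have "z = pt x"
    unfolding pt_def cayley_def by (simp add: field_simps)
  then show ?thesis using that by blast
qed

lemma S1_cayley:
  assumes "z \<in> S1"
  obtains p q where "(p, q) \<noteq> (0, 0)" "z = cayley p q"
  using S1_cases[OF assms]
  by cases (use that[of 1 0] that[of _ 1] in \<open>auto simp: pt_def ptinf_def\<close>)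

lemma ccw_pt:
  "ccw (pt x) (pt y) (pt z) \<longleftrightarrow> x < y \<and> y < z \<or> y < z \<and> z < x \<or> z < x \<and> x < y"
  unfolding pt_def by (subst ccw_cayley) (auto simp: zero_less_mult_iff mult_less_0_iff)

lemma ccw_inf:
  "ccw ptinf (pt x) (pt y) \<longleftrightarrow> x < y" "ccw (pt x) (pt y) ptinf \<longleftrightarrow> x < y" "ccw (pt y) ptinf (pt x) \<longleftrightarrow> x < y"
  "\<not> ccw ptinf ptinf z" "\<not> ccw ptinf z ptinf" "\<not> ccw z ptinf ptinf"
proof -
  show "ccw ptinf (pt x) (pt y) \<longleftrightarrow> x < y" "ccw (pt x) (pt y) ptinf \<longleftrightarrow> x < y" "ccw (pt y) ptinf (pt x) \<longleftrightarrow> x < y"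
    unfolding pt_def ptinf_def by (subst ccw_cayley; auto simp: zero_less_mult_iff mult_less_0_iff)+
  show "\<not> ccw ptinf ptinf z" "\<not> ccw ptinf z ptinf" "\<not> ccw z ptinf ptinf"
    by (simp_all add: ccw_def algebra_simps)
qed

lemma ccw_total:
  assumes "x \<in> S1" "y \<in> S1" "z \<in> S1" "x \<noteq> y" "y \<noteq> z" "x \<noteq> z"
  shows "ccw x y z \<or> ccw x z y"
  by (rule S1_cases[OF assms(1)]; rule S1_cases[OF assms(2)]; rule S1_cases[OF assms(3)])
    (use assms(4-6) in \<open>auto simp: ccw_pt ccw_inf\<close>)

lemma ccw_asym:
  assumes "x \<in> S1" "y \<in> S1" "z \<in> S1" "ccw x y z"
  shows "\<not> ccw x z y" "x \<noteq> y" "y \<noteq> z" "x \<noteq> z"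
  by (rule S1_cases[OF assms(1)]; rule S1_cases[OF assms(2)]; rule S1_cases[OF assms(3)];
      use assms(4) in \<open>auto simp: ccw_pt ccw_inf\<close>)+

section \<open>Moebius transformations\<close>

text \<open>For \<open>z = cayley p q\<close> the pair \<open>(z + 1, \<i> (z - 1))\<close> is a complex multiple of \<open>(p, q)\<close>, which
  exhibits the projective action as a continuous function of \<open>z\<close>.\<close>

definition mob :: "int \<Rightarrow> int \<Rightarrow> int \<Rightarrow> int \<Rightarrow> complex \<Rightarrow> complex" where
  "mob a b c d z =
    ((of_int a * (z + 1) + of_int b * (\<i> * (z - 1))) - \<i> * (of_int c * (z + 1) + of_int d * (\<i> * (z - 1)))) /
    ((of_int a * (z + 1) + of_int b * (\<i> * (z - 1))) + \<i> * (of_int c * (z + 1) + of_int d * (\<i> * (z - 1))))"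

lemma lin_nonzero:
  assumes "a * d - b * c = (1::int)" "(p, q) \<noteq> (0, 0::real)"
  shows "(of_int a * p + of_int b * q, of_int c * p + of_int d * q) \<noteq> (0, 0)"
proof
  assume "(of_int a * p + of_int b * q, of_int c * p + of_int d * q) = (0, 0)"
  then have 1: "of_int a * p + of_int b * q = 0" "of_int c * p + of_int d * q = 0" by auto
  have "real_of_int (a * d - b * c) = 1"
    using assms(1) by simp
  then have dt: "real_of_int a * of_int d - of_int b * of_int c = 1"
    by simp
  have "p = (real_of_int a * of_int d - of_int b * of_int c) * p" "q = (real_of_int a * of_int d - of_int b * of_int c) * q"
    using dt by simp_all
  moreover have "(real_of_int a * of_int d - of_int b * of_int c) * p =
      of_int d * (of_int a * p + of_int b * q) - of_int b * (of_int c * p + of_int d * q)"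
    "(real_of_int a * of_int d - of_int b * of_int c) * q =
      of_int a * (of_int c * p + of_int d * q) - of_int c * (of_int a * p + of_int b * q)"
    by (simp_all add: algebra_simps)
  ultimately show False using 1 assms(2) by simp
qed

lemma mob_denom_eq:
  assumes "(p, q) \<noteq> (0, 0)"
  defines "k \<equiv> 2 / (complex_of_real p + \<i> * of_real q)"
  shows "cayley p q + 1 = k * of_real p" "\<i> * (cayley p q - 1) = k * of_real q" "k \<noteq> 0"
proof -
  have nz: "complex_of_real p + \<i> * of_real q \<noteq> 0"
    using cayley_denom_nonzero[OF assms(1)] .
  show "cayley p q + 1 = k * of_real p" "\<i> * (cayley p q - 1) = k * of_real q" "k \<noteq> 0"
    unfolding cayley_def k_def using nz by (simp_all add: field_simps)
qed

lemma mob_cayley: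
  assumes "(p, q) \<noteq> (0, 0)"
  shows "mob a b c d (cayley p q) = cayley (of_int a * p + of_int b * q) (of_int c * p + of_int d * q)"
proof -
  obtain k where k: "cayley p q + 1 = k * of_real p" "\<i> * (cayley p q - 1) = k * of_real q" "k \<noteq> 0"
    using mob_denom_eq[OF assms] by blast
  have "mob a b c d (cayley p q) =
      (k * (of_real (of_int a * p + of_int b * q) - \<i> * of_real (of_int c * p + of_int d * q))) /
      (k * (of_real (of_int a * p + of_int b * q) + \<i> * of_real (of_int c * p + of_int d * q)))"
    unfolding mob_def k(1,2) by (simp add: algebra_simps)
  then show ?thesis
    using k(3) by (simp add: cayley_def)
qed

lemma mob_in_S1 [simp]:
  assumes "a * d - b * c = (1::int)" "z \<in> S1"
  shows "mob a b c d z \<in> S1"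
proof -
  obtain p q where pq: "(p, q) \<noteq> (0, 0)" "z = cayley p q"
    using S1_cayley[OF assms(2)] .
  show ?thesis
    unfolding pq(2) mob_cayley[OF pq(1)] by (rule cayley_in_S1[OF lin_nonzero[OF assms(1) pq(1)]])
qed

lemma continuous_on_mob:
  assumes "a * d - b * c = (1::int)"
  shows "continuous_on S1 (mob a b c d)"
proof -
  have "(of_int a * (z + 1) + of_int b * (\<i> * (z - 1))) + \<i> * (of_int c * (z + 1) + of_int d * (\<i> * (z - 1))) \<noteq> 0"
    if z: "z \<in> S1" for z
  proof -
    obtain p q where pq: "(p, q) \<noteq> (0, 0)" "z = cayley p q"
      using S1_cayley[OF z] .
    obtain k where k: "z + 1 = k * of_real p" "\<i> * (z - 1) = k * of_real q" "k \<noteq> 0"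
      using mob_denom_eq[OF pq(1)] pq(2) by blast
    have "(of_int a * (z + 1) + of_int b * (\<i> * (z - 1))) + \<i> * (of_int c * (z + 1) + of_int d * (\<i> * (z - 1))) =
       k * (of_real (of_int a * p + of_int b * q) + \<i> * of_real (of_int c * p + of_int d * q))"
      unfolding k(1,2) by (simp add: algebra_simps)
    then show ?thesis
      using k(3) cayley_denom_nonzero[OF lin_nonzero[OF assms pq(1)]] by simp
  qed
  then show ?thesis
    unfolding mob_def[abs_def] by (intro continuous_intros) blast
qed

lemma mob_mob:
  assumes "a' * d' - b' * c' = (1::int)" "z \<in> S1"
  shows "mob a b c d (mob a' b' c' d' z) =
    mob (a * a' + b * c') (a * b' + b * d') (c * a' + d * c') (c * b' + d * d') z"
proof -
  obtain p q where pq: "(p, q) \<noteq> (0, 0)" "z = cayley p q"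
    using S1_cayley[OF assms(2)] .
  show ?thesis
    unfolding pq(2) mob_cayley[OF pq(1)] mob_cayley[OF lin_nonzero[OF assms(1) pq(1)]]
    by (simp add: algebra_simps)
qed

lemma mob_id: "z \<in> S1 \<Longrightarrow> mob 1 0 0 1 z = z"
  by (rule S1_cayley[of z]) (auto simp: mob_cayley simp del: prod.inject)

lemma mob_inverse:
  assumes "a * d - b * c = (1::int)" "z \<in> S1"
  shows "mob d (- b) (- c) a (mob a b c d z) = z" "mob a b c d (mob d (- b) (- c) a z) = z"
proof -
  have "d * a - b * c = 1" "a * d - c * b = 1" "a * d - b * c = 1" using assms(1) by (simp_all add: mult.commute)
  then show "mob d (- b) (- c) a (mob a b c d z) = z"
    using mob_mob[OF assms(1,2), of d "-b" "-c" a] mob_id[OF assms(2)] by (simp add: algebra_simps)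
  show "mob a b c d (mob d (- b) (- c) a z) = z"
    using mob_mob[of d a "-b" "-c" z a b c d] mob_id[OF assms(2)] assms by (simp add: algebra_simps)
qed

lemma ccw_mob:
  assumes "a * d - b * c = (1::int)" "x \<in> S1" "y \<in> S1" "z \<in> S1"
  shows "ccw (mob a b c d x) (mob a b c d y) (mob a b c d z) \<longleftrightarrow> ccw x y z"
proof -
  obtain p q where x: "(p, q) \<noteq> (0, 0)" "x = cayley p q" using S1_cayley[OF assms(2)] .
  obtain r s where y: "(r, s) \<noteq> (0, 0)" "y = cayley r s" using S1_cayley[OF assms(3)] .
  obtain u v where z: "(u, v) \<noteq> (0, 0)" "z = cayley u v" using S1_cayley[OF assms(4)] .
  have "real_of_int (a * d - b * c) = 1"
    using assms(1) by simp
  then have dt: "real_of_int a * of_int d - of_int b * of_int c = 1"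
    by simp
  have det: "(of_int a * p + of_int b * q) * (of_int c * r + of_int d * s) -
      (of_int c * p + of_int d * q) * (of_int a * r + of_int b * s) = p * s - q * r" for p q r s :: real
  proof -
    have "(of_int a * p + of_int b * q) * (of_int c * r + of_int d * s) -
      (of_int c * p + of_int d * q) * (of_int a * r + of_int b * s) =
      (of_int a * of_int d - of_int b * of_int c) * (p * s - q * r)"
      by (simp add: algebra_simps)
    then show ?thesis using dt by simp
  qed
  show ?thesis
    unfolding x(2) y(2) z(2) mob_cayley[OF x(1)] mob_cayley[OF y(1)] mob_cayley[OF z(1)]
      ccw_cayley[OF x(1) y(1) z(1)]
      ccw_cayley[OF lin_nonzero[OF assms(1) x(1)] lin_nonzero[OF assms(1) y(1)] lin_nonzero[OF assms(1) z(1)]]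
      det ..
qed

section \<open>PPSL(2,Z) is a group\<close>

lemma agrees_iff:
  "agrees_with_PSL2Z f A \<longleftrightarrow>
    (\<exists>a b c d. a * d - b * c = 1 \<and> (\<forall>z\<in>A \<inter> S1. f z = mob a b c d z))"
proof -
  have "(\<forall>p q. (p, q) \<noteq> (0, 0) \<longrightarrow> cayley p q \<in> A \<longrightarrow>
      f (cayley p q) = cayley (of_int a * p + of_int b * q) (of_int c * p + of_int d * q)) \<longleftrightarrow>
    (\<forall>z\<in>A \<inter> S1. f z = mob a b c d z)" for a b c d
  proof (intro iffI ballI allI impI)
    fix z assume *: "\<forall>p q. (p, q) \<noteq> (0, 0) \<longrightarrow> cayley p q \<in> A \<longrightarrow>
      f (cayley p q) = cayley (of_int a * p + of_int b * q) (of_int c * p + of_int d * q)" "z \<in> A \<inter> S1"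
    then obtain p q where pq: "(p, q) \<noteq> (0, 0)" "z = cayley p q"
      using S1_cayley[of z] by blast
    then show "f z = mob a b c d z"
      using * mob_cayley[OF pq(1)] by auto
  next
    fix p q :: real
    assume *: "\<forall>z\<in>A \<inter> S1. f z = mob a b c d z" "(p, q) \<noteq> (0, 0)" "cayley p q \<in> A"
    then show "f (cayley p q) = cayley (of_int a * p + of_int b * q) (of_int c * p + of_int d * q)"
      using cayley_in_S1[OF *(2)] mob_cayley[OF *(2)] by auto
  qed
  then show ?thesis
    unfolding agrees_with_PSL2Z_def by simp
qed

lemma agrees_subset: "agrees_with_PSL2Z f A \<Longrightarrow> C \<subseteq> A \<Longrightarrow> agrees_with_PSL2Z f C"
  unfolding agrees_iff by (meson IntD1 IntD2 IntI subsetD)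

text \<open>Connected sets replace components because their images under continuous maps are again
  connected; composition and inversion of piecewise maps rest on that.\<close>

lemma piecewise_iff:
  "piecewise_PSL2Z f \<longleftrightarrow> (\<exists>B. finite B \<and> B \<subseteq> rational_points \<and>
    (\<forall>C. connected C \<longrightarrow> C \<subseteq> S1 - B \<longrightarrow> agrees_with_PSL2Z f C))"
proof -
  have "agrees_with_PSL2Z f C"
    if all: "\<forall>C\<in>components (S1 - B). agrees_with_PSL2Z f C" and C: "connected C" "C \<subseteq> S1 - B" for B C
  proof (cases "C = {}")
    case True
    then show ?thesis
      unfolding agrees_iff by (intro exI[of _ 1] exI[of _ 0]) auto
  next
    case False
    with C obtain K where "K \<in> components (S1 - B)" "C \<subseteq> K"
      using exists_component_superset[OF C(2) _ C(1)] by auto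
    then show ?thesis using all agrees_subset by blast
  qed
  moreover have "C \<in> components (S1 - B) \<Longrightarrow> connected C \<and> C \<subseteq> S1 - B" for B C
    using in_components_connected in_components_subset by blast
  ultimately show ?thesis
    unfolding piecewise_PSL2Z_def by meson
qed

lemma rational_pointsE:
  assumes "z \<in> rational_points"
  obtains p q :: int where "(p, q) \<noteq> (0, 0)" "(real_of_int p, real_of_int q) \<noteq> (0, 0)" "z = cayley (of_int p) (of_int q)"
proof -
  obtain p q :: int where "(p, q) \<noteq> (0, 0)" "z = cayley (of_int p) (of_int q)"
    using assms unfolding rational_points_def by blast
  then show ?thesis using that[of p q] by simp
qed

lemma rational_pointsI: "(p, q) \<noteq> (0, 0 :: int) \<Longrightarrow> cayley (of_int p) (of_int q) \<in> rational_points"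
  unfolding rational_points_def by blast

lemma rational_points_S1: "rational_points \<subseteq> S1"
  using rational_pointsE cayley_in_S1 by (metis subsetI)

lemma mob_rational:
  assumes "a * d - b * c = 1" "z \<in> rational_points"
  shows "mob a b c d z \<in> rational_points"
proof -
  obtain p q :: int where pq: "(real_of_int p, real_of_int q) \<noteq> (0, 0)" "z = cayley (of_int p) (of_int q)"
    using rational_pointsE[OF assms(2)] by metis
  have "mob a b c d z = cayley (of_int (a * p + b * q)) (of_int (c * p + d * q))"
    unfolding pq(2) mob_cayley[OF pq(1)] by simp
  moreover have "(a * p + b * q, c * p + d * q) \<noteq> (0, 0)"
  proof
    assume "(a * p + b * q, c * p + d * q) = (0, 0)"
    then have "real_of_int (a * p + b * q) = 0" "real_of_int (c * p + d * q) = 0"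
      by simp_all
    then show False using lin_nonzero[OF assms(1) pq(1)] by simp
  qed
  ultimately show ?thesis using rational_pointsI by metis
qed

lemma mob_rational_iff:
  assumes "a * d - b * c = 1" "z \<in> S1"
  shows "mob a b c d z \<in> rational_points \<longleftrightarrow> z \<in> rational_points"
proof
  assume "mob a b c d z \<in> rational_points"
  moreover have "d * a - - b * - c = 1" using assms(1) by (simp add: mult.commute)
  ultimately show "z \<in> rational_points"
    using mob_rational[of d a "-b" "-c" "mob a b c d z"] mob_inverse[OF assms] by simp
qed (rule mob_rational[OF assms(1)])

section \<open>Limits and breakpoints in the real coordinate\<close>

lemma continuous_on_pt: "continuous_on UNIV pt"
proof -
  have "complex_of_real x + \<i> \<noteq> 0" for x
    by (auto simp: complex_eq_iff)
  then show ?thesis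
    unfolding pt_def[abs_def] cayley_def by (auto intro!: continuous_intros)
qed

lemma tendsto_pt: "(pt \<longlongrightarrow> pt x) (at x within T)"
  using continuous_on_pt by (meson continuous_on_def continuous_on_subset UNIV_I subset_UNIV tendsto_within_subset)

lemma tendsto_pt_infinity:
  assumes "filterlim X at_infinity F"
  shows "((\<lambda>t. pt (X t)) \<longlongrightarrow> ptinf) F"
proof -
  have inv: "((\<lambda>t. inverse (X t)) \<longlongrightarrow> 0) F"
    using assms by (rule filterlim_compose[OF tendsto_inverse_0])
  have "((\<lambda>t. cayley 1 (inverse (X t))) \<longlongrightarrow> (of_real 1 - \<i> * of_real 0) / (of_real 1 + \<i> * of_real 0)) F"
    unfolding cayley_def by (intro tendsto_intros inv) simp
  then have "((\<lambda>t. cayley 1 (inverse (X t))) \<longlongrightarrow> ptinf) F"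
    by (simp add: ptinf_def cayley_def)
  moreover have "eventually (\<lambda>t. X t \<noteq> 0) F"
    using assms by (rule filterlim_at_infinity_imp_eventually_ne)
  then have "eventually (\<lambda>t. cayley 1 (inverse (X t)) = pt (X t)) F"
    by (rule eventually_mono) (simp add: pt_def cayley_eq_iff)
  ultimately show ?thesis
    by (rule Lim_transform_eventually)
qed

text \<open>A piece is given without its end points, and continuity extends its formula to them.
  Stated for a filter, this covers one-sided limits at a real point as well as limits towards
  \<infinity>.\<close>

lemma agree_at_limit:
  assumes "continuous_on S1 f" "a * d - b * c = 1" "(X \<longlongrightarrow> z) F" "F \<noteq> bot" "z \<in> S1"
    and "eventually (\<lambda>t. X t \<in> S1 \<and> f (X t) = mob a b c d (X t)) F"
  shows "f z = mob a b c d z"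
proof -
  have ev: "eventually (\<lambda>t. X t \<in> S1) F"
    using assms(6) by (rule eventually_mono) simp
  have 1: "((\<lambda>t. f (X t)) \<longlongrightarrow> f z) F"
    using continuous_on_tendsto_compose[OF assms(1,3,5) ev] .
  have 2: "((\<lambda>t. mob a b c d (X t)) \<longlongrightarrow> mob a b c d z) F"
    using continuous_on_tendsto_compose[OF continuous_on_mob[OF assms(2)] assms(3,5) ev] .
  have 3: "eventually (\<lambda>t. mob a b c d (X t) = f (X t)) F"
    using assms(6) by (rule eventually_mono) simp
  show ?thesis
    by (rule tendsto_unique[OF assms(4) 1 Lim_transform_eventually[OF 2 3]])
qed

text \<open>The image of a set of reals under \<open>pt\<close> never meets \<infinity>, so a break
  there drops out and a finite set of reals describes all others.\<close>

lemma piecewise_breakpoints: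
  assumes "piecewise_PSL2Z f"
  shows "\<exists>R. finite R \<and> pt ` R \<subseteq> rational_points \<and>
    (\<forall>I. connected I \<longrightarrow> I \<inter> R = {} \<longrightarrow> agrees_with_PSL2Z f (pt ` I))"
proof -
  obtain B where B: "finite B" "B \<subseteq> rational_points"
    "\<And>C. connected C \<Longrightarrow> C \<subseteq> S1 - B \<Longrightarrow> agrees_with_PSL2Z f C"
    using assms unfolding piecewise_iff by blast
  show ?thesis
  proof (intro exI[of _ "pt -` B"] conjI allI impI)
    show "finite (pt -` B)"
      using B(1) by (rule finite_vimageI) (simp add: inj_def)
    show "pt ` (pt -` B) \<subseteq> rational_points"
      using B(2) by blast
    fix I :: "real set" assume I: "connected I" "I \<inter> pt -` B = {}"
    show "agrees_with_PSL2Z f (pt ` I)"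
    proof (rule B(3))
      show "connected (pt ` I)"
        using I(1) continuous_on_pt by (meson connected_continuous_image continuous_on_subset subset_UNIV)
      show "pt ` I \<subseteq> S1 - B"
        using I(2) by auto
    qed
  qed
qed

lemma finite_gap_right:
  assumes "finite (R :: real set)"
  obtains y where "x < y" "{x<..<y} \<inter> R = {}"
proof (cases "\<exists>r\<in>R. x < r")
  case True
  define y where "y = Min {r \<in> R. x < r}"
  have "finite {r \<in> R. x < r}" "{r \<in> R. x < r} \<noteq> {}"
    using assms True by auto
  then have "y \<in> {r \<in> R. x < r}" "\<And>r. r \<in> R \<Longrightarrow> x < r \<Longrightarrow> y \<le> r"
    unfolding y_def using Min_in by (blast, auto)
  then show ?thesis using that[of y] by force
next
  case False
  then show ?thesis using that[of "x + 1"] by force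
qed

lemma finite_gap_infinity:
  assumes "finite (R :: real set)"
  shows "\<exists>N :: nat. {real N<..} \<inter> R = {} \<and> {..<- real N} \<inter> R = {}"
proof -
  obtain M where M: "\<And>r. r \<in> R \<Longrightarrow> norm r \<le> M"
    using finite_imp_bounded[OF assms] unfolding bounded_iff by blast
  obtain N :: nat where "M \<le> real N"
    using real_arch_simple by blast
  have "\<bar>r\<bar> \<le> real N" if "r \<in> R" for r
    using M[OF that] \<open>M \<le> real N\<close> by simp
  then show ?thesis
    by (intro exI[of _ N]) fastforce
qed

lemma agrees_pt_iff:
  "agrees_with_PSL2Z f (pt ` I) \<longleftrightarrow>
    (\<exists>a b c d. a * d - b * c = 1 \<and> (\<forall>x\<in>I. f (pt x) = mob a b c d (pt x)))"
proof -
  have "pt ` I \<inter> S1 = pt ` I"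
    using pt_in_S1 by blast
  then show ?thesis
    unfolding agrees_iff by simp
qed

text \<open>At a breakpoint no formula is given for \<open>f\<close>. The value is the limit of the
  piece to the right of it, or along large reals at \<infinity>, hence the image of a rational point
  under an integral matrix.\<close>

lemma piecewise_rational:
  assumes f: "continuous_on S1 f" "piecewise_PSL2Z f" and z: "z \<in> rational_points"
  shows "f z \<in> rational_points"
proof -
  obtain R where R: "finite R" "pt ` R \<subseteq> rational_points"
    "\<And>I. connected I \<Longrightarrow> I \<inter> R = {} \<Longrightarrow> agrees_with_PSL2Z f (pt ` I)"
    using piecewise_breakpoints[OF f(2)] by blast
  have "z \<in> S1" using z rational_points_S1 by blast
  then show ?thesis
  proof (cases rule: S1_cases)
    case 1
    obtain N :: nat where "{real N<..} \<inter> R = {}"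
      using finite_gap_infinity[OF R(1)] by blast
    then obtain a b c d where m: "a * d - b * c = 1" "\<forall>x\<in>{real N<..}. f (pt x) = mob a b c d (pt x)"
      using R(3)[of "{real N<..}"] unfolding agrees_pt_iff by auto
    have "f ptinf = mob a b c d ptinf"
    proof (rule agree_at_limit[OF f(1) m(1)])
      show "(pt \<longlongrightarrow> ptinf) at_top"
        by (rule tendsto_pt_infinity) (rule filterlim_at_top_imp_at_infinity[OF filterlim_ident])
      show "\<forall>\<^sub>F t in at_top. pt t \<in> S1 \<and> f (pt t) = mob a b c d (pt t)"
        using eventually_gt_at_top[of "real N"] by (rule eventually_mono) (use m(2) in simp)
    qed simp_all
    then show ?thesis using mob_rational[OF m(1)] z 1 by simp
  next
    case (2 x)
    obtain y where y: "x < y" "{x<..<y} \<inter> R = {}"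
      using finite_gap_right[OF R(1)] .
    then obtain a b c d where m: "a * d - b * c = 1" "\<forall>x\<in>{x<..<y}. f (pt x) = mob a b c d (pt x)"
      using R(3)[of "{x<..<y}"] unfolding agrees_pt_iff by auto
    have "f (pt x) = mob a b c d (pt x)"
    proof (rule agree_at_limit[OF f(1) m(1) tendsto_pt])
      show "\<forall>\<^sub>F t in at_right x. pt t \<in> S1 \<and> f (pt t) = mob a b c d (pt t)"
        by (rule eventually_at_rightI[of x y]) (use m(2) y(1) in auto)
    qed simp_all
    then show ?thesis using mob_rational[OF m(1)] z 2 by simp
  qed
qed

section \<open>Homeomorphisms of the circle and closure under the group operations\<close>

definition circle_homeo :: "(complex \<Rightarrow> complex) \<Rightarrow> bool" where
  "circle_homeo f \<longleftrightarrow> f \<in> Bij S1 \<and> homeomorphism S1 S1 f (inv_into S1 f) \<and> orientation_preserving f"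

lemma carrier_PPSL2Z: "carrier PPSL2Z = {f. circle_homeo f \<and> piecewise_PSL2Z f}"
  by (auto simp: PPSL2Z_def circle_homeo_def)

text \<open>Since the circle is compact, a continuous bijection is a homeomorphism; \<open>g\<close>
  only has to invert \<open>f\<close> as a map of sets.\<close>

lemma circle_homeoI:
  assumes "f \<in> extensional S1" "\<And>x. x \<in> S1 \<Longrightarrow> f x \<in> S1" "\<And>x. x \<in> S1 \<Longrightarrow> g x \<in> S1"
    "\<And>x. x \<in> S1 \<Longrightarrow> g (f x) = x" "\<And>x. x \<in> S1 \<Longrightarrow> f (g x) = x"
    "continuous_on S1 f" "orientation_preserving f"
  shows "circle_homeo f"
proof -
  have bij: "bij_betw f S1 S1"
    by (rule bij_betwI[of _ _ _ g]) (use assms in auto)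
  then have im: "f ` S1 = S1" and inj: "inj_on f S1"
    by (auto simp: bij_betw_def)
  obtain h where h: "homeomorphism S1 S1 f h"
    using homeomorphism_compact[OF compact_sphere assms(6) im inj] by blast
  have "homeomorphism S1 S1 f (inv_into S1 f)"
  proof (rule homeomorphism_cong[OF h])
    fix x assume "x \<in> S1"
    then have "f (h x) = x" "h x \<in> S1"
      using h unfolding homeomorphism_def by auto
    then show "inv_into S1 f x = h x"
      using inv_into_f_f[OF inj, of "h x"] by simp
  qed simp_all
  then show ?thesis
    unfolding circle_homeo_def Bij_def using assms bij by simp
qed

context
  fixes f assumes f: "circle_homeo f"
begin

lemma circle_homeo_facts:
  "f \<in> Bij S1" "f \<in> extensional S1" "continuous_on S1 f" "continuous_on S1 (inv_into S1 f)"
  "bij_betw f S1 S1" "inj_on f S1" "f ` S1 = S1"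
  using f unfolding circle_homeo_def Bij_def homeomorphism_def bij_betw_def by auto

lemma circle_homeo_closed: "x \<in> S1 \<Longrightarrow> f x \<in> S1" "x \<in> S1 \<Longrightarrow> inv_into S1 f x \<in> S1"
  using circle_homeo_facts(7) inv_into_into[of x f S1] by blast+

lemma circle_homeo_inv: "x \<in> S1 \<Longrightarrow> inv_into S1 f (f x) = x" "x \<in> S1 \<Longrightarrow> f (inv_into S1 f x) = x"
  using circle_homeo_facts(6,7) by (metis inv_into_f_f, metis f_inv_into_f)

lemma circle_homeo_eq_iff: "x \<in> S1 \<Longrightarrow> y \<in> S1 \<Longrightarrow> f x = f y \<longleftrightarrow> x = y"
  using circle_homeo_facts(6) by (meson inj_onD)

text \<open>For the converse direction: three distinct points are in exactly one of the two cyclic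
  orders, and the wrong one would be preserved too.\<close>

lemma circle_homeo_ccw:
  assumes "x \<in> S1" "y \<in> S1" "z \<in> S1"
  shows "ccw (f x) (f y) (f z) \<longleftrightarrow> ccw x y z"
proof
  have op: "orientation_preserving f"
    using f by (simp add: circle_homeo_def)
  show "ccw x y z \<Longrightarrow> ccw (f x) (f y) (f z)"
    using op assms unfolding orientation_preserving_def by blast
  assume *: "ccw (f x) (f y) (f z)"
  have "x \<noteq> y" "y \<noteq> z" "x \<noteq> z"
    using ccw_asym(2-4)[OF _ _ _ *] assms circle_homeo_closed by blast+
  moreover have "\<not> ccw x z y"
    using op assms * ccw_asym(1)[OF _ _ _ *] circle_homeo_closed unfolding orientation_preserving_def by blast
  ultimately show "ccw x y z"
    using ccw_total[OF assms] by blast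
qed

lemma circle_homeo_inverse: "circle_homeo (restrict (inv_into S1 f) S1)"
proof (rule circle_homeoI[of _ f])
  show "continuous_on S1 (restrict (inv_into S1 f) S1)"
    using circle_homeo_facts(4) by (simp cong: continuous_on_cong_simp)
  show "orientation_preserving (restrict (inv_into S1 f) S1)"
    unfolding orientation_preserving_def
  proof (intro ballI impI)
    fix x y z assume *: "x \<in> S1" "y \<in> S1" "z \<in> S1" "ccw x y z"
    then have "ccw (f (inv_into S1 f x)) (f (inv_into S1 f y)) (f (inv_into S1 f z))"
      by (simp only: circle_homeo_inv)
    then show "ccw (restrict (inv_into S1 f) S1 x) (restrict (inv_into S1 f) S1 y) (restrict (inv_into S1 f) S1 z)"
      using * circle_homeo_ccw[OF circle_homeo_closed(2) circle_homeo_closed(2) circle_homeo_closed(2)]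
      by simp
  qed
qed (use circle_homeo_closed circle_homeo_inv in auto)

end

lemma circle_homeo_compose:
  assumes f: "circle_homeo f" and g: "circle_homeo g"
  shows "circle_homeo (compose S1 f g)"
proof (rule circle_homeoI[of _ "\<lambda>x. inv_into S1 g (inv_into S1 f x)"])
  have "continuous_on S1 (f \<circ> g)"
    using circle_homeo_facts(3,7)[OF f] circle_homeo_facts(3,7)[OF g] by (intro continuous_on_compose) auto
  then show "continuous_on S1 (compose S1 f g)"
    by (simp add: compose_def o_def cong: continuous_on_cong_simp)
  show "orientation_preserving (compose S1 f g)"
    unfolding orientation_preserving_def
    using circle_homeo_ccw[OF f] circle_homeo_ccw[OF g] circle_homeo_closed(1)[OF g]
    by (simp add: compose_def)
qed (use circle_homeo_closed[OF f] circle_homeo_closed[OF g] circle_homeo_inv[OF f] circle_homeo_inv[OF g]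
    in \<open>auto simp: compose_def\<close>)

lemma piecewise_compose:
  assumes f: "circle_homeo f" "piecewise_PSL2Z f" and g: "circle_homeo g" "piecewise_PSL2Z g"
  shows "piecewise_PSL2Z (compose S1 f g)"
proof -
  obtain B where B: "finite B" "B \<subseteq> rational_points"
    "\<And>C. connected C \<Longrightarrow> C \<subseteq> S1 - B \<Longrightarrow> agrees_with_PSL2Z f C"
    using f(2) unfolding piecewise_iff by blast
  obtain B' where B': "finite B'" "B' \<subseteq> rational_points"
    "\<And>C. connected C \<Longrightarrow> C \<subseteq> S1 - B' \<Longrightarrow> agrees_with_PSL2Z g C"
    using g(2) unfolding piecewise_iff by blast
  \<comment> \<open>The composite can break where \<open>g\<close> breaks or where \<open>g\<close>
    takes a breakpoint of \<open>f\<close> as its value.\<close>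
  let ?B = "B' \<union> (g -` B \<inter> S1)"
  show ?thesis
    unfolding piecewise_iff
  proof (intro exI[of _ ?B] conjI allI impI)
    show "finite ?B"
      using B(1) B'(1) finite_vimage_IntI[OF B(1) circle_homeo_facts(6)[OF g(1)]] by simp
    show "?B \<subseteq> rational_points"
    proof
      fix z assume z: "z \<in> ?B"
      show "z \<in> rational_points"
      proof (cases "z \<in> B'")
        case False
        then have z': "z \<in> S1" "g z \<in> rational_points"
          using z B(2) by auto
        \<comment> \<open>A single point is connected. Away from the breaks of \<open>g\<close>, it
          follows that \<open>g z\<close> is the image of z under an integral matrix, and
          rationality of \<open>g z\<close> passes back to z.\<close>
        have "agrees_with_PSL2Z g {z}"
          using B'(3)[of "{z}"] False z'(1) by auto
        then obtain a b c d where "a * d - b * c = 1" "g z = mob a b c d z"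
          unfolding agrees_iff using z' by auto
        then show ?thesis using mob_rational_iff z' by metis
      qed (use B'(2) in blast)
    qed
    fix C assume C: "connected C" "C \<subseteq> S1 - ?B"
    have "agrees_with_PSL2Z g C"
      using B'(3) C by blast
    then obtain a b c d where m: "a * d - b * c = 1" "\<forall>z\<in>C \<inter> S1. g z = mob a b c d z"
      unfolding agrees_iff by blast
    have "connected (g ` C)"
      using C circle_homeo_facts(3)[OF g(1)] by (meson connected_continuous_image continuous_on_subset Diff_subset subset_trans)
    moreover have "g ` C \<subseteq> S1 - B"
      using C(2) circle_homeo_closed(1)[OF g(1)] by auto
    ultimately have "agrees_with_PSL2Z f (g ` C)"
      using B(3) by blast
    then obtain a' b' c' d' where m': "a' * d' - b' * c' = 1" "\<forall>z\<in>g ` C \<inter> S1. f z = mob a' b' c' d' z"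
      unfolding agrees_iff by blast
    show "agrees_with_PSL2Z (compose S1 f g) C"
      unfolding agrees_iff
    proof (intro exI conjI ballI)
      show "(a' * a + b' * c) * (c' * b + d' * d) - (a' * b + b' * d) * (c' * a + d' * c) = 1"
      proof -
        have "(a' * a + b' * c) * (c' * b + d' * d) - (a' * b + b' * d) * (c' * a + d' * c) =
            (a' * d' - b' * c') * (a * d - b * c)"
          by (simp add: algebra_simps)
        then show ?thesis using m(1) m'(1) by simp
      qed
      fix z assume z: "z \<in> C \<inter> S1"
      then have "f (g z) = mob a' b' c' d' (mob a b c d z)"
        using m(2) m'(2) circle_homeo_closed(1)[OF g(1)] by (metis IntD1 IntD2 IntI imageI)
      then show "compose S1 f g z = mob (a' * a + b' * c) (a' * b + b' * d) (c' * a + d' * c) (c' * b + d' * d) z"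
        using z mob_mob[OF m(1)] by (simp add: compose_def)
    qed
  qed
qed

lemma piecewise_inverse:
  assumes f: "circle_homeo f" "piecewise_PSL2Z f"
  shows "piecewise_PSL2Z (restrict (inv_into S1 f) S1)"
proof -
  obtain B where B: "finite B" "B \<subseteq> rational_points"
    "\<And>C. connected C \<Longrightarrow> C \<subseteq> S1 - B \<Longrightarrow> agrees_with_PSL2Z f C"
    using f(2) unfolding piecewise_iff by blast
  let ?g = "inv_into S1 f"
  show ?thesis
    unfolding piecewise_iff
  proof (intro exI[of _ "f ` B"] conjI allI impI)
    show "finite (f ` B)" using B(1) by simp
    show "f ` B \<subseteq> rational_points"
      using piecewise_rational[OF circle_homeo_facts(3)[OF f(1)] f(2)] B(2) by blast
    fix C assume C: "connected C" "C \<subseteq> S1 - f ` B"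
    have "connected (?g ` C)"
      using C circle_homeo_facts(4)[OF f(1)] by (meson connected_continuous_image continuous_on_subset Diff_subset subset_trans)
    moreover have "?g ` C \<subseteq> S1 - B"
    proof
      fix y assume "y \<in> ?g ` C"
      then obtain z where z: "z \<in> C" "y = ?g z" by blast
      then have "z \<in> S1" "z \<notin> f ` B" using C(2) by auto
      then show "y \<in> S1 - B"
        using circle_homeo_closed(2)[OF f(1)] circle_homeo_inv(2)[OF f(1)] z(2) by force
    qed
    ultimately have "agrees_with_PSL2Z f (?g ` C)"
      using B(3) by blast
    then obtain a b c d where m: "a * d - b * c = 1" "\<forall>z\<in>?g ` C \<inter> S1. f z = mob a b c d z"
      unfolding agrees_iff by blast
    show "agrees_with_PSL2Z (restrict ?g S1) C"
      unfolding agrees_iff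
    proof (intro exI conjI ballI)
      show "d * a - - b * - c = 1" using m(1) by (simp add: mult.commute)
      fix z assume z: "z \<in> C \<inter> S1"
      then have "mob a b c d (?g z) = z" "?g z \<in> S1"
        using m(2) circle_homeo_closed(2)[OF f(1)] circle_homeo_inv(2)[OF f(1)] by (metis IntD1 IntD2 IntI imageI)+
      then show "restrict ?g S1 z = mob d (- b) (- c) a z"
        using z mob_inverse(1)[OF m(1), of "?g z"] by simp
    qed
  qed
qed

lemma subgroup_PPSL2Z: "subgroup {f. circle_homeo f \<and> piecewise_PSL2Z f} (BijGroup S1)"
proof (rule group.subgroupI[OF group_BijGroup])
  let ?H = "{f. circle_homeo f \<and> piecewise_PSL2Z f}"
  show "?H \<subseteq> carrier (BijGroup S1)"
    using circle_homeo_facts(1) by (auto simp: BijGroup_def)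
  have "circle_homeo (restrict id S1)"
    by (rule circle_homeoI[of _ id])
      (auto simp: orientation_preserving_def cong: continuous_on_cong_simp)
  moreover have "piecewise_PSL2Z (restrict id S1)"
    unfolding piecewise_iff agrees_iff
    by (intro exI[of _ "{}"] conjI allI impI exI[of _ 1] exI[of _ 0]) (auto simp: mob_id)
  ultimately show "?H \<noteq> {}" by blast
  fix f assume f: "f \<in> ?H"
  then show "inv\<^bsub>BijGroup S1\<^esub> f \<in> ?H"
    using inv_BijGroup[of f S1] circle_homeo_facts(1)[of f] circle_homeo_inverse piecewise_inverse by simp
  fix g assume g: "g \<in> ?H"
  with f show "f \<otimes>\<^bsub>BijGroup S1\<^esub> g \<in> ?H"
    using circle_homeo_facts(1)[of f] circle_homeo_facts(1)[of g] circle_homeo_compose piecewise_compose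
    by (simp add: BijGroup_def)
qed

lemma PPSL2Z_alt: "PPSL2Z = BijGroup S1\<lparr>carrier := {f. circle_homeo f \<and> piecewise_PSL2Z f}\<rparr>"
  using carrier_PPSL2Z unfolding PPSL2Z_def by simp

lemma group_PPSL2Z: "group PPSL2Z"
  unfolding PPSL2Z_alt by (rule subgroup.subgroup_is_group[OF subgroup_PPSL2Z group_BijGroup])

lemma carrier_imp_homeo: "f \<in> carrier PPSL2Z \<Longrightarrow> circle_homeo f"
  by (simp add: carrier_PPSL2Z)

lemma one_PPSL2Z: "\<one>\<^bsub>PPSL2Z\<^esub> = restrict (\<lambda>x. x) S1"
  by (simp add: PPSL2Z_def BijGroup_def)

lemma mult_PPSL2Z:
  assumes "f \<in> carrier PPSL2Z" "g \<in> carrier PPSL2Z"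
  shows "f \<otimes>\<^bsub>PPSL2Z\<^esub> g = compose S1 f g"
  using assms circle_homeo_facts(1) by (simp add: PPSL2Z_alt BijGroup_def)

lemma inv_PPSL2Z:
  assumes "f \<in> carrier PPSL2Z"
  shows "inv\<^bsub>PPSL2Z\<^esub> f = restrict (inv_into S1 f) S1"
  using assms group.m_inv_consistent[OF group_BijGroup subgroup_PPSL2Z, of f] circle_homeo_facts(1)[of f] inv_BijGroup[of f S1]
  unfolding PPSL2Z_alt by simp

section \<open>The two generators\<close>

definition smob :: "int \<Rightarrow> int \<Rightarrow> int \<Rightarrow> int \<Rightarrow> complex \<Rightarrow> complex" where
  "smob a b c d = restrict (mob a b c d) S1"

lemma smob_carrier:
  assumes "a * d - b * c = 1"
  shows "smob a b c d \<in> carrier PPSL2Z"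
proof -
  have inv: "d * a - - b * - c = 1" using assms by (simp add: mult.commute)
  have "circle_homeo (smob a b c d)"
    unfolding smob_def
  proof (rule circle_homeoI[of _ "mob d (- b) (- c) a"])
    show "continuous_on S1 (restrict (mob a b c d) S1)"
      using continuous_on_mob[OF assms] by (simp cong: continuous_on_cong_simp)
    show "orientation_preserving (restrict (mob a b c d) S1)"
      unfolding orientation_preserving_def using ccw_mob[OF assms] by simp
  qed (use assms mob_in_S1[OF inv] mob_inverse in auto)
  moreover have "piecewise_PSL2Z (smob a b c d)"
    unfolding piecewise_iff agrees_iff
    by (intro exI[of _ "{}"] conjI allI impI exI[of _ a] exI[of _ b] exI[of _ c] exI[of _ d])
      (use assms in \<open>auto simp: smob_def\<close>)
  ultimately show ?thesis
    by (simp add: carrier_PPSL2Z)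
qed

lemma smob_apply [simp]: "z \<in> S1 \<Longrightarrow> smob a b c d z = mob a b c d z"
  by (simp add: smob_def)

lemma carrier_closed: "f \<in> carrier PPSL2Z \<Longrightarrow> z \<in> S1 \<Longrightarrow> f z \<in> S1"
  using circle_homeo_closed(1)[OF carrier_imp_homeo] .

lemma mult_apply:
  "f \<in> carrier PPSL2Z \<Longrightarrow> g \<in> carrier PPSL2Z \<Longrightarrow> z \<in> S1 \<Longrightarrow> (f \<otimes>\<^bsub>PPSL2Z\<^esub> g) z = f (g z)"
  by (simp add: mult_PPSL2Z compose_def)

lemma inv_apply:
  "f \<in> carrier PPSL2Z \<Longrightarrow> z \<in> S1 \<Longrightarrow> (inv\<^bsub>PPSL2Z\<^esub> f) z = inv_into S1 f z"
  by (simp add: inv_PPSL2Z)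

lemma one_apply: "z \<in> S1 \<Longrightarrow> \<one>\<^bsub>PPSL2Z\<^esub> z = z"
  by (simp add: one_PPSL2Z)

lemma inv_apply_cancel:
  assumes "f \<in> carrier PPSL2Z" "z \<in> S1"
  shows "(inv\<^bsub>PPSL2Z\<^esub> f) (f z) = z" "f ((inv\<^bsub>PPSL2Z\<^esub> f) z) = z"
  using assms circle_homeo_inv[OF carrier_imp_homeo[OF assms(1)] assms(2)] carrier_closed
  by (simp_all add: inv_apply)

lemma carrier_eqI:
  assumes "f \<in> carrier PPSL2Z" "g \<in> carrier PPSL2Z" "\<And>z. z \<in> S1 \<Longrightarrow> f z = g z"
  shows "f = g"
  using assms circle_homeo_facts(2)[OF carrier_imp_homeo] extensionalityI[of f S1 g] by blast

text \<open>Maps with disjoint supports: by injectivity a point moved by \<open>f\<close> goes to a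
  point that \<open>f\<close> moves again, and \<open>g\<close> fixes both of them.\<close>

lemma commute_disjoint:
  assumes f: "f \<in> carrier PPSL2Z" and g: "g \<in> carrier PPSL2Z"
    and disj: "\<And>z. z \<in> S1 \<Longrightarrow> f z = z \<or> g z = z"
  shows "f \<otimes>\<^bsub>PPSL2Z\<^esub> g = g \<otimes>\<^bsub>PPSL2Z\<^esub> f"
proof (rule carrier_eqI)
  interpret group PPSL2Z by (rule group_PPSL2Z)
  show "f \<otimes>\<^bsub>PPSL2Z\<^esub> g \<in> carrier PPSL2Z" "g \<otimes>\<^bsub>PPSL2Z\<^esub> f \<in> carrier PPSL2Z"
    using f g by simp_all
  fix z assume z: "z \<in> S1"
  have inj: "f (f z) = f z \<Longrightarrow> f z = z" "g (g z) = g z \<Longrightarrow> g z = z"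
    using circle_homeo_eq_iff[OF carrier_imp_homeo[OF f] carrier_closed[OF f z] z]
      circle_homeo_eq_iff[OF carrier_imp_homeo[OF g] carrier_closed[OF g z] z] by simp_all
  have "f (g z) = g (f z)"
  proof (cases "f z = z")
    case True
    then show ?thesis using disj[OF carrier_closed[OF g z]] inj(2) by auto
  next
    case False
    then show ?thesis using disj[OF z] disj[OF carrier_closed[OF f z]] inj(1) by auto
  qed
  then show "(f \<otimes>\<^bsub>PPSL2Z\<^esub> g) z = (g \<otimes>\<^bsub>PPSL2Z\<^esub> f) z"
    using mult_apply f g z by simp
qed

section \<open>Moebius transformations in the real coordinate and the basic turns\<close>

lemma mob_pt_cayley: "mob a b c d (pt x) = cayley (of_int a * x + of_int b) (of_int c * x + of_int d)"
  and mob_ptinf_cayley: "mob a b c d ptinf = cayley (of_int a) (of_int c)"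
  using mob_cayley[of x 1 a b c d] mob_cayley[of 1 0 a b c d] by (simp_all add: pt_def ptinf_def)

lemma mob_pt: "of_int c * x + of_int d \<noteq> (0::real) \<Longrightarrow>
    mob a b c d (pt x) = pt ((of_int a * x + of_int b) / (of_int c * x + of_int d))"
  unfolding mob_pt_cayley by (rule cayley_pt)

lemma mob_pt_inf: "a * d - b * c = 1 \<Longrightarrow> of_int c * x + of_int d = (0::real) \<Longrightarrow> mob a b c d (pt x) = ptinf"
  using lin_nonzero[of a d b c x 1] by (simp add: mob_pt_cayley cayley_inf)

lemma mob_inf: "c \<noteq> 0 \<Longrightarrow> mob a b c d ptinf = pt (of_int a / of_int c)"
  by (simp add: mob_ptinf_cayley cayley_pt)

lemma mob_inf_inf: "a \<noteq> 0 \<Longrightarrow> mob a b 0 d ptinf = ptinf"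
  by (simp add: mob_ptinf_cayley cayley_inf)

lemma Re_pt: "Re (pt x) = (x\<^sup>2 - 1) / (x\<^sup>2 + 1)" and Im_pt: "Im (pt x) = - 2 * x / (x\<^sup>2 + 1)"
  unfolding pt_def cayley_def by (simp_all add: Re_divide Im_divide power2_eq_square)

lemma ptinf_eq: "ptinf = 1"
  by (simp add: ptinf_def cayley_def)

lemma Im_pt_iff: "Im (pt x) \<ge> 0 \<longleftrightarrow> x \<le> 0" "Im (pt x) \<le> 0 \<longleftrightarrow> x \<ge> 0"
proof -
  have "x\<^sup>2 + 1 > 0" by (simp add: add_nonneg_pos)
  then show "Im (pt x) \<ge> 0 \<longleftrightarrow> x \<le> 0" "Im (pt x) \<le> 0 \<longleftrightarrow> x \<ge> 0"
    unfolding Im_pt by (simp_all add: zero_le_divide_iff divide_le_0_iff)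
qed

lemma Re_pt_iff: "Re (pt x) \<ge> 0 \<longleftrightarrow> \<bar>x\<bar> \<ge> 1" "Re (pt x) \<le> 0 \<longleftrightarrow> \<bar>x\<bar> \<le> 1"
proof -
  have p: "x\<^sup>2 + 1 > 0" by (simp add: add_nonneg_pos)
  have "1 \<le> x\<^sup>2 \<longleftrightarrow> \<bar>x\<bar> \<ge> 1" "x\<^sup>2 \<le> 1 \<longleftrightarrow> \<bar>x\<bar> \<le> 1"
    using abs_le_square_iff[of 1 x] abs_le_square_iff[of x 1] by simp_all
  then show "Re (pt x) \<ge> 0 \<longleftrightarrow> \<bar>x\<bar> \<ge> 1" "Re (pt x) \<le> 0 \<longleftrightarrow> \<bar>x\<bar> \<le> 1"
    unfolding Re_pt using p by (simp_all add: zero_le_divide_iff divide_le_0_iff)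
qed

text \<open>The quarter turn of the ideal quadrilateral with vertices \<open>\<infinity>, -1, 0, 1\<close>, which the Cayley
  transform puts at \<open>1, \<i>, -1, -\<i>\<close>; it is a Moebius transformation on each quadrant.\<close>

definition quad_turn :: "complex \<Rightarrow> complex" where
  "quad_turn = (\<lambda>z\<in>S1.
     if Im z \<ge> 0 then (if Re z \<ge> 0 then mob 1 1 (-1) 0 z else mob 1 1 0 1 z)
     else (if Re z \<le> 0 then mob 0 1 (-1) 1 z else mob 1 0 (-1) 1 z))"

text \<open>The matrix of x -> 1/(1 - x), which permutes \<infinity>, 0, 1 cyclically in this order
  and so turns the triangle to the left of the edge from \<infinity> to 0.\<close>

definition tri_turn :: "complex \<Rightarrow> complex" where
  "tri_turn = smob 0 1 (-1) 1"

lemma quad_turn_inf: "quad_turn ptinf = pt (-1)"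
  using ptinf_in_S1 by (simp add: quad_turn_def mob_inf) (simp add: ptinf_eq)

lemma quad_turn_pt:
  "x \<le> -1 \<Longrightarrow> quad_turn (pt x) = pt (- (x + 1) / x)"
  "-1 \<le> x \<Longrightarrow> x \<le> 0 \<Longrightarrow> quad_turn (pt x) = pt (x + 1)"
  "0 \<le> x \<Longrightarrow> x < 1 \<Longrightarrow> quad_turn (pt x) = pt (1 / (1 - x))"
  "quad_turn (pt 1) = ptinf"
  "1 < x \<Longrightarrow> quad_turn (pt x) = pt (x / (1 - x))"
  by (auto simp: quad_turn_def Im_pt_iff Re_pt_iff mob_pt mob_pt_inf) (simp add: field_simps)

lemma tri_turn_pt: "x \<noteq> 1 \<Longrightarrow> tri_turn (pt x) = pt (1 / (1 - x))" "tri_turn (pt 1) = ptinf"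
  and tri_turn_inf: "tri_turn ptinf = pt 0"
  by (simp_all add: tri_turn_def mob_pt mob_pt_inf mob_inf)

text \<open>The map x -> -1/x, which reverses the edge from \<infinity> to 0; it is the square of
  \<open>quad_turn\<close>.\<close>

definition half_turn :: "complex \<Rightarrow> complex" where
  "half_turn = smob 0 (-1) 1 0"

lemma half_turn_pt: "x \<noteq> 0 \<Longrightarrow> half_turn (pt x) = pt (- 1 / x)" "half_turn (pt 0) = ptinf"
  and half_turn_inf: "half_turn ptinf = pt 0"
  by (simp_all add: half_turn_def mob_pt mob_pt_inf mob_inf)

lemma half_turn_half_turn:
  assumes "z \<in> S1"
  shows "half_turn (half_turn z) = z"
  using assms
proof (cases rule: S1_cases)
  case 1
  then show ?thesis by (simp add: half_turn_inf half_turn_pt)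
next
  case (2 x)
  then show ?thesis
    using half_turn_pt(1)[of x] half_turn_pt(1)[of "- 1 / x"]
    by (cases "x = 0") (simp_all add: half_turn_inf half_turn_pt(2))
qed

lemma quad_turn_closed: "z \<in> S1 \<Longrightarrow> quad_turn z \<in> S1"
  by (auto simp: quad_turn_def)

lemma half_turn_carrier: "half_turn \<in> carrier PPSL2Z" and tri_turn_carrier: "tri_turn \<in> carrier PPSL2Z"
  unfolding half_turn_def tri_turn_def by (rule smob_carrier; simp)+

lemma quad_turn_quad_turn:
  assumes "z \<in> S1"
  shows "quad_turn (quad_turn z) = half_turn z"
  using assms
proof (cases rule: S1_cases)
  case 1
  then show ?thesis
    using quad_turn_pt(2)[of "-1"] by (simp add: quad_turn_inf half_turn_inf)
next
  case (2 x)
  consider "x \<le> -1" | "-1 < x" "x < 0" | "x = 0" | "0 < x" "x < 1" | "x = 1" | "1 < x" by linarith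
  then show ?thesis
  proof cases
    assume "x \<le> -1"
    then have "- (x + 1) / x \<ge> -1" "- (x + 1) / x \<le> 0" "- (x + 1) / x + 1 = - 1 / x" "x \<noteq> 0"
      by (simp_all add: field_simps)
    then show ?thesis using \<open>x \<le> -1\<close> 2 by (simp add: quad_turn_pt half_turn_pt del: divide_minus_left)
  next
    assume "-1 < x" "x < 0"
    then show ?thesis using 2 quad_turn_pt(3)[of "x + 1"] by (simp add: quad_turn_pt(2) half_turn_pt)
  next
    assume "x = 0"
    then show ?thesis using 2 by (simp add: quad_turn_pt half_turn_pt)
  next
    assume x: "0 < x" "x < 1"
    then have "1 / (1 - x) > 1" "1 / (1 - x) / (1 - 1 / (1 - x)) = - 1 / x"
      by (simp_all add: field_simps)
    then show ?thesis using 2 x by (simp add: quad_turn_pt half_turn_pt)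
  next
    assume "x = 1"
    then show ?thesis using 2 by (simp add: quad_turn_pt quad_turn_inf half_turn_pt)
  next
    assume x: "1 < x"
    then have "x / (1 - x) \<le> -1" "- (x / (1 - x) + 1) / (x / (1 - x)) = - 1 / x"
      by (simp_all add: field_simps)
    then show ?thesis using 2 x by (simp add: quad_turn_pt half_turn_pt del: divide_minus_left)
  qed
qed

text \<open>Once \<infinity> is fixed, the cyclic order of the circle is the linear order of the
  line.\<close>

lemma orientation_preservingI_mono:
  assumes "f ptinf = ptinf" "\<And>x. f (pt x) = pt (F x)" "strict_mono F"
  shows "orientation_preserving f"
  unfolding orientation_preserving_def
proof (intro ballI impI)
  fix x y z assume *: "x \<in> S1" "y \<in> S1" "z \<in> S1" "ccw x y z"
  have [simp]: "F s < F t \<longleftrightarrow> s < t" for s t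
    using assms(3) by (simp add: strict_mono_less)
  show "ccw (f x) (f y) (f z)"
    by (rule S1_cases[OF *(1)]; rule S1_cases[OF *(2)]; rule S1_cases[OF *(3)];
        use *(4) in \<open>auto simp: assms(1,2) ccw_pt ccw_inf\<close>)
qed

lemma orientation_preserving_compose:
  assumes "orientation_preserving f" "orientation_preserving g" "\<And>z. z \<in> S1 \<Longrightarrow> g z \<in> S1"
  shows "orientation_preserving (\<lambda>z. f (g z))"
  using assms unfolding orientation_preserving_def by blast

text \<open>\<open>contraction\<close> is the generator \<open>B\<close> of Thompson's group \<open>F\<close> in the real coordinate.\<close>

definition contraction :: "real \<Rightarrow> real" where
  "contraction x = (if x \<le> -1 then x + 1 else if x \<le> 0 then (x + 1) / (x + 2)
     else if x \<le> 1 then 1 / (2 - x) else x)"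

lemma strict_mono_contraction: "strict_mono contraction"
proof (rule strict_monoI)
  fix x y :: real assume "x < y"
  have r1: "t \<le> -1 \<Longrightarrow> contraction t \<le> 0" for t
    by (simp add: contraction_def)
  have r2: "-1 < t \<Longrightarrow> t \<le> 0 \<Longrightarrow> 0 < contraction t \<and> contraction t \<le> 1 / 2" for t
    by (simp add: contraction_def field_simps)
  have r3: "0 < t \<Longrightarrow> t \<le> 1 \<Longrightarrow> 1 / 2 < contraction t \<and> contraction t \<le> 1" for t
    by (simp add: contraction_def field_simps)
  have r4: "1 < t \<Longrightarrow> 1 < contraction t" for t
    by (simp add: contraction_def)
  have s2: "-1 < x \<Longrightarrow> y \<le> 0 \<Longrightarrow> contraction x < contraction y"
    using \<open>x < y\<close> by (simp add: contraction_def field_simps)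
  have s3: "0 < x \<Longrightarrow> y \<le> 1 \<Longrightarrow> contraction x < contraction y"
    using \<open>x < y\<close> by (simp add: contraction_def field_simps)
  consider "y \<le> -1" | "x \<le> -1" "-1 < y" | "-1 < x" "y \<le> 0" | "-1 < x" "x \<le> 0" "0 < y"
    | "0 < x" "y \<le> 1" | "0 < x" "x \<le> 1" "1 < y" | "1 < x" using \<open>x < y\<close> by linarith
  then show "contraction x < contraction y"
  proof cases
    case 1
    then show ?thesis using \<open>x < y\<close> by (simp add: contraction_def)
  next
    case 2
    then show ?thesis using r1[of x] r2[of y] r3[of y] r4[of y] by linarith
  next
    case 4
    then show ?thesis using r2[of x] r3[of y] r4[of y] by linarith
  next
    case 6
    then show ?thesis using r3[of x] r4[of y] by linarith
  next
    case 7
    then show ?thesis using \<open>x < y\<close> by (simp add: contraction_def)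
  qed (use s2 s3 in auto)
qed

lemma turns_contraction:
  "tri_turn (quad_turn (half_turn ptinf)) = ptinf"
  "tri_turn (quad_turn (half_turn (pt x))) = pt (contraction x)"
proof -
  show "tri_turn (quad_turn (half_turn ptinf)) = ptinf"
    by (simp add: half_turn_inf quad_turn_pt tri_turn_pt)
  consider "x < -1" | "x = -1" | "-1 < x" "x < 0" | "x = 0" | "0 < x" "x \<le> 1" | "1 < x" by linarith
  then show "tri_turn (quad_turn (half_turn (pt x))) = pt (contraction x)"
  proof cases
    case 1
    then have "0 \<le> - 1 / x" "- 1 / x < 1" "1 / (1 - - 1 / x) \<noteq> 1" "1 / (1 - 1 / (1 - - 1 / x)) = x + 1"
      by (simp_all add: field_simps)
    then show ?thesis using 1 by (simp add: half_turn_pt quad_turn_pt tri_turn_pt contraction_def del: divide_minus_left)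
  next
    case 2
    then show ?thesis by (simp add: half_turn_pt quad_turn_pt tri_turn_inf contraction_def)
  next
    case 3
    then have "1 < - 1 / x" "- 1 / x / (1 - - 1 / x) \<noteq> 1" "1 / (1 - - 1 / x / (1 - - 1 / x)) = (x + 1) / (x + 2)"
      by (simp_all add: field_simps)
    then show ?thesis using 3 by (simp add: half_turn_pt quad_turn_pt tri_turn_pt contraction_def del: divide_minus_left)
  next
    case 4
    then show ?thesis by (simp add: half_turn_pt quad_turn_inf tri_turn_pt contraction_def)
  next
    case 5
    then have "- 1 / x \<le> - 1" "- (- 1 / x + 1) / (- 1 / x) \<noteq> 1" "1 / (1 - - (- 1 / x + 1) / (- 1 / x)) = 1 / (2 - x)"
      by (simp_all add: field_simps)
    then show ?thesis using 5 by (simp add: half_turn_pt quad_turn_pt tri_turn_pt contraction_def del: divide_minus_left)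
  next
    case 6
    then have "- 1 \<le> - 1 / x" "- 1 / x \<le> 0" "- 1 / x + 1 \<noteq> 1" "1 / (1 - (- 1 / x + 1)) = x"
      by (simp_all add: field_simps)
    then show ?thesis using 6 by (simp add: half_turn_pt quad_turn_pt tri_turn_pt contraction_def del: divide_minus_left)
  qed
qed

lemma connected_constant_sign:
  fixes f :: "'a::topological_space \<Rightarrow> real"
  assumes "connected C" "continuous_on C f" "\<And>z. z \<in> C \<Longrightarrow> f z \<noteq> 0"
  shows "(\<forall>z\<in>C. f z > 0) \<or> (\<forall>z\<in>C. f z < 0)"
proof (rule ccontr)
  assume "\<not> ?thesis"
  then obtain x y where xy: "x \<in> C" "y \<in> C" "f x \<le> 0" "f y \<ge> 0"
    by (auto simp: not_less)
  have "connected (f ` C)"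
    using assms(1,2) by (rule connected_continuous_image[rotated])
  then have "0 \<in> f ` C"
    unfolding connected_iff_interval using xy by blast
  then show False
    using assms(3) by force
qed

text \<open>Orientation is not examined quadrant by quadrant: up to composition with
  \<open>half_turn\<close> on one side and the inverse of \<open>tri_turn\<close> on the other,
  \<open>quad_turn\<close> is the increasing map \<open>contraction\<close>. Continuity is a gluing
  argument along the four closed quarters of the circle, and the cube serves as inverse.\<close>

lemma quad_turn_carrier: "quad_turn \<in> carrier PPSL2Z"
proof -
  interpret group PPSL2Z by (rule group_PPSL2Z)
  let ?i = "inv\<^bsub>PPSL2Z\<^esub> tri_turn"
  have i: "?i \<in> carrier PPSL2Z" using tri_turn_carrier by simp
  have op1: "orientation_preserving (\<lambda>z. tri_turn (quad_turn (half_turn z)))"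
    by (rule orientation_preservingI_mono[OF turns_contraction strict_mono_contraction])
  have op2: "orientation_preserving ?i" and op3: "orientation_preserving half_turn"
    using i half_turn_carrier carrier_imp_homeo unfolding circle_homeo_def by blast+
  have cl: "half_turn z \<in> S1" if "z \<in> S1" for z
    using that carrier_closed[OF half_turn_carrier] by blast
  have op4: "orientation_preserving (\<lambda>z. ?i (tri_turn (quad_turn (half_turn (half_turn z)))))"
    by (rule orientation_preserving_compose[OF op2 orientation_preserving_compose[OF op1 op3 cl]])
      (use cl quad_turn_closed carrier_closed[OF tri_turn_carrier] in auto)
  have "?i (tri_turn (quad_turn (half_turn (half_turn z)))) = quad_turn z" if "z \<in> S1" for z
    using that quad_turn_closed inv_apply_cancel[OF tri_turn_carrier] by (simp add: half_turn_half_turn)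
  then have op: "orientation_preserving quad_turn"
    using op4 unfolding orientation_preserving_def by simp
  have four: "quad_turn (quad_turn (quad_turn (quad_turn z))) = z" if "z \<in> S1" for z
    using that quad_turn_closed by (simp add: quad_turn_quad_turn half_turn_half_turn cl)
  define up where "up z = (if Re z \<ge> 0 then mob 1 1 (-1) 0 z else mob 1 1 0 1 z)" for z
  define lo where "lo z = (if Re z \<le> 0 then mob 0 1 (-1) 1 z else mob 1 0 (-1) 1 z)" for z
  have closed_half: "closed {z. Re z \<ge> 0}" "closed {z. Re z \<le> 0}" "closed {z. Im z \<ge> 0}" "closed {z. Im z \<le> 0}"
    by (simp_all add: closed_halfspace_Re_ge closed_halfspace_Re_le closed_halfspace_Im_ge closed_halfspace_Im_le)
  have S1_Un: "S1 = (S1 \<inter> {z. Re z \<ge> 0}) \<union> (S1 \<inter> {z. Re z \<le> 0})" "S1 = (S1 \<inter> {z. Im z \<ge> 0}) \<union> (S1 \<inter> {z. Im z \<le> 0})"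
    by auto
  have sub: "continuous_on (S1 \<inter> T) (mob a b c d)" if "a * d - b * c = 1" for a b c d T
    using continuous_on_mob[OF that] by (rule continuous_on_subset) blast
  have "continuous_on ((S1 \<inter> {z. Im z \<ge> 0} \<inter> {z. Re z \<ge> 0}) \<union> (S1 \<inter> {z. Im z \<ge> 0} \<inter> {z. Re z \<le> 0})) up"
    unfolding up_def
  proof (rule continuous_on_cases)
    show "\<forall>x. x \<in> S1 \<inter> {z. 0 \<le> Im z} \<inter> {z. 0 \<le> Re z} \<and> \<not> 0 \<le> Re x \<or>
        x \<in> S1 \<inter> {z. 0 \<le> Im z} \<inter> {z. Re z \<le> 0} \<and> 0 \<le> Re x \<longrightarrow> mob 1 1 (- 1) 0 x = mob 1 1 0 1 x"
    proof (intro allI impI)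
      fix z assume "z \<in> S1 \<inter> {z. 0 \<le> Im z} \<inter> {z. 0 \<le> Re z} \<and> \<not> 0 \<le> Re z \<or>
        z \<in> S1 \<inter> {z. 0 \<le> Im z} \<inter> {z. Re z \<le> 0} \<and> 0 \<le> Re z"
      then have z: "z \<in> S1" "Im z \<ge> 0" "Re z = 0" by auto
      then show "mob 1 1 (- 1) 0 z = mob 1 1 0 1 z"
      proof (cases rule: S1_cases)
        case (2 x)
        then have "x \<le> 0" "\<bar>x\<bar> = 1"
          using z Im_pt_iff(1)[of x] Re_pt_iff[of x] by auto
        then have "x = -1" by auto
        then show ?thesis using 2 by (simp add: mob_pt)
      qed (use z in \<open>simp add: ptinf_eq\<close>)
    qed
  qed (use closed_half in \<open>auto intro!: sub closed_Int simp: Int_assoc\<close>)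
  then have up: "continuous_on (S1 \<inter> {z. Im z \<ge> 0}) up"
    by (rule continuous_on_subset) auto
  have "continuous_on ((S1 \<inter> {z. Im z \<le> 0} \<inter> {z. Re z \<le> 0}) \<union> (S1 \<inter> {z. Im z \<le> 0} \<inter> {z. Re z \<ge> 0})) lo"
    unfolding lo_def
  proof (rule continuous_on_cases)
    show "\<forall>x. x \<in> S1 \<inter> {z. Im z \<le> 0} \<inter> {z. Re z \<le> 0} \<and> \<not> Re x \<le> 0 \<or>
        x \<in> S1 \<inter> {z. Im z \<le> 0} \<inter> {z. 0 \<le> Re z} \<and> Re x \<le> 0 \<longrightarrow> mob 0 1 (- 1) 1 x = mob 1 0 (- 1) 1 x"
    proof (intro allI impI)
      fix z assume "z \<in> S1 \<inter> {z. Im z \<le> 0} \<inter> {z. Re z \<le> 0} \<and> \<not> Re z \<le> 0 \<or>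
        z \<in> S1 \<inter> {z. Im z \<le> 0} \<inter> {z. 0 \<le> Re z} \<and> Re z \<le> 0"
      then have z: "z \<in> S1" "Im z \<le> 0" "Re z = 0" by auto
      then show "mob 0 1 (- 1) 1 z = mob 1 0 (- 1) 1 z"
      proof (cases rule: S1_cases)
        case (2 x)
        then have "x \<ge> 0" "\<bar>x\<bar> = 1"
          using z Im_pt_iff(2)[of x] Re_pt_iff[of x] by auto
        then have "x = 1" by auto
        then show ?thesis using 2 by (simp add: mob_pt_inf)
      qed (use z in \<open>simp add: ptinf_eq\<close>)
    qed
  qed (use closed_half in \<open>auto intro!: sub closed_Int simp: Int_assoc\<close>)
  then have lo: "continuous_on (S1 \<inter> {z. Im z \<le> 0}) lo"
    by (rule continuous_on_subset) auto
  have "continuous_on ((S1 \<inter> {z. Im z \<ge> 0}) \<union> (S1 \<inter> {z. Im z \<le> 0})) (\<lambda>z. if Im z \<ge> 0 then up z else lo z)"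
  proof (rule continuous_on_cases)
    show "\<forall>x. x \<in> S1 \<inter> {z. 0 \<le> Im z} \<and> \<not> 0 \<le> Im x \<or> x \<in> S1 \<inter> {z. Im z \<le> 0} \<and> 0 \<le> Im x \<longrightarrow> up x = lo x"
    proof (intro allI impI)
      fix z assume "z \<in> S1 \<inter> {z. 0 \<le> Im z} \<and> \<not> 0 \<le> Im z \<or> z \<in> S1 \<inter> {z. Im z \<le> 0} \<and> 0 \<le> Im z"
      then have z: "z \<in> S1" "Im z = 0" by auto
      then show "up z = lo z"
      proof (cases rule: S1_cases)
        case 1
        then show ?thesis by (simp add: up_def lo_def ptinf_eq mob_inf[unfolded ptinf_eq])
      next
        case (2 x)
        then have "x = 0"
          using z Im_pt_iff[of x] by auto
        then show ?thesis using 2 by (simp add: up_def lo_def mob_pt Re_pt)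
      qed
    qed
  qed (use closed_half up lo in \<open>auto intro!: closed_Int\<close>)
  then have "continuous_on S1 (\<lambda>z. if Im z \<ge> 0 then up z else lo z)"
    unfolding S1_Un(2)[symmetric] .
  then have cont: "continuous_on S1 quad_turn"
    unfolding quad_turn_def up_def lo_def by (simp cong: continuous_on_cong_simp)
  have "circle_homeo quad_turn"
  proof (rule circle_homeoI[of _ "\<lambda>z. quad_turn (quad_turn (quad_turn z))"])
    show "quad_turn \<in> extensional S1"
      unfolding quad_turn_def by simp
  qed (use cont op in \<open>simp_all add: four quad_turn_closed\<close>)
  moreover have "piecewise_PSL2Z quad_turn"
    unfolding piecewise_iff
  proof (intro exI[of _ "{ptinf, pt (-1), pt 0, pt 1}"] conjI allI impI)
    show "{ptinf, pt (-1), pt 0, pt 1} \<subseteq> rational_points"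
      using rational_pointsI[of 1 0] rational_pointsI[of "-1" 1] rational_pointsI[of 0 1] rational_pointsI[of 1 1]
      by (simp add: ptinf_def pt_def)
    fix C assume C: "connected C" "C \<subseteq> S1 - {ptinf, pt (-1), pt 0, pt 1}"
    have nz: "Re z \<noteq> 0 \<and> Im z \<noteq> 0" if "z \<in> C" for z
    proof -
      have z: "z \<in> S1" "z \<notin> {ptinf, pt (-1), pt 0, pt 1}" using that C(2) by auto
      show ?thesis
        using z(1)
      proof (cases rule: S1_cases)
        case (2 x)
        then have "x \<noteq> 0" "\<bar>x\<bar> \<noteq> 1" using z(2) by auto
        then show ?thesis using Re_pt_iff[of x] Im_pt_iff[of x] 2 by auto
      qed (use z in auto)
    qed
    have re: "(\<forall>z\<in>C. Re z > 0) \<or> (\<forall>z\<in>C. Re z < 0)"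
      by (rule connected_constant_sign[OF C(1) continuous_on_Re[OF continuous_on_id]]) (simp add: nz)
    have im: "(\<forall>z\<in>C. Im z > 0) \<or> (\<forall>z\<in>C. Im z < 0)"
      by (rule connected_constant_sign[OF C(1) continuous_on_Im[OF continuous_on_id]]) (simp add: nz)
    have agreesI: "agrees_with_PSL2Z quad_turn C"
      if "a * d - b * c = 1" "\<And>z. z \<in> C \<Longrightarrow> z \<in> S1 \<Longrightarrow> quad_turn z = mob a b c d z" for a b c d
      unfolding agrees_iff using that by blast
    from re im show "agrees_with_PSL2Z quad_turn C"
    proof (elim disjE)
      assume "\<forall>z\<in>C. Re z > 0" "\<forall>z\<in>C. Im z > 0"
      \<comment> \<open>The matrix entries are instantiated in the order a, d, b, c in which they
        occur in the determinant condition.\<close>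
      then show ?thesis by (intro agreesI[of 1 0 1 "-1"]) (simp_all add: quad_turn_def less_imp_le)
    next
      assume "\<forall>z\<in>C. Re z < 0" "\<forall>z\<in>C. Im z > 0"
      then show ?thesis by (intro agreesI[of 1 1 1 0]) (auto simp: quad_turn_def less_imp_le dest!: bspec)
    next
      assume "\<forall>z\<in>C. Re z < 0" "\<forall>z\<in>C. Im z < 0"
      then show ?thesis by (intro agreesI[of 0 1 1 "-1"]) (auto simp: quad_turn_def less_imp_le dest!: bspec)
    next
      assume "\<forall>z\<in>C. Re z > 0" "\<forall>z\<in>C. Im z < 0"
      then show ?thesis by (intro agreesI[of 1 1 0 "-1"]) (simp_all add: quad_turn_def less_imp_le flip: not_less)
    qed
  qed simp
  ultimately show ?thesis
    by (simp add: carrier_PPSL2Z)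
qed

section \<open>The relations\<close>

text \<open>The five relators as equations in an arbitrary group, with the commutators as pairs of
  commuting elements. Here \<open>v\<close> is the conjugate of \<open>u\<close> by the square of x,
  so that \<open>w\<close> contains it as a factor.\<close>

definition (in group) ppsl2z_relations :: "'a \<Rightarrow> 'a \<Rightarrow> bool" where
  "ppsl2z_relations x y \<longleftrightarrow> x \<otimes> (x \<otimes> (x \<otimes> x)) = \<one> \<and> y \<otimes> (y \<otimes> y) = \<one> \<and>
    (x \<otimes> y) [^] (5::nat) = \<one> \<and>
    (let u = y \<otimes> x \<otimes> y; s = x \<otimes> x; v = s \<otimes> u \<otimes> s; w = s \<otimes> (y \<otimes> y) \<otimes> v \<otimes> y \<otimes> s
     in u \<otimes> v = v \<otimes> u \<and> u \<otimes> w = w \<otimes> u)"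

text \<open>Under this substitution the relators become the defining relations of Thompson's group \<open>T\<close>
  given by Cannon, Floyd and Parry.\<close>

lemma (in group) thompson_relationsI:
  assumes x: "x \<in> carrier G" and y: "y \<in> carrier G" and rels: "ppsl2z_relations x y"
  shows "thompson_relations G (y \<otimes> (x \<otimes> x)) (inv y \<otimes> x) (inv y)"
proof -
  let ?A = "y \<otimes> (x \<otimes> x)" and ?B = "inv y \<otimes> x" and ?C = "inv y"
  define u where "u = y \<otimes> x \<otimes> y"
  define v where "v = x \<otimes> x \<otimes> u \<otimes> (x \<otimes> x)"
  define w where "w = x \<otimes> x \<otimes> (y \<otimes> y) \<otimes> v \<otimes> y \<otimes> (x \<otimes> x)"
  have r: "x \<otimes> (x \<otimes> (x \<otimes> x)) = \<one>" "y \<otimes> (y \<otimes> y) = \<one>" "(x \<otimes> y) [^] (5::nat) = \<one>"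
    "u \<otimes> v = v \<otimes> u" "u \<otimes> w = w \<otimes> u"
    using rels unfolding ppsl2z_relations_def Let_def u_def v_def w_def by simp_all
  have x4: "x \<otimes> (x \<otimes> (x \<otimes> (x \<otimes> z))) = z" and y3: "y \<otimes> (y \<otimes> (y \<otimes> z)) = z" if "z \<in> carrier G" for z
    using arg_cong[OF r(1), of "\<lambda>t. t \<otimes> z"] arg_cong[OF r(2), of "\<lambda>t. t \<otimes> z"] that x y
    by (simp_all add: m_assoc)
  have ix: "inv x = x \<otimes> (x \<otimes> x)" and iy: "inv y = y \<otimes> y"
    using r(1,2) x y by (simp_all add: inv_equality m_assoc)
  have [simp]: "u \<in> carrier G" "v \<in> carrier G"
    using x y by (simp_all add: u_def v_def)
  note norm = m_assoc inv_mult_group ix iy x4 y3 r(1,2)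
  \<comment> \<open>With these identities the two commutators turn into \<open>comm2\<close> and
    \<open>comm3\<close>. The fourth one says that \<open>D 1\<close> is \<open>inv x\<close>, after
    which \<open>C_A\<close> amounts to x^4 = 1, \<open>C_cube\<close> to y^3 = 1, and
    \<open>C_expand\<close> to cancellation.\<close>
  have AB: "?A \<otimes> inv ?B = u"
    using x y by (simp add: norm u_def)
  have ABA: "inv ?A \<otimes> ?B \<otimes> ?A = v"
    using x y by (simp add: norm v_def u_def)
  have AvA: "inv ?A \<otimes> v \<otimes> ?A = w"
    using x y by (simp add: norm w_def v_def u_def)
  have ACB: "inv ?A \<otimes> ?C \<otimes> ?B = inv x"
    using x y by (simp add: norm)
  have five: "x \<otimes> (y \<otimes> (x \<otimes> (y \<otimes> (x \<otimes> (y \<otimes> (x \<otimes> (y \<otimes> (x \<otimes> y)))))))) = \<one>"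
    using r(3) x y by (simp add: m_assoc eval_nat_numeral)
  show ?thesis
  proof
    show "?A \<in> carrier G" "?B \<in> carrier G" "?C \<in> carrier G"
      using x y by simp_all
    show "?A \<otimes> inv ?B \<otimes> (inv ?A \<otimes> ?B \<otimes> ?A) = inv ?A \<otimes> ?B \<otimes> ?A \<otimes> (?A \<otimes> inv ?B)"
      unfolding AB ABA by (rule r(4))
    show "?A \<otimes> inv ?B \<otimes> (inv ?A \<otimes> (inv ?A \<otimes> ?B \<otimes> ?A) \<otimes> ?A) =
        inv ?A \<otimes> (inv ?A \<otimes> ?B \<otimes> ?A) \<otimes> ?A \<otimes> (?A \<otimes> inv ?B)"
      unfolding AB ABA AvA by (rule r(5))
    show "?C = ?B \<otimes> (inv ?A \<otimes> ?C \<otimes> ?B)"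
      unfolding ACB using x y by (simp add: m_assoc)
    have "inv x \<otimes> v = x \<otimes> (y \<otimes> (x \<otimes> (y \<otimes> (x \<otimes> x))))"
      using x y by (simp add: norm v_def u_def)
    \<comment> \<open>The fifth power of x y enters only here: split into two blocks of five
      letters, it identifies one block with the inverse of the other and yields
      \<open>C2_B\<close>.\<close>
    also have "\<dots> = inv (y \<otimes> (x \<otimes> (y \<otimes> (x \<otimes> y)))) \<otimes> x"
    proof -
      have "x \<otimes> (y \<otimes> (x \<otimes> (y \<otimes> x))) = inv (y \<otimes> (x \<otimes> (y \<otimes> (x \<otimes> y))))"
        using five x y by (intro inv_equality [symmetric]) (simp_all add: m_assoc)
      then show ?thesis
        using x y by (metis m_assoc m_closed)
    qed
    also have "\<dots> = ?B \<otimes> (inv ?A \<otimes> inv x \<otimes> ?B)"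
      using x y by (simp add: norm)
    finally show "inv ?A \<otimes> ?C \<otimes> ?B \<otimes> (inv ?A \<otimes> ?B \<otimes> ?A) = ?B \<otimes> (inv ?A \<otimes> (inv ?A \<otimes> ?C \<otimes> ?B) \<otimes> ?B)"
      unfolding ACB ABA .
    show "?C \<otimes> ?A = inv ?A \<otimes> ?C \<otimes> ?B \<otimes> (inv ?A \<otimes> ?C \<otimes> ?B)"
      unfolding ACB using x y by (simp add: norm)
    show "?C \<otimes> (?C \<otimes> ?C) = \<one>"
      using x y by (simp add: norm)
  qed
qed

text \<open>The elements of the moves for the doe from \<infinity> to 0. There
  \<open>quad_turn\<close> carries the doe to the edge from -1 to 1 and \<open>tri_turn\<close>
  carries it to the edge from 0 to 1. Inverses are taken because it is the inverse of the element
  that produces the result of the move.\<close>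

definition alpha0 :: "complex \<Rightarrow> complex" where "alpha0 = inv\<^bsub>PPSL2Z\<^esub> quad_turn"
definition beta0 :: "complex \<Rightarrow> complex" where "beta0 = inv\<^bsub>PPSL2Z\<^esub> tri_turn"

lemma alpha0_carrier [simp]: "alpha0 \<in> carrier PPSL2Z" and beta0_carrier [simp]: "beta0 \<in> carrier PPSL2Z"
  using group.inv_closed[OF group_PPSL2Z] quad_turn_carrier tri_turn_carrier
  by (simp_all add: alpha0_def beta0_def)

lemma half_turn_closed: "z \<in> S1 \<Longrightarrow> half_turn z \<in> S1" and tri_turn_closed: "z \<in> S1 \<Longrightarrow> tri_turn z \<in> S1"
  using carrier_closed half_turn_carrier tri_turn_carrier by blast+

lemma alpha0_apply: "z \<in> S1 \<Longrightarrow> alpha0 z = quad_turn (half_turn z)"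
  using inv_apply_cancel(1)[OF quad_turn_carrier, of "quad_turn (half_turn z)"]
  by (simp add: alpha0_def quad_turn_closed half_turn_closed quad_turn_quad_turn half_turn_half_turn)

lemma alpha0_alpha0:
  assumes "z \<in> S1"
  shows "alpha0 (alpha0 z) = half_turn z"
proof -
  have *: "half_turn (quad_turn t) = quad_turn (half_turn t)" if "t \<in> S1" for t
    using that by (metis quad_turn_quad_turn quad_turn_closed)
  have "alpha0 (alpha0 z) = quad_turn (half_turn (quad_turn (half_turn z)))"
    using assms by (simp add: alpha0_apply quad_turn_closed half_turn_closed)
  also have "\<dots> = quad_turn (quad_turn z)"
    using assms by (simp add: * half_turn_closed half_turn_half_turn)
  finally show ?thesis
    using assms by (simp add: quad_turn_quad_turn)
qed

lemma tri_turn_cube: "z \<in> S1 \<Longrightarrow> tri_turn (tri_turn (tri_turn z)) = z"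
proof -
  assume z: "z \<in> S1"
  obtain p q where pq: "(p, q) \<noteq> (0, 0)" "z = cayley p q"
    using S1_cayley[OF z] .
  have "tri_turn (tri_turn (tri_turn z)) = mob (-1) 0 0 (-1) z"
    using z by (simp add: tri_turn_def mob_mob)
  also have "\<dots> = z"
    unfolding pq(2) mob_cayley[OF pq(1)] by (simp add: cayley_minus)
  finally show ?thesis .
qed

lemma beta0_apply: "z \<in> S1 \<Longrightarrow> beta0 z = tri_turn (tri_turn z)"
  using inv_apply_cancel(1)[OF tri_turn_carrier, of "tri_turn (tri_turn z)"]
  by (simp add: beta0_def tri_turn_closed tri_turn_cube)

text \<open>The inverse of \<open>alpha0\<close> composed with \<open>beta0\<close>. It sends
  \<infinity> to 1/2, then to -1, 1, 0 and back to \<infinity>, which is where the order five comes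
  from.\<close>

definition penta_turn :: "complex \<Rightarrow> complex" where
  "penta_turn z = tri_turn (quad_turn z)"

lemma penta_turn_closed: "z \<in> S1 \<Longrightarrow> penta_turn z \<in> S1"
  by (simp add: penta_turn_def quad_turn_closed tri_turn_closed)

lemma penta_turn_inj: "z \<in> S1 \<Longrightarrow> t \<in> S1 \<Longrightarrow> penta_turn z = penta_turn t \<longleftrightarrow> z = t"
  using circle_homeo_eq_iff[OF carrier_imp_homeo[OF quad_turn_carrier]]
    circle_homeo_eq_iff[OF carrier_imp_homeo[OF tri_turn_carrier]]
  by (simp add: penta_turn_def quad_turn_closed)

lemma penta_turn_inf: "penta_turn ptinf = pt (1 / 2)"
  by (simp add: penta_turn_def quad_turn_inf tri_turn_pt)

lemma penta_turn_pt:
  "x \<le> -1 \<Longrightarrow> penta_turn (pt x) = pt (x / (2 * x + 1))"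
  "-1 \<le> x \<Longrightarrow> x < 0 \<Longrightarrow> penta_turn (pt x) = pt (- 1 / x)"
  "penta_turn (pt 0) = ptinf"
  "0 < x \<Longrightarrow> x \<le> 1 \<Longrightarrow> penta_turn (pt x) = pt ((x - 1) / x)"
  "1 \<le> x \<Longrightarrow> penta_turn (pt x) = pt ((x - 1) / (2 * x - 1))"
proof -
  show "penta_turn (pt x) = pt (x / (2 * x + 1))" if "x \<le> -1"
  proof -
    have "- (x + 1) / x \<noteq> 1" "1 / (1 - - (x + 1) / x) = x / (2 * x + 1)"
      using that by (simp_all add: field_simps)
    then show ?thesis using that by (simp add: penta_turn_def quad_turn_pt tri_turn_pt)
  qed
  show "penta_turn (pt x) = pt (- 1 / x)" if "-1 \<le> x" "x < 0"
    using that by (simp add: penta_turn_def quad_turn_pt tri_turn_pt)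
  show "penta_turn (pt 0) = ptinf"
    by (simp add: penta_turn_def quad_turn_pt tri_turn_pt)
  show "penta_turn (pt x) = pt ((x - 1) / x)" if "0 < x" "x \<le> 1"
  proof (cases "x = 1")
    case False
    then have "1 / (1 - x) \<noteq> 1" "1 / (1 - 1 / (1 - x)) = (x - 1) / x"
      using that by (simp_all add: field_simps)
    then show ?thesis using that False by (simp add: penta_turn_def quad_turn_pt tri_turn_pt)
  qed (simp add: penta_turn_def quad_turn_pt tri_turn_inf)
  show "penta_turn (pt x) = pt ((x - 1) / (2 * x - 1))" if "1 \<le> x"
  proof (cases "x = 1")
    case False
    then have "x / (1 - x) \<noteq> 1" "1 / (1 - x / (1 - x)) = (x - 1) / (2 * x - 1)"
      using that by (simp_all add: field_simps)
    then show ?thesis using that False by (simp add: penta_turn_def quad_turn_pt tri_turn_pt)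
  qed (simp add: penta_turn_def quad_turn_pt tri_turn_inf)
qed

definition penta_fixed :: "complex \<Rightarrow> bool" where
  "penta_fixed z \<longleftrightarrow> penta_turn (penta_turn (penta_turn (penta_turn (penta_turn z)))) = z"

text \<open>By injectivity the identity to be proved can be pulled back along an orbit, from one
  side of the pentagon to another.\<close>

lemma penta_fixed_back: "z \<in> S1 \<Longrightarrow> penta_fixed (penta_turn z) \<Longrightarrow> penta_fixed z"
  by (simp add: penta_fixed_def penta_turn_inj penta_turn_closed)

text \<open>The five sides of the ideal pentagon \<open>\<infinity>, -1, 0, 1/2, 1\<close> are permuted cyclically, so it is enough
  to compute the fifth power on one of them.\<close>

lemma penta_turn_order:
  assumes "z \<in> S1"
  shows "penta_fixed z"
proof -
  have p1: "penta_fixed (pt x)" if x: "x \<le> -1" for x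
  proof -
    let ?y = "x / (2 * x + 1)"
    have 0: "2 * x + 1 \<noteq> 0" "x \<noteq> 0" using x by simp_all
    then have "?y - 1 = - (x + 1) / (2 * x + 1)"
      by (simp add: field_simps)
    then have 1: "0 < ?y" "?y \<le> 1" "(?y - 1) / ?y = - (x + 1) / x"
      using x 0 by (simp_all add: divide_simps)
    then have 2: "penta_turn (penta_turn (pt x)) = pt (- (x + 1) / x)"
      using x by (simp add: penta_turn_pt)
    show ?thesis
    \<comment> \<open>The orbit of -1 passes through 0 and \<infinity>, where the formulas for the
      open sides do not apply.\<close>
    proof (cases "x = -1")
      case True
      then show ?thesis
        unfolding penta_fixed_def 2 by (simp add: penta_turn_pt penta_turn_inf)
    next
      case False
      have neg: "x + 1 < 0" "x < 0" using x False by simp_all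
      have "x / (x + 1) - 1 = - 1 / (x + 1)" "2 * (x / (x + 1)) - 1 = (x - 1) / (x + 1)"
        "1 / (1 - x) - 1 = x / (1 - x)"
        using neg by (simp_all add: diff_frac_eq divide_simps)
      then have 3: "(x / (x + 1) - 1) / (2 * (x / (x + 1)) - 1) = 1 / (1 - x)"
        "(1 / (1 - x) - 1) / (1 / (1 - x)) = x"
        using neg by (simp_all add: divide_simps)
      have 4: "- 1 \<le> - (x + 1) / x" "- (x + 1) / x < 0" "1 \<le> x / (x + 1)"
        "0 < 1 / (1 - x)" "1 / (1 - x) \<le> 1" "- 1 / (- (x + 1) / x) = x / (x + 1)"
        using neg by (simp_all add: divide_simps) (simp add: algebra_simps)
      show ?thesis
        unfolding penta_fixed_def 2 penta_turn_pt(2)[OF 4(1,2)] 4(6) penta_turn_pt(5)[OF 4(3)] 3(1)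
          penta_turn_pt(4)[OF 4(4,5)] 3(2) ..
    qed
  qed
  \<comment> \<open>From here on each side or vertex is sent by \<open>penta_turn\<close> to one
    that is already settled.\<close>
  have p3: "penta_fixed (pt x)" if x: "0 < x" "x \<le> 1 / 2" for x
  proof (rule penta_fixed_back)
    have "x \<le> 1" "(x - 1) / x \<le> -1" using x by (simp_all add: divide_le_eq)
    then show "penta_fixed (penta_turn (pt x))"
      unfolding penta_turn_pt(4)[OF x(1) \<open>x \<le> 1\<close>] by (intro p1)
  qed simp
  have pinf: "penta_fixed ptinf"
    by (rule penta_fixed_back; use p3[of "1 / 2"] in \<open>simp add: penta_turn_inf\<close>)
  have p0: "penta_fixed (pt 0)"
    by (rule penta_fixed_back; use pinf in \<open>simp add: penta_turn_pt(3)\<close>)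
  have p5: "penta_fixed (pt x)" if x: "1 \<le> x" for x
  proof (rule penta_fixed_back)
    show "penta_fixed (penta_turn (pt x))"
    proof (cases "x = 1")
      case True
      show ?thesis unfolding penta_turn_pt(5)[OF x] using p0 by (simp add: True)
    next
      case False
      then have "0 < (x - 1) / (2 * x - 1)" "(x - 1) / (2 * x - 1) \<le> 1 / 2"
        using x by (simp_all add: divide_le_eq zero_less_divide_iff)
      then show ?thesis unfolding penta_turn_pt(5)[OF x] by (rule p3)
    qed
  qed simp
  have p2: "penta_fixed (pt x)" if x: "-1 \<le> x" "x < 0" for x
  proof (rule penta_fixed_back)
    have "1 \<le> - 1 / x" using x by (simp add: field_simps)
    then show "penta_fixed (penta_turn (pt x))"
      unfolding penta_turn_pt(2)[OF x] by (rule p5)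
  qed simp
  have p4: "penta_fixed (pt x)" if x: "1 / 2 \<le> x" "x < 1" for x
  proof (rule penta_fixed_back)
    have le: "0 < x" "x \<le> 1" using x by simp_all
    have "-1 \<le> (x - 1) / x" "(x - 1) / x < 0" using x by (simp_all add: le_divide_eq divide_less_0_iff)
    then show "penta_fixed (penta_turn (pt x))"
      unfolding penta_turn_pt(4)[OF le] by (rule p2)
  qed simp
  show ?thesis
    using assms
  proof (cases rule: S1_cases)
    case (2 x)
    consider "x \<le> -1" | "-1 \<le> x" "x < 0" | "x = 0" | "0 < x" "x \<le> 1 / 2" | "1 / 2 \<le> x" "x < 1" | "1 \<le> x"
      by linarith
    then show ?thesis
      using p0 p1 p2 p3 p4 p5 2 by cases auto
  qed (use pinf in simp)
qed

text \<open>This composite is the inverse of \<beta>\<alpha>\<beta>. Hence \<beta>\<alpha>\<beta>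
  moves only points x > 0, and both commutator relations become statements about disjoint
  supports.\<close>

lemma tri_quad_tri_fixed:
  "tri_turn (quad_turn (tri_turn ptinf)) = ptinf"
  "x \<le> 0 \<Longrightarrow> tri_turn (quad_turn (tri_turn (pt x))) = pt x"
proof -
  show "tri_turn (quad_turn (tri_turn ptinf)) = ptinf"
    by (simp add: tri_turn_inf quad_turn_pt tri_turn_pt)
  show "tri_turn (quad_turn (tri_turn (pt x))) = pt x" if "x \<le> 0"
  proof (cases "x = 0")
    case True
    then show ?thesis by (simp add: tri_turn_pt quad_turn_pt tri_turn_inf)
  next
    case False
    then have "0 \<le> 1 / (1 - x)" "1 / (1 - x) < 1" "1 / (1 - 1 / (1 - x)) \<noteq> 1"
      "1 / (1 - 1 / (1 - 1 / (1 - x))) = x"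
      using that by (simp_all add: field_simps)
    then show ?thesis using that False by (simp add: tri_turn_pt quad_turn_pt)
  qed
qed

lemma beta0_alpha0_beta0_fixed:
  assumes "z = ptinf \<or> (\<exists>x\<le>0. z = pt x)"
  shows "beta0 (alpha0 (beta0 z)) = z"
proof -
  have z: "z \<in> S1" and fixed: "tri_turn (quad_turn (tri_turn z)) = z"
    using assms tri_quad_tri_fixed by auto
  have "beta0 (alpha0 (beta0 (tri_turn (quad_turn (tri_turn z))))) = z"
    using z inv_apply_cancel(1)[OF quad_turn_carrier] inv_apply_cancel(1)[OF tri_turn_carrier]
    by (simp add: alpha0_def beta0_def tri_turn_closed quad_turn_closed)
  then show ?thesis unfolding fixed .
qed

interpretation PPSL2Z: group PPSL2Z
  by (rule group_PPSL2Z)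

lemma relations_alpha0_beta0: "PPSL2Z.ppsl2z_relations alpha0 beta0"
proof -
  note ap = mult_apply carrier_closed one_apply
  let ?s = "alpha0 \<otimes>\<^bsub>PPSL2Z\<^esub> alpha0"
  let ?u = "beta0 \<otimes>\<^bsub>PPSL2Z\<^esub> alpha0 \<otimes>\<^bsub>PPSL2Z\<^esub> beta0"
  let ?v = "?s \<otimes>\<^bsub>PPSL2Z\<^esub> ?u \<otimes>\<^bsub>PPSL2Z\<^esub> ?s"
  let ?w = "?s \<otimes>\<^bsub>PPSL2Z\<^esub> (beta0 \<otimes>\<^bsub>PPSL2Z\<^esub> beta0) \<otimes>\<^bsub>PPSL2Z\<^esub> ?v \<otimes>\<^bsub>PPSL2Z\<^esub> beta0 \<otimes>\<^bsub>PPSL2Z\<^esub> ?s"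
  have "alpha0 \<otimes>\<^bsub>PPSL2Z\<^esub> (alpha0 \<otimes>\<^bsub>PPSL2Z\<^esub> (alpha0 \<otimes>\<^bsub>PPSL2Z\<^esub> alpha0)) = \<one>\<^bsub>PPSL2Z\<^esub>"
    by (rule carrier_eqI) (simp_all add: ap alpha0_alpha0 half_turn_closed half_turn_half_turn)
  moreover have b3: "beta0 (beta0 (beta0 z)) = z" if "z \<in> S1" for z
    using that by (simp add: beta0_apply tri_turn_closed tri_turn_cube)
  then have "beta0 \<otimes>\<^bsub>PPSL2Z\<^esub> (beta0 \<otimes>\<^bsub>PPSL2Z\<^esub> beta0) = \<one>\<^bsub>PPSL2Z\<^esub>"
    by (intro carrier_eqI) (simp_all add: ap)
  moreover have "(alpha0 \<otimes>\<^bsub>PPSL2Z\<^esub> beta0) [^]\<^bsub>PPSL2Z\<^esub> (5::nat) = \<one>\<^bsub>PPSL2Z\<^esub>"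
  proof (rule carrier_eqI)
    fix z assume z: "z \<in> S1"
    let ?k = "\<lambda>z. alpha0 (beta0 z)"
    have k: "?k (penta_turn t) = t" if "t \<in> S1" for t
      using that inv_apply_cancel(1)[OF quad_turn_carrier] inv_apply_cancel(1)[OF tri_turn_carrier]
      by (simp add: penta_turn_def alpha0_def beta0_def quad_turn_closed)
    have "?k (?k (?k (?k (?k (penta_turn (penta_turn (penta_turn (penta_turn (penta_turn z))))))))) = z"
      using z by (simp add: k penta_turn_closed)
    then have "?k (?k (?k (?k (?k z)))) = z"
      using penta_turn_order[OF z] unfolding penta_fixed_def by simp
    then show "((alpha0 \<otimes>\<^bsub>PPSL2Z\<^esub> beta0) [^]\<^bsub>PPSL2Z\<^esub> (5::nat)) z = \<one>\<^bsub>PPSL2Z\<^esub> z"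
      using z by (simp add: ap eval_nat_numeral)
  qed simp_all
  moreover have "?u \<otimes>\<^bsub>PPSL2Z\<^esub> ?v = ?v \<otimes>\<^bsub>PPSL2Z\<^esub> ?u"
  proof (rule commute_disjoint)
    fix z assume z: "z \<in> S1"
    \<comment> \<open>The half turn exchanges x > 0 and x < 0, so its conjugate \<open>?v\<close> of
      \<open>?u\<close> moves only negative points.\<close>
    have v: "?v z = half_turn (beta0 (alpha0 (beta0 (half_turn z))))"
      using z by (simp add: ap alpha0_alpha0 half_turn_closed)
    have "?u z = beta0 (alpha0 (beta0 z))"
      using z by (simp add: ap)
    moreover have "beta0 (alpha0 (beta0 z)) = z \<or> beta0 (alpha0 (beta0 (half_turn z))) = half_turn z"
      using z
    proof (cases rule: S1_cases)
      case (2 x)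
      show ?thesis
      proof (cases "x \<le> 0")
        case False
        then have "half_turn z = pt (- 1 / x)" "- 1 / x \<le> 0"
          using 2 by (simp_all add: half_turn_pt)
        then show ?thesis using beta0_alpha0_beta0_fixed by blast
      qed (use 2 beta0_alpha0_beta0_fixed in blast)
    qed (use beta0_alpha0_beta0_fixed in blast)
    ultimately show "?u z = z \<or> ?v z = z"
      unfolding v using half_turn_half_turn[OF z] by auto
  qed simp_all
  moreover have "?u \<otimes>\<^bsub>PPSL2Z\<^esub> ?w = ?w \<otimes>\<^bsub>PPSL2Z\<^esub> ?u"
  proof (rule commute_disjoint)
    fix z assume z: "z \<in> S1"
    \<comment> \<open>In coordinates \<open>?t\<close> is -1/(x + 1). The element \<open>?w\<close>
      is the conjugate of \<open>?u\<close> by this map, which takes x > 0 to negative numbers; so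
      \<open>?w\<close> fixes every point that \<open>?u\<close> can move.\<close>
    let ?t = "half_turn (beta0 (half_turn z))"
    have w: "?w z = half_turn (beta0 (beta0 (half_turn (beta0 (alpha0 (beta0 ?t))))))"
      using z by (simp add: ap alpha0_alpha0 half_turn_closed)
    have undo: "half_turn (beta0 (beta0 (half_turn ?t))) = z"
      using z b3 by (simp add: half_turn_half_turn carrier_closed half_turn_closed)
    have "?u z = beta0 (alpha0 (beta0 z))"
      using z by (simp add: ap)
    moreover have "beta0 (alpha0 (beta0 z)) = z \<or> beta0 (alpha0 (beta0 ?t)) = ?t"
      using z
    proof (cases rule: S1_cases)
      case (2 x)
      show ?thesis
      proof (cases "x \<le> 0")
        case False
        then have "1 / (1 - - 1 / x) \<noteq> 1" "1 / (1 - 1 / (1 - - 1 / x)) = x + 1" "- 1 / x \<noteq> 1" "x + 1 \<noteq> 0" "- 1 / (x + 1) \<le> 0"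
          by (simp_all add: field_simps)
        then have "?t = pt (- 1 / (x + 1))"
          using 2 False by (simp add: half_turn_pt beta0_apply tri_turn_pt del: divide_minus_left)
        then show ?thesis using beta0_alpha0_beta0_fixed \<open>- 1 / (x + 1) \<le> 0\<close> by blast
      qed (use 2 beta0_alpha0_beta0_fixed in blast)
    qed (use beta0_alpha0_beta0_fixed in blast)
    ultimately show "?u z = z \<or> ?w z = z"
      unfolding w using undo by auto
  qed simp_all
  ultimately show ?thesis
    unfolding PPSL2Z.ppsl2z_relations_def Let_def by blast
qed

section \<open>Translation and contraction, and the action on the circle\<close>

definition transl :: "complex \<Rightarrow> complex" where
  "transl = beta0 \<otimes>\<^bsub>PPSL2Z\<^esub> (alpha0 \<otimes>\<^bsub>PPSL2Z\<^esub> alpha0)"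

definition contr :: "complex \<Rightarrow> complex" where
  "contr = inv\<^bsub>PPSL2Z\<^esub> beta0 \<otimes>\<^bsub>PPSL2Z\<^esub> alpha0"

lemma transl_carrier [simp]: "transl \<in> carrier PPSL2Z" and contr_carrier [simp]: "contr \<in> carrier PPSL2Z"
  by (simp_all add: transl_def contr_def)

lemma transl_inf: "transl ptinf = ptinf" and transl_pt: "transl (pt x) = pt (x + 1)"
proof -
  have "transl z = mob 1 1 0 1 z" if "z \<in> S1" for z
    using that unfolding transl_def
    by (simp add: mult_apply alpha0_alpha0 carrier_closed half_turn_closed beta0_apply)
      (simp add: half_turn_def tri_turn_def mob_mob)
  then show "transl ptinf = ptinf" "transl (pt x) = pt (x + 1)"
    by (simp_all add: mob_pt mob_inf_inf)
qed

lemma contr_inf: "contr ptinf = ptinf" and contr_pt: "contr (pt x) = pt (contraction x)"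
proof -
  have "inv\<^bsub>PPSL2Z\<^esub> beta0 = tri_turn"
    unfolding beta0_def using tri_turn_carrier by simp
  then have "contr z = tri_turn (quad_turn (half_turn z))" if "z \<in> S1" for z
    using that tri_turn_carrier unfolding contr_def by (simp add: mult_apply alpha0_apply)
  then show "contr ptinf = ptinf" "contr (pt x) = pt (contraction x)"
    by (simp_all add: turns_contraction)
qed

lemma transl_pow: "(transl [^]\<^bsub>PPSL2Z\<^esub> (n::nat)) (pt x) = pt (x + real n)"
  by (induction n arbitrary: x) (simp_all add: one_apply mult_apply transl_pt algebra_simps)

lemma contr_pow: "(contr [^]\<^bsub>PPSL2Z\<^esub> (n::nat)) (pt x) = pt ((contraction ^^ n) x)"
  by (induction n arbitrary: x) (simp_all add: one_apply mult_apply contr_pt funpow_swap1)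

text \<open>The group acts through \<open>h\<close>, so the axioms of the action only concern the
  images of its generators: the translation x + 1, the map \<open>contraction\<close> and the turn
  of the triangle. Leaving the group arbitrary makes room for the quotient of the free
  group.\<close>

lemma thompson_action_PPSL2Z:
  assumes G: "group G" and x: "x \<in> carrier G" and y: "y \<in> carrier G" and rels: "group.ppsl2z_relations G x y"
    and h: "h \<in> hom G PPSL2Z" and hx: "h x = alpha0" and hy: "h y = beta0"
  shows "thompson_action G (y \<otimes>\<^bsub>G\<^esub> (x \<otimes>\<^bsub>G\<^esub> x)) (inv\<^bsub>G\<^esub> y \<otimes>\<^bsub>G\<^esub> x) (inv\<^bsub>G\<^esub> y) h S1 ptinf (pt 1)"
proof -
  interpret G: group G by (rule G)
  interpret h: group_hom G PPSL2Z h
    using h by unfold_locales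
  interpret thompson_relations G "y \<otimes>\<^bsub>G\<^esub> (x \<otimes>\<^bsub>G\<^esub> x)" "inv\<^bsub>G\<^esub> y \<otimes>\<^bsub>G\<^esub> x" "inv\<^bsub>G\<^esub> y"
    by (rule G.thompson_relationsI[OF x y rels])
  have hA: "h (y \<otimes>\<^bsub>G\<^esub> (x \<otimes>\<^bsub>G\<^esub> x)) = transl"
    using x y by (simp add: transl_def hx hy)
  have hB: "h (inv\<^bsub>G\<^esub> y \<otimes>\<^bsub>G\<^esub> x) = contr"
    using x y by (simp add: contr_def hx hy)
  have hC: "h (inv\<^bsub>G\<^esub> y) = tri_turn"
    using y tri_turn_carrier by (simp add: hy beta0_def)
  have hpow: "h (z [^]\<^bsub>G\<^esub> (n::nat)) = h z [^]\<^bsub>PPSL2Z\<^esub> n" if "z \<in> carrier G" for z n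
    using that by (rule h.hom_nat_pow)
  have v2: "h (inv\<^bsub>G\<^esub> (y \<otimes>\<^bsub>G\<^esub> (x \<otimes>\<^bsub>G\<^esub> x))) (pt 1) = pt 0"
    using inv_apply_cancel(1)[OF transl_carrier, of "pt 0"] transl_pt[of 0]
    unfolding h.hom_inv[OF closed(1)] hA by simp
  \<comment> \<open>The first application takes 0 to 1/2, and (0, 1] is mapped into itself, so no
    iterate returns to 0.\<close>
  have contr0: "0 < (contraction ^^ Suc n) 0 \<and> (contraction ^^ Suc n) 0 \<le> 1" for n
  proof (induction n)
    case 0
    show ?case by (simp add: contraction_def)
  next
    case (Suc n)
    have "0 < contraction t \<and> contraction t \<le> 1" if "0 < t \<and> t \<le> 1" for t
      using that by (simp add: contraction_def)
    from this[OF Suc] show ?case by simp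
  qed
  show ?thesis
  proof
    show "h z p \<in> S1" if "z \<in> carrier G" "p \<in> S1" for z p
      using that carrier_closed h.hom_closed by blast
    show "h \<one>\<^bsub>G\<^esub> p = p" if "p \<in> S1" for p
      using that one_apply by simp
    show "h (z \<otimes>\<^bsub>G\<^esub> t) p = h z (h t p)" if "z \<in> carrier G" "t \<in> carrier G" "p \<in> S1" for z t p
      using that by (simp add: mult_apply)
    show "ptinf \<in> S1" "pt 1 \<in> S1" by simp_all
    show "h (y \<otimes>\<^bsub>G\<^esub> (x \<otimes>\<^bsub>G\<^esub> x)) ptinf = ptinf" "h (inv\<^bsub>G\<^esub> y \<otimes>\<^bsub>G\<^esub> x) ptinf = ptinf" "h (inv\<^bsub>G\<^esub> y) ptinf \<noteq> ptinf"
      unfolding hA hB hC by (simp_all add: transl_inf contr_inf tri_turn_inf)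
    show "h (inv\<^bsub>G\<^esub> y \<otimes>\<^bsub>G\<^esub> x) (h ((y \<otimes>\<^bsub>G\<^esub> (x \<otimes>\<^bsub>G\<^esub> x)) [^]\<^bsub>G\<^esub> i) (pt 1)) = h ((y \<otimes>\<^bsub>G\<^esub> (x \<otimes>\<^bsub>G\<^esub> x)) [^]\<^bsub>G\<^esub> i) (pt 1)" for i :: nat
      unfolding hpow[OF closed(1)] hA hB transl_pow contr_pt by (simp add: contraction_def)
    show "h ((y \<otimes>\<^bsub>G\<^esub> (x \<otimes>\<^bsub>G\<^esub> x)) [^]\<^bsub>G\<^esub> d) (pt 1) \<noteq> pt 1" if "d > 0" for d :: nat
      unfolding hpow[OF closed(1)] hA transl_pow using that by simp
    show "h ((inv\<^bsub>G\<^esub> y \<otimes>\<^bsub>G\<^esub> x) [^]\<^bsub>G\<^esub> d) (h (inv\<^bsub>G\<^esub> (y \<otimes>\<^bsub>G\<^esub> (x \<otimes>\<^bsub>G\<^esub> x))) (pt 1)) \<noteq> h (inv\<^bsub>G\<^esub> (y \<otimes>\<^bsub>G\<^esub> (x \<otimes>\<^bsub>G\<^esub> x))) (pt 1)"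
      if "d > 0" for d :: nat
      unfolding v2 hpow[OF closed(2)] hB contr_pow using contr0[of "d - 1"] that by simp
  qed
qed

section \<open>The generators generate\<close>

text \<open>Right multiplication by the matrices of the half turn and of the turn of the triangle
  \<open>\<infinity>, 0, 1\<close> reaches all of SL(2,Z), by the Euclidean algorithm on the bottom row.\<close>

lemma SL2Z_induct:
  fixes a b c d :: int
  assumes "a * d - b * c = 1" and one: "P 1 0 0 1"
    and S: "\<And>a b c d. a * d - b * c = 1 \<Longrightarrow> P a b c d \<Longrightarrow> P b (- a) d (- c)"
    and U: "\<And>a b c d. a * d - b * c = 1 \<Longrightarrow> P a b c d \<Longrightarrow> P (- b) (a + b) (- d) (c + d)"
  shows "P a b c d"
proof -
  have neg: "P (- a) (- b) (- c) (- d)" if "a * d - b * c = 1" "P a b c d" for a b c d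
    using S[OF _ S[OF that]] that(1) by (simp add: algebra_simps)
  have down: "P a (b - a) c (d - c)" if "a * d - b * c = 1" "P a b c d" for a b c d
    using U[OF _ S[OF that]] that(1) by (simp add: algebra_simps)
  have up: "P a (b + a) c (d + c)" if "a * d - b * c = 1" "P a b c d" for a b c d
  proof -
    have "P (- (a + b)) a (- (c + d)) c"
      using U[OF _ U[OF that]] that(1) by (simp add: algebra_simps)
    moreover have "- (a + b) * c - a * - (c + d) = 1"
      using that(1) by (simp add: algebra_simps)
    ultimately have "P a (- (- (a + b))) c (- (- (c + d)))"
      by (rule S[rotated])
    then show ?thesis by (simp add: algebra_simps)
  qed
  have shift: "P a (b + k * a) c (d + k * c)" if "a * d - b * c = 1" "P a b c d" for a b c d k
  proof (induction k rule: int_induct[where k = 0])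
    case base
    then show ?case using that by simp
  next
    case (step1 i)
    have "a * (d + i * c) - (b + i * a) * c = 1" using that(1) by (simp add: algebra_simps)
    from up[OF this step1(2)] show ?case by (simp add: algebra_simps)
  next
    case (step2 i)
    have "a * (d + i * c) - (b + i * a) * c = 1" using that(1) by (simp add: algebra_simps)
    from down[OF this step2(2)] show ?case by (simp add: algebra_simps)
  qed
  show ?thesis
    using assms(1)
  proof (induction "nat \<bar>c\<bar>" arbitrary: a b c d rule: less_induct)
    case less
    show ?case
    proof (cases "c = 0")
      case True
      then have "a * d = 1" using less.prems by simp
      then have ad: "a = 1 \<and> d = 1 \<or> a = - 1 \<and> d = - 1"
        using pos_zmult_eq_1_iff_lemma zmult_eq_1_iff by blast
      have "P 1 k 0 1" for k
        using shift[of 1 1 0 0 k] one by simp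
      then show ?thesis
        using ad True neg[of 1 1 "- b" 0] by auto
    next
      case False
      \<comment> \<open>Adding k times the first column replaces d by the remainder of d modulo c,
        and the half turn then moves this remainder into the place of c.\<close>
      define k where "k = - (d div c)"
      have d': "d + k * c = d mod c"
        by (simp add: k_def minus_div_mult_eq_mod)
      have det: "a * (d + k * c) - (b + k * a) * c = 1"
        using less.prems by (simp add: algebra_simps)
      have det': "(b + k * a) * (- c) - (- a) * (d + k * c) = 1"
        using det by (simp add: algebra_simps)
      have "nat \<bar>d + k * c\<bar> < nat \<bar>c\<bar>"
        unfolding d' using abs_mod_less[OF False, of d] by simp
      from less.hyps[OF this det'] have "P (b + k * a) (- a) (d + k * c) (- c)" .
      from S[OF det' this] have "P (- a) (- (b + k * a)) (- c) (- (d + k * c))" .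
      then have "P a (b + k * a) c (d + k * c)"
        using neg[of "- a" "- (d + k * c)" "- (b + k * a)" "- c"] det by (simp add: algebra_simps)
      from shift[OF det this, of "- k"] show ?thesis
        by simp
    qed
  qed
qed

section \<open>The generated subgroup and the matrices it contains\<close>

abbreviation gen :: "(complex \<Rightarrow> complex) set" where
  "gen \<equiv> generate PPSL2Z {alpha0, beta0}"

lemma gen_subset: "g \<in> gen \<Longrightarrow> g \<in> carrier PPSL2Z"
  using PPSL2Z.generate_in_carrier[of "{alpha0, beta0}"] by simp

lemma gen_mult: "g \<in> gen \<Longrightarrow> h \<in> gen \<Longrightarrow> g \<otimes>\<^bsub>PPSL2Z\<^esub> h \<in> gen"
  by (rule generate.eng)

lemma gen_inv: "g \<in> gen \<Longrightarrow> inv\<^bsub>PPSL2Z\<^esub> g \<in> gen"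
  by (rule PPSL2Z.generate_m_inv_closed) simp_all

lemma smob_mult:
  assumes "a * d - b * c = 1" "a' * d' - b' * c' = 1"
  shows "smob a b c d \<otimes>\<^bsub>PPSL2Z\<^esub> smob a' b' c' d' =
    smob (a * a' + b * c') (a * b' + b * d') (c * a' + d * c') (c * b' + d * d')"
proof (rule carrier_eqI)
  have "(a * a' + b * c') * (c * b' + d * d') - (a * b' + b * d') * (c * a' + d * c') =
      (a * d - b * c) * (a' * d' - b' * c')"
    by (simp add: algebra_simps)
  then show "smob (a * a' + b * c') (a * b' + b * d') (c * a' + d * c') (c * b' + d * d') \<in> carrier PPSL2Z"
    using assms by (intro smob_carrier) simp
qed (use assms smob_carrier in \<open>auto simp: mult_apply mob_mob\<close>)

lemma half_turn_gen: "half_turn \<in> gen"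
proof -
  have "alpha0 \<otimes>\<^bsub>PPSL2Z\<^esub> alpha0 = half_turn"
    by (rule carrier_eqI) (simp_all add: mult_apply alpha0_alpha0 half_turn_carrier)
  then show ?thesis
    using gen_mult[of alpha0 alpha0] generate.incl[of alpha0 "{alpha0, beta0}" PPSL2Z] by simp
qed

lemma tri_turn_gen: "tri_turn \<in> gen"
proof -
  have "tri_turn = inv\<^bsub>PPSL2Z\<^esub> beta0"
    unfolding beta0_def using tri_turn_carrier by simp
  then show ?thesis
    using generate.inv[of beta0 "{alpha0, beta0}" PPSL2Z] by simp
qed

lemma smob_gen:
  assumes "a * d - b * c = 1"
  shows "smob a b c d \<in> gen"
  using assms
proof (rule SL2Z_induct)
  have "smob 1 0 0 1 = \<one>\<^bsub>PPSL2Z\<^esub>"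
    by (rule carrier_eqI) (simp_all add: smob_carrier mob_id one_apply)
  then show "smob 1 0 0 1 \<in> gen"
    using generate.one by metis
next
  fix a b c d :: int assume *: "a * d - b * c = 1" "smob a b c d \<in> gen"
  show "smob b (- a) d (- c) \<in> gen"
    using gen_mult[OF *(2) half_turn_gen] smob_mult[OF *(1), of 0 0 "-1" 1] by (simp add: half_turn_def)
  show "smob (- b) (a + b) (- d) (c + d) \<in> gen"
    using gen_mult[OF *(2) tri_turn_gen] smob_mult[OF *(1), of 0 1 1 "-1"] by (simp add: tri_turn_def)
qed

lemma rational_transitive:
  assumes "z \<in> rational_points"
  obtains a b c d where "a * d - b * c = 1" "smob a b c d ptinf = z"
proof -
  obtain p q :: int where pq: "(p, q) \<noteq> (0, 0)" "z = cayley (of_int p) (of_int q)"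
    using rational_pointsE[OF assms] by metis
  define g where "g = gcd p q"
  have g: "g \<noteq> 0" using pq(1) by (simp add: g_def)
  obtain a c where ac: "p = a * g" "q = c * g" "coprime a c"
    using gcd_coprime_exists[of p q] g unfolding g_def by blast
  obtain u v where "u * a + v * c = 1"
    using bezout_int[of a c] ac(3) by (metis coprime_iff_gcd_eq_1)
  then have det: "a * u - (- v) * c = 1"
    by (simp add: algebra_simps)
  have "smob a (- v) c u ptinf = cayley (of_int a) (of_int c)"
    using mob_ptinf_cayley by simp
  also have "\<dots> = z"
    unfolding pq(2) ac(1,2) using cayley_scale[of "of_int g" "of_int a" "of_int c"] g by (simp add: mult.commute)
  finally show ?thesis using det that by blast
qed

subsection \<open>Homeomorphisms fixing infinity\<close>

definition fixinf :: "(complex \<Rightarrow> complex) \<Rightarrow> bool" where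
  "fixinf f \<longleftrightarrow> f \<in> carrier PPSL2Z \<and> f ptinf = ptinf"

text \<open>Meaningful for maps that fix \<infinity>: such a map takes the line to itself, and this
  is its expression in the real coordinate.\<close>

definition rf :: "(complex \<Rightarrow> complex) \<Rightarrow> real \<Rightarrow> real" where
  "rf f x = (THE y. f (pt x) = pt y)"

lemma fixinf_carrier: "fixinf f \<Longrightarrow> f \<in> carrier PPSL2Z"
  by (simp add: fixinf_def)

lemma rf_eqI: "f (pt x) = pt y \<Longrightarrow> rf f x = y"
  unfolding rf_def by (rule the_equality) simp_all

lemma rf: "f (pt x) = pt (rf f x)" if "fixinf f"
proof -
  have c: "f \<in> carrier PPSL2Z" "f ptinf = ptinf"
    using that by (simp_all add: fixinf_def)
  have "f (pt x) \<in> S1"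
    using carrier_closed[OF c(1)] by simp
  then show ?thesis
  proof (cases rule: S1_cases)
    case 1
    then show ?thesis
      using circle_homeo_eq_iff[OF carrier_imp_homeo[OF c(1)], of "pt x" ptinf] c(2) by simp
  next
    case (2 y)
    then show ?thesis using rf_eqI by metis
  qed
qed

lemma rf_strict_mono: "fixinf f \<Longrightarrow> rf f x < rf f y \<longleftrightarrow> x < y"
  using circle_homeo_ccw[OF carrier_imp_homeo[OF fixinf_carrier], of f ptinf "pt x" "pt y"]
  by (simp add: rf ccw_inf) (simp add: fixinf_def rf ccw_inf)

lemma rf_mono: "fixinf f \<Longrightarrow> rf f x \<le> rf f y \<longleftrightarrow> x \<le> y"
  using rf_strict_mono[of f y x] by linarith

lemma fixinf_mult: "fixinf f \<Longrightarrow> fixinf g \<Longrightarrow> fixinf (f \<otimes>\<^bsub>PPSL2Z\<^esub> g)"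
  by (simp add: fixinf_def mult_apply)

lemma rf_mult: "fixinf f \<Longrightarrow> fixinf g \<Longrightarrow> rf (f \<otimes>\<^bsub>PPSL2Z\<^esub> g) x = rf f (rf g x)"
  by (rule rf_eqI) (simp add: fixinf_carrier mult_apply rf)

lemma fixinf_inv: "fixinf f \<Longrightarrow> fixinf (inv\<^bsub>PPSL2Z\<^esub> f)"
  unfolding fixinf_def using inv_apply_cancel(1)[of f ptinf] by auto

lemma rf_inv: "fixinf f \<Longrightarrow> rf f (rf (inv\<^bsub>PPSL2Z\<^esub> f) x) = x" "fixinf f \<Longrightarrow> rf (inv\<^bsub>PPSL2Z\<^esub> f) (rf f x) = x"
proof -
  assume f: "fixinf f"
  have "pt (rf f (rf (inv\<^bsub>PPSL2Z\<^esub> f) x)) = pt x"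
    using inv_apply_cancel(2)[OF fixinf_carrier[OF f], of "pt x"] rf[OF f] rf[OF fixinf_inv[OF f]] by simp
  then show "rf f (rf (inv\<^bsub>PPSL2Z\<^esub> f) x) = x" by simp
  have "pt (rf (inv\<^bsub>PPSL2Z\<^esub> f) (rf f x)) = pt x"
    using inv_apply_cancel(1)[OF fixinf_carrier[OF f], of "pt x"] rf[OF f] rf[OF fixinf_inv[OF f]] by simp
  then show "rf (inv\<^bsub>PPSL2Z\<^esub> f) (rf f x) = x" by simp
qed

text \<open>By \<open>agrees_pt_iff\<close> this is \<open>agrees_with_PSL2Z\<close> on the image of
  \<open>I\<close> under \<open>pt\<close>. It asks for one matrix on all of \<open>I\<close>, not
  for an affine map.\<close>

definition lin :: "(complex \<Rightarrow> complex) \<Rightarrow> real set \<Rightarrow> bool" where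
  "lin f I \<longleftrightarrow> (\<exists>a b c d. a * d - b * c = 1 \<and> (\<forall>x\<in>I. f (pt x) = mob a b c d (pt x)))"

lemma lin_subset: "lin f I \<Longrightarrow> J \<subseteq> I \<Longrightarrow> lin f J"
  unfolding lin_def by (meson subsetD)

lemma linI: "a * d - b * c = 1 \<Longrightarrow> (\<And>x. x \<in> I \<Longrightarrow> f (pt x) = mob a b c d (pt x)) \<Longrightarrow> lin f I"
  unfolding lin_def by blast

lemma lin_mult:
  assumes "fixinf f" "fixinf g" "lin g I" "lin f (rf g ` I)"
  shows "lin (f \<otimes>\<^bsub>PPSL2Z\<^esub> g) I"
proof -
  obtain a b c d where g: "a * d - b * c = 1" "\<And>x. x \<in> I \<Longrightarrow> g (pt x) = mob a b c d (pt x)"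
    using assms(3) unfolding lin_def by blast
  obtain a' b' c' d' where f: "a' * d' - b' * c' = 1" "\<And>x. x \<in> rf g ` I \<Longrightarrow> f (pt x) = mob a' b' c' d' (pt x)"
    using assms(4) unfolding lin_def by blast
  have det: "(a' * a + b' * c) * (c' * b + d' * d) - (a' * b + b' * d) * (c' * a + d' * c) = 1"
  proof -
    have "(a' * a + b' * c) * (c' * b + d' * d) - (a' * b + b' * d) * (c' * a + d' * c) =
        (a' * d' - b' * c') * (a * d - b * c)"
      by (simp add: algebra_simps)
    then show ?thesis using f(1) g(1) by simp
  qed
  show ?thesis
  proof (rule linI[OF det])
    fix x assume x: "x \<in> I"
    have "(f \<otimes>\<^bsub>PPSL2Z\<^esub> g) (pt x) = f (pt (rf g x))"
      using assms(1,2) by (simp add: mult_apply fixinf_carrier rf)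
    also have "\<dots> = mob a' b' c' d' (pt (rf g x))"
      using f(2) x by simp
    also have "pt (rf g x) = mob a b c d (pt x)"
      using rf[OF assms(2)] g(2)[OF x] by simp
    finally show "(f \<otimes>\<^bsub>PPSL2Z\<^esub> g) (pt x) = mob (a' * a + b' * c) (a' * b + b' * d) (c' * a + d' * c) (c' * b + d' * d) (pt x)"
      using mob_mob[OF g(1)] by simp
  qed
qed

lemma carrier_continuous: "f \<in> carrier PPSL2Z \<Longrightarrow> continuous_on S1 f"
  using circle_homeo_facts(3)[OF carrier_imp_homeo] .

lemma lin_closure:
  assumes f: "f \<in> carrier PPSL2Z" and "x < y" "lin f {x<..<y}"
  shows "lin f {x..y}"
proof -
  obtain a b c d where m: "a * d - b * c = 1" "\<And>t. t \<in> {x<..<y} \<Longrightarrow> f (pt t) = mob a b c d (pt t)"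
    using assms(3) unfolding lin_def by blast
  have "f (pt x) = mob a b c d (pt x)"
  proof (rule agree_at_limit[OF carrier_continuous[OF f] m(1) tendsto_pt])
    show "\<forall>\<^sub>F t in at_right x. pt t \<in> S1 \<and> f (pt t) = mob a b c d (pt t)"
      by (rule eventually_at_rightI[of x y]) (use m(2) assms(2) in auto)
  qed simp_all
  moreover have "f (pt y) = mob a b c d (pt y)"
  proof (rule agree_at_limit[OF carrier_continuous[OF f] m(1) tendsto_pt])
    show "\<forall>\<^sub>F t in at_left y. pt t \<in> S1 \<and> f (pt t) = mob a b c d (pt t)"
      by (rule eventually_at_leftI[of x y]) (use m(2) assms(2) in auto)
  qed simp_all
  ultimately have "f (pt t) = mob a b c d (pt t)" if "t \<in> {x..y}" for t
    using m(2)[of t] that by (cases "t = x \<or> t = y") auto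
  then show ?thesis by (rule linI[OF m(1)])
qed

lemma mob_pt_eq_pt:
  assumes "a * d - b * c = 1" "mob a b c d (pt x) = pt y"
  shows "of_int c * x + of_int d \<noteq> 0" "y * (of_int c * x + of_int d) = of_int a * x + of_int b"
proof -
  show nz: "of_int c * x + of_int d \<noteq> 0"
    using mob_pt_inf[OF assms(1)] assms(2) by fastforce
  have "(of_int a * x + of_int b) / (of_int c * x + of_int d) = y"
    using mob_pt[OF nz] assms(2) by simp
  then show "y * (of_int c * x + of_int d) = of_int a * x + of_int b"
    using nz by (simp add: field_simps)
qed

lemma int_unit_cases: "a * d = (1::int) \<Longrightarrow> a = 1 \<and> d = 1 \<or> a = - 1 \<and> d = - 1"
  using zmult_eq_1_iff by blast

text \<open>By continuity the matrix fixes \<infinity>, so its entry c vanishes. An integral upper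
  triangular matrix of determinant one acts as translation by an integer.\<close>

lemma lin_infinity:
  assumes f: "fixinf f" and X: "filterlim X at_infinity F" "F \<noteq> bot" "\<forall>\<^sub>F t in F. X t \<in> I" and lin: "lin f I"
  obtains m :: int where "\<And>x. x \<in> I \<Longrightarrow> f (pt x) = pt (x + of_int m)"
proof -
  obtain a b c d where m: "a * d - b * c = 1" "\<And>x. x \<in> I \<Longrightarrow> f (pt x) = mob a b c d (pt x)"
    using lin unfolding lin_def by blast
  have "f ptinf = mob a b c d ptinf"
  proof (rule agree_at_limit[OF carrier_continuous[OF fixinf_carrier[OF f]] m(1) tendsto_pt_infinity[OF X(1)] X(2)])
    show "\<forall>\<^sub>F t in F. pt (X t) \<in> S1 \<and> f (pt (X t)) = mob a b c d (pt (X t))"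
      using X(3) by (rule eventually_mono) (use m(2) in simp)
  qed simp
  then have "c = 0"
    using mob_inf[of c a b d] f unfolding fixinf_def by fastforce
  then have "a = 1 \<and> d = 1 \<or> a = - 1 \<and> d = - 1"
    using m(1) int_unit_cases by simp
  then have "mob a b c d (pt x) = pt (x + of_int (b * d))" for x
    using \<open>c = 0\<close> by (auto simp: mob_pt)
  then show ?thesis using that m(2) by metis
qed

lemma fixinf_infinity:
  assumes "fixinf f"
  obtains N :: nat and m m' :: int where
    "\<And>x. real N \<le> x \<Longrightarrow> rf f x = x + of_int m" "\<And>x. x \<le> - real N \<Longrightarrow> rf f x = x + of_int m'"
proof -
  have "piecewise_PSL2Z f"
    using fixinf_carrier[OF assms] by (simp add: carrier_PPSL2Z)
  then obtain R where R: "finite R" "\<And>I. connected I \<Longrightarrow> I \<inter> R = {} \<Longrightarrow> lin f I"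
    using piecewise_breakpoints[of f] unfolding agrees_pt_iff lin_def by blast
  obtain N :: nat where N: "{real N<..} \<inter> R = {}" "{..<- real N} \<inter> R = {}"
    using finite_gap_infinity[OF R(1)] by blast
  have top: "lin f {real N<..}" and bot: "lin f {..<- real N}"
    using R(2) N by simp_all
  have "\<forall>\<^sub>F t in at_top. t \<in> {real N<..}" "\<forall>\<^sub>F t in at_bot. t \<in> {..<- real N}"
    using eventually_gt_at_top[of "real N"] eventually_gt_at_bot[of "- real N"] by simp_all
  note ev = this
  obtain m where m: "\<And>x. x \<in> {real N<..} \<Longrightarrow> f (pt x) = pt (x + of_int m)"
    using lin_infinity[OF assms filterlim_at_top_imp_at_infinity[OF filterlim_ident] trivial_limit_at_top_linorder ev(1) top]
    by blast
  obtain m' where m': "\<And>x. x \<in> {..<- real N} \<Longrightarrow> f (pt x) = pt (x + of_int m')"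
    using lin_infinity[OF assms filterlim_at_bot_imp_at_infinity[OF filterlim_ident] trivial_limit_at_bot_linorder ev(2) bot]
    by blast
  show ?thesis
    \<comment> \<open>The successor turns the strict inequalities of the open rays into the weak
      ones of the conclusion.\<close>
    using m m' by (intro that[of "Suc N" m m'] rf_eqI) auto
qed

section \<open>Translations, contractions and expansions based at an integer\<close>

definition tr :: "int \<Rightarrow> complex \<Rightarrow> complex" where
  "tr k = smob 1 k 0 1"

lemma tr_gen: "tr k \<in> gen"
  unfolding tr_def by (rule smob_gen) simp

lemma tr_pt: "tr k (pt x) = pt (x + of_int k)"
  by (simp add: tr_def mob_pt)

lemma fixinf_tr: "fixinf (tr k)"
  unfolding fixinf_def using gen_subset[OF tr_gen] by (simp add: tr_def mob_inf_inf)

lemma rf_tr: "rf (tr k) x = x + of_int k"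
  by (rule rf_eqI) (rule tr_pt)

lemma lin_tr: "lin (tr k) I"
  by (rule linI[of 1 1 k 0]) (simp_all add: tr_def)

lemma fixinf_contr: "fixinf contr" and rf_contr: "rf contr x = contraction x"
  by (simp_all add: fixinf_def contr_inf rf_eqI contr_pt)

lemma contr_gen: "contr \<in> gen"
  unfolding contr_def by (intro gen_mult gen_inv generate.incl) simp_all

definition con :: "int \<Rightarrow> complex \<Rightarrow> complex" where
  "con k = tr k \<otimes>\<^bsub>PPSL2Z\<^esub> (contr \<otimes>\<^bsub>PPSL2Z\<^esub> tr (- k))"

definition expa :: "int \<Rightarrow> complex \<Rightarrow> complex" where
  "expa k = inv\<^bsub>PPSL2Z\<^esub> (con k)"

text \<open>The inverse of \<open>contraction\<close>. It maps [0, 1/2] onto [-1, 0] and [1/2, 1]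
  onto [0, 1], each by one matrix, and thus undoes one subdivision of the unit interval at the
  mediant of its ends.\<close>

definition expansion :: "real \<Rightarrow> real" where
  "expansion x = (if x \<le> 0 then x - 1 else if x \<le> 1 / 2 then (2 * x - 1) / (1 - x)
     else if x \<le> 1 then (2 * x - 1) / x else x)"

lemma con_gen: "con k \<in> gen" and expa_gen: "expa k \<in> gen"
  unfolding con_def expa_def by (intro gen_mult gen_inv tr_gen contr_gen)+

lemma fixinf_con: "fixinf (con k)" and fixinf_expa: "fixinf (expa k)"
  unfolding con_def expa_def by (intro fixinf_mult fixinf_inv fixinf_tr fixinf_contr)+

lemma rf_con: "rf (con k) x = contraction (x - of_int k) + of_int k"
  unfolding con_def by (simp add: rf_mult fixinf_mult fixinf_tr fixinf_contr rf_tr rf_contr)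

lemma contraction_expansion: "contraction (expansion x) = x"
proof -
  consider "x \<le> 0" | "0 < x" "x \<le> 1 / 2" | "1 / 2 < x" "x \<le> 1" | "1 < x" by linarith
  then show ?thesis
  proof cases
    case 2
    then have "-1 < (2 * x - 1) / (1 - x)" "(2 * x - 1) / (1 - x) \<le> 0"
      by (simp_all add: field_simps)
    moreover have "((2 * x - 1) / (1 - x) + 1) / ((2 * x - 1) / (1 - x) + 2) = x"
    proof -
      have "(2 * x - 1) / (1 - x) + 1 = x / (1 - x)" "(2 * x - 1) / (1 - x) + 2 = 1 / (1 - x)"
        using 2 by (simp_all add: field_simps)
      then show ?thesis using 2 by simp
    qed
    ultimately show ?thesis using 2 by (simp add: contraction_def expansion_def)
  next
    case 3
    define y where "y = (2 * x - 1) / x"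
    have "0 < y" "y \<le> 1" "1 / (2 - y) = x"
      unfolding y_def using 3 by (simp_all add: field_simps)
    then have "contraction y = x"
      by (simp add: contraction_def)
    then show ?thesis using 3 by (simp add: expansion_def y_def)
  qed (simp_all add: contraction_def expansion_def)
qed

lemma rf_expa: "rf (expa k) x = expansion (x - of_int k) + of_int k"
proof -
  have "rf (con k) (rf (expa k) x) = x" "rf (con k) (expansion (x - of_int k) + of_int k) = x"
    unfolding expa_def using rf_inv(1)[OF fixinf_con] by (simp_all add: rf_con contraction_expansion)
  then show ?thesis
    using rf_strict_mono[OF fixinf_con] by (metis less_irrefl linorder_neqE)
qed

lemma lin_contr: "lin contr {of_int n..of_int n + 1}"
proof -
  consider "n \<le> -2" | "n = -1" | "n = 0" | "1 \<le> n" by linarith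
  then show ?thesis
  proof cases
    case 1
    then have "real_of_int n \<le> -2" by linarith
    then show ?thesis
      by (intro linI[of 1 1 1 0]) (auto simp: contr_pt mob_pt contraction_def)
  next
    case 2
    have "contr (pt x) = mob 1 1 1 2 (pt x)" if "-1 \<le> x" "x \<le> 0" for x
      using that by (simp add: contr_pt contraction_def mob_pt)
    then show ?thesis using 2 by (intro linI[of 1 2 1 1]) auto
  next
    case 3
    have "contr (pt x) = mob 0 1 (-1) 2 (pt x)" if "0 \<le> x" "x \<le> 1" for x
      using that by (simp add: contr_pt contraction_def mob_pt)
    then show ?thesis using 3 by (intro linI[of 0 2 1 "-1"]) auto
  next
    case 4
    have "contr (pt x) = mob 1 0 0 1 (pt x)" if "1 \<le> x" for x
      using that by (cases "x = 1") (simp_all add: contr_pt contraction_def mob_pt)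
    moreover have "real_of_int n \<ge> 1" using 4 by linarith
    ultimately show ?thesis by (intro linI[of 1 1 0 0]) auto
  qed
qed

lemma lin_conj_tr:
  assumes "fixinf f" "lin f ((\<lambda>x. x - of_int k) ` I)"
  shows "lin (tr k \<otimes>\<^bsub>PPSL2Z\<^esub> (f \<otimes>\<^bsub>PPSL2Z\<^esub> tr (- k))) I"
proof (rule lin_mult)
  show "lin (f \<otimes>\<^bsub>PPSL2Z\<^esub> tr (- k)) I"
    using assms by (intro lin_mult fixinf_tr lin_tr) (simp_all add: rf_tr)
qed (simp_all add: assms fixinf_mult fixinf_tr lin_tr)

lemma lin_con: "lin (con k) {of_int n..of_int n + 1}"
  unfolding con_def
proof (rule lin_conj_tr[OF fixinf_contr lin_subset[OF lin_contr[of "n - k"]]])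
  show "(\<lambda>x. x - real_of_int k) ` {of_int n..of_int n + 1} \<subseteq> {of_int (n - k)..of_int (n - k) + 1}"
    by auto
qed

text \<open>Besides the integers k and k + 1, the only possible break is k + 1/2. It is the one that
  needs care when \<open>expa k\<close> is composed on the left.\<close>

lemma lin_expa:
  "lin (expa k) {..of_int k}" "lin (expa k) {of_int k..of_int k + 1 / 2}"
  "lin (expa k) {of_int k + 1 / 2..of_int k + 1}" "lin (expa k) {of_int k + 1..}"
proof -
  let ?e = "inv\<^bsub>PPSL2Z\<^esub> contr"
  have e: "fixinf ?e" by (rule fixinf_inv[OF fixinf_contr])
  have rfe: "rf ?e x = expansion x" for x
  proof -
    have "rf contr (rf ?e x) = rf contr (expansion x)"
      using rf_inv(1)[OF fixinf_contr] by (simp add: rf_contr contraction_expansion)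
    then show ?thesis
      using rf_strict_mono[OF fixinf_contr] by (metis less_irrefl linorder_neqE)
  qed
  have ept: "?e (pt x) = pt (expansion x)" for x
    using rf[OF e] rfe by simp
  have inv_tr: "inv\<^bsub>PPSL2Z\<^esub> tr j = tr (- j)" for j
  proof (rule carrier_eqI)
    show "inv\<^bsub>PPSL2Z\<^esub> tr j \<in> carrier PPSL2Z" "tr (- j) \<in> carrier PPSL2Z"
      using gen_subset[OF tr_gen] by simp_all
    fix z assume "z \<in> S1"
    then show "(inv\<^bsub>PPSL2Z\<^esub> tr j) z = tr (- j) z"
    proof (cases rule: S1_cases)
      case 1
      then show ?thesis using fixinf_inv[OF fixinf_tr] fixinf_tr unfolding fixinf_def by metis
    next
      case (2 x)
      have "(inv\<^bsub>PPSL2Z\<^esub> tr j) (tr j (pt (x - of_int j))) = pt (x - of_int j)"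
        by (rule inv_apply_cancel(1)) (simp_all add: gen_subset[OF tr_gen])
      then show ?thesis using 2 by (simp add: tr_pt)
    qed
  qed
  have expa: "expa k = tr k \<otimes>\<^bsub>PPSL2Z\<^esub> (?e \<otimes>\<^bsub>PPSL2Z\<^esub> tr (- k))"
    unfolding expa_def con_def using gen_subset[OF tr_gen]
    by (simp add: PPSL2Z.inv_mult_group inv_tr PPSL2Z.m_assoc)
  have 1: "lin ?e {..0}"
    by (rule linI[of 1 1 "-1" 0]) (simp_all add: ept mob_pt expansion_def)
  have 2: "lin ?e {0..1 / 2}"
    by (rule linI[of 2 1 "-1" "-1"]) (auto simp: ept mob_pt expansion_def)
  have 3: "lin ?e {1 / 2..1}"
    by (rule linI[of 2 0 "-1" 1]) (auto simp: ept mob_pt expansion_def)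
  have 4: "lin ?e {1..}"
    by (rule linI[of 1 1 0 0]) (auto simp: ept mob_pt expansion_def)
  show "lin (expa k) {..of_int k}"
    unfolding expa by (rule lin_conj_tr[OF e lin_subset[OF 1]]) auto
  show "lin (expa k) {of_int k..of_int k + 1 / 2}"
    unfolding expa by (rule lin_conj_tr[OF e lin_subset[OF 2]]) auto
  show "lin (expa k) {of_int k + 1 / 2..of_int k + 1}"
    unfolding expa by (rule lin_conj_tr[OF e lin_subset[OF 3]]) auto
  show "lin (expa k) {of_int k + 1..}"
    unfolding expa by (rule lin_conj_tr[OF e lin_subset[OF 4]]) auto
qed

subsection \<open>Denominators\<close>

text \<open>The denominator in lowest terms, expressed so that any positive n with n x integral is
  at once an upper bound.\<close>

definition qden :: "real \<Rightarrow> nat" where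
  "qden x = (LEAST n. 0 < n \<and> real n * x \<in> \<int>)"

lemma qden_le: "0 < n \<Longrightarrow> real n * x \<in> \<int> \<Longrightarrow> qden x \<le> n"
  unfolding qden_def by (rule Least_le) simp

lemma qden:
  assumes "x \<in> \<rat>"
  shows "0 < qden x" "real (qden x) * x \<in> \<int>"
proof -
  obtain a b :: int where ab: "b > 0" "x = of_int a / of_int b"
    using assms by (rule Rats_cases')
  then have "0 < nat b \<and> real (nat b) * x \<in> \<int>"
    by simp
  then have "0 < qden x \<and> real (qden x) * x \<in> \<int>"
    unfolding qden_def by (rule LeastI)
  then show "0 < qden x" "real (qden x) * x \<in> \<int>" by simp_all
qed

lemma qden_int: "x \<in> \<int> \<Longrightarrow> qden x = 1"
  using qden_le[of 1 x] qden(1)[of x] by (metis Ints_subset_Rats One_nat_def le_antisym less_eq_Suc_le mult_1 of_nat_1 subsetD zero_less_one)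

lemma qden_1_int: "x \<in> \<rat> \<Longrightarrow> qden x \<le> 1 \<Longrightarrow> x \<in> \<int>"
  using qden[of x] by (cases "qden x") auto

lemma expansion_rat: "x \<in> \<rat> \<Longrightarrow> expansion x \<in> \<rat>"
  by (simp add: expansion_def)

text \<open>For x = p/q in (0, 1) the image is (2p - q)/(q - p) or (2p - q)/p, and both q - p and p
  are positive and smaller than q. Outside (0, 1) the map is the identity or subtracts 1, so q still
  clears the denominator.\<close>

lemma qden_expansion:
  assumes "x \<in> \<rat>"
  shows "qden (expansion x) \<le> qden x" and "0 < x \<Longrightarrow> x < 1 \<Longrightarrow> qden (expansion x) < qden x"
proof -
  let ?q = "qden x"
  have q: "0 < ?q" "real ?q * x \<in> \<int>" using qden[OF assms] .
  obtain p where p: "real ?q * x = of_int p" using q(2) by (auto simp: Ints_def)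
  show strict: "qden (expansion x) < ?q" if x: "0 < x" "x < 1"
  proof -
    have "0 < real ?q * x" "real ?q * x < real ?q"
      using x q(1) by simp_all
    then have p0: "0 < p" "p < int ?q"
      unfolding p by linarith+
    show ?thesis
    proof (cases "x \<le> 1 / 2")
      case True
      have "real (?q - nat p) = real ?q * (1 - x)"
        using p0 p by (simp add: of_nat_diff algebra_simps)
      then have "real (?q - nat p) * expansion x = real ?q * ((1 - x) * expansion x)"
        by (simp only: mult.assoc)
      also have "(1 - x) * expansion x = 2 * x - 1"
        using True x by (simp add: expansion_def)
      also have "real ?q * (2 * x - 1) = 2 * (real ?q * x) - real ?q"
        by (simp add: algebra_simps)
      also have "\<dots> = of_int (2 * p - int ?q)"
        unfolding p by simp
      finally have "real (?q - nat p) * expansion x \<in> \<int>"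
        by (simp only: Ints_of_int)
      moreover have "0 < ?q - nat p" using p0 by linarith
      ultimately have "qden (expansion x) \<le> ?q - nat p"
        by (rule qden_le[rotated])
      then show ?thesis using p0 by linarith
    next
      case False
      have "real (nat p) = real ?q * x"
        using p0 p by simp
      then have "real (nat p) * expansion x = 2 * (real ?q * x) - real ?q"
        using False x by (simp add: expansion_def field_simps)
      also have "\<dots> = of_int (2 * p - int ?q)"
        unfolding p by simp
      finally have "real (nat p) * expansion x \<in> \<int>"
        by (simp only: Ints_of_int)
      moreover have "0 < nat p" using p0 by simp
      ultimately have "qden (expansion x) \<le> nat p"
        by (rule qden_le[rotated])
      then show ?thesis using p0 by linarith
    qed
  qed
  show "qden (expansion x) \<le> ?q"
  proof (cases "0 < x \<and> x < 1")
    case True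
    then show ?thesis using strict by simp
  next
    case False
    then have "real ?q * expansion x \<in> \<int>"
      using q(2) by (auto simp: expansion_def right_diff_distrib)
    then show ?thesis using q(1) by (intro qden_le)
  qed
qed

lemma qden_shift: "x \<in> \<rat> \<Longrightarrow> qden (x + of_int k) = qden x"
proof -
  have le: "qden (x + of_int k) \<le> qden x" if "x \<in> \<rat>" for x k
    using qden[OF that] by (intro qden_le) (simp_all add: distrib_left)
  assume "x \<in> \<rat>"
  then show ?thesis
    using le[of x k] le[of "x + of_int k" "- k"] by simp
qed

lemma rf_expa_rat:
  assumes "x \<in> \<rat>"
  shows "rf (expa k) x \<in> \<rat>" "qden (rf (expa k) x) \<le> qden x"
    "of_int k < x \<Longrightarrow> x < of_int k + 1 \<Longrightarrow> qden (rf (expa k) x) < qden x"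
proof -
  have r: "x - of_int k \<in> \<rat>" using assms by simp
  have eq: "qden (x - of_int k) = qden x" using qden_shift[OF assms, of "- k"] by simp
  have eq2: "qden (rf (expa k) x) = qden (expansion (x - of_int k))"
    unfolding rf_expa by (rule qden_shift[OF expansion_rat[OF r]])
  show "rf (expa k) x \<in> \<rat>"
    unfolding rf_expa using expansion_rat[OF r] by simp
  show "qden (rf (expa k) x) \<le> qden x"
    using qden_expansion(1)[OF r] eq eq2 by simp
  show "of_int k < x \<Longrightarrow> x < of_int k + 1 \<Longrightarrow> qden (rf (expa k) x) < qden x"
    using qden_expansion(2)[OF r] eq eq2 by simp
qed

lemma rf_expa_int: "x \<in> \<int> \<Longrightarrow> rf (expa k) x \<in> \<int>"
  using rf_expa_rat[of x k] qden_int[of x] qden_1_int[of "rf (expa k) x"] Ints_subset_Rats by auto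

subsection \<open>Making the breakpoints integral\<close>

definition breaks_in :: "(complex \<Rightarrow> complex) \<Rightarrow> real set \<Rightarrow> bool" where
  "breaks_in f R \<longleftrightarrow> (\<forall>x y. x < y \<longrightarrow> {x<..<y} \<inter> (R \<union> \<int>) = {} \<longrightarrow> lin f {x<..<y})"

lemma gap_floor:
  fixes x y :: real
  assumes "x < y" "{x<..<y} \<inter> \<int> = {}"
  shows "{x<..<y} \<subseteq> {of_int \<lfloor>x\<rfloor>..of_int \<lfloor>x\<rfloor> + 1}"
proof -
  have "y \<le> of_int \<lfloor>x\<rfloor> + 1"
  proof (rule ccontr)
    assume "\<not> y \<le> of_int \<lfloor>x\<rfloor> + 1"
    then have "of_int (\<lfloor>x\<rfloor> + 1) \<in> {x<..<y}" by simp
    then show False using assms(2) Ints_of_int by blast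
  qed
  then show ?thesis
    using of_int_floor_le[of x] by (auto simp del: of_int_floor_le)
qed

text \<open>Precomposition with \<open>con k\<close> transports the breaks by the inverse map
  \<open>expa k\<close>. This never raises a denominator and lowers all those of points strictly
  between k and k + 1, so with k the floor of a nonintegral break the sum of the denominators
  decreases.\<close>

lemma integral_breakpoints:
  assumes "fixinf f" "finite R" "R \<subseteq> \<rat>" "breaks_in f R"
  shows "\<exists>g\<in>gen. fixinf g \<and> (\<forall>n::int. lin (f \<otimes>\<^bsub>PPSL2Z\<^esub> g) {of_int n..of_int n + 1})"
  using assms
proof (induction "\<Sum>r\<in>R. qden r" arbitrary: f R rule: less_induct)
  case less
  show ?case
  proof (cases "R \<subseteq> \<int>")
    case True
    have "lin f {of_int n..of_int n + 1}" for n
    proof (rule lin_closure[OF fixinf_carrier[OF less.prems(1)]])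
      have "{real_of_int n<..<of_int n + 1} \<inter> \<int> = {}"
        by (auto simp: Ints_def)
      then show "lin f {of_int n<..<of_int n + 1}"
        using less.prems(4) True unfolding breaks_in_def by (metis Un_absorb1 less_add_one)
    qed simp
    moreover have "f \<otimes>\<^bsub>PPSL2Z\<^esub> \<one>\<^bsub>PPSL2Z\<^esub> = f"
      using fixinf_carrier[OF less.prems(1)] by simp
    moreover have "fixinf \<one>\<^bsub>PPSL2Z\<^esub>"
      by (simp add: fixinf_def one_apply)
    ultimately show ?thesis
      using generate.one[of PPSL2Z "{alpha0, beta0}"] by (intro bexI[of _ "\<one>\<^bsub>PPSL2Z\<^esub>"]) auto
  next
    case False
    then obtain r0 where r0: "r0 \<in> R" "r0 \<notin> \<int>" by blast
    define k where "k = \<lfloor>r0\<rfloor>"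
    have k: "of_int k < r0" "r0 < of_int k + 1"
      using r0(2) unfolding k_def by (metis Ints_of_int of_int_floor_le order_le_less, linarith)
    let ?e = "rf (expa k)" and ?c = "rf (con k)"
    let ?f = "f \<otimes>\<^bsub>PPSL2Z\<^esub> con k"
    have ec: "?e (?c x) = x" for x
      unfolding expa_def by (rule rf_inv(2)[OF fixinf_con])
    have fix_f: "fixinf ?f"
      using less.prems(1) fixinf_con by (rule fixinf_mult)
    have sub: "?e ` R \<subseteq> \<rat>"
      using rf_expa_rat(1) less.prems(3) by blast
    have "breaks_in ?f (?e ` R)"
      unfolding breaks_in_def
    proof (intro allI impI)
      fix x y :: real assume xy: "x < y" "{x<..<y} \<inter> (?e ` R \<union> \<int>) = {}"
      show "lin ?f {x<..<y}"
      proof (rule lin_mult[OF less.prems(1) fixinf_con])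
        show "lin (con k) {x<..<y}"
          using gap_floor[OF xy(1)] xy(2) by (intro lin_subset[OF lin_con]) blast
        have "t \<notin> R \<union> \<int>" if t: "t \<in> {?c x<..<?c y}" for t
        proof -
          have "?e t \<in> {x<..<y}"
            using t rf_strict_mono[OF fixinf_expa, of k "?c x" t] rf_strict_mono[OF fixinf_expa, of k t "?c y"] by (simp add: ec)
          then show ?thesis using xy(2) rf_expa_int by blast
        qed
        then have "lin f {?c x<..<?c y}"
          using less.prems(4) xy(1) rf_strict_mono[OF fixinf_con] unfolding breaks_in_def by blast
        then show "lin f (?c ` {x<..<y})"
          by (rule lin_subset) (auto simp: rf_strict_mono[OF fixinf_con])
      qed
    qed
    moreover have "(\<Sum>r\<in>?e ` R. qden r) < (\<Sum>r\<in>R. qden r)"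
    proof -
      have "inj_on ?e R"
        using rf_strict_mono[OF fixinf_expa, of k] by (intro inj_onI) (metis less_irrefl linorder_neqE)
      then have "(\<Sum>r\<in>?e ` R. qden r) = (\<Sum>r\<in>R. qden (?e r))"
        by (simp add: sum.reindex)
      also have "\<dots> < (\<Sum>r\<in>R. qden r)"
        using less.prems(2,3) r0(1) k rf_expa_rat(2,3)
        by (intro sum_strict_mono_ex1) blast+
      finally show ?thesis .
    qed
    ultimately obtain g where g: "g \<in> gen" "fixinf g"
      "\<And>n::int. lin (?f \<otimes>\<^bsub>PPSL2Z\<^esub> g) {of_int n..of_int n + 1}"
      using less.hyps[OF _ fix_f finite_imageI[OF less.prems(2)] sub] by blast
    have "?f \<otimes>\<^bsub>PPSL2Z\<^esub> g = f \<otimes>\<^bsub>PPSL2Z\<^esub> (con k \<otimes>\<^bsub>PPSL2Z\<^esub> g)"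
      using fixinf_carrier less.prems(1) fixinf_con g(2) by (simp add: PPSL2Z.m_assoc)
    then show ?thesis
      using g con_gen gen_mult fixinf_mult fixinf_con by (intro bexI[of _ "con k \<otimes>\<^bsub>PPSL2Z\<^esub> g"]) auto
  qed
qed

subsection \<open>Making the values at the integers integral\<close>

text \<open>As \<open>f\<close> takes finite values on the interval, c x + d has no zero there and
  hence constant sign. The matrix may be negated without changing the map, which makes the sign
  positive.\<close>

lemma lin_unit_matrix:
  fixes n :: int
  assumes f: "fixinf f" and lin: "lin f {of_int n..of_int n + 1}"
  shows "\<exists>a b c d :: int. a * d - b * c = 1 \<and> c * n + d > 0 \<and> c * (n + 1) + d > 0 \<and>
    (\<forall>x\<in>{of_int n..of_int n + 1}. rf f x * (of_int c * x + of_int d) = of_int a * x + of_int b)"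
proof -
  obtain a b c d where m: "a * d - b * c = 1" "\<And>x. x \<in> {of_int n..of_int n + 1} \<Longrightarrow> f (pt x) = mob a b c d (pt x)"
    using lin unfolding lin_def by blast
  have nz: "of_int c * x + of_int d \<noteq> 0" and eq: "rf f x * (of_int c * x + of_int d) = of_int a * x + of_int b"
    if "of_int n \<le> x" "x \<le> of_int n + 1" for x
  proof -
    have "mob a b c d (pt x) = pt (rf f x)"
      using m(2)[of x] that rf[OF f] by simp
    from mob_pt_eq_pt[OF m(1) this] show "of_int c * x + of_int d \<noteq> 0"
      "rf f x * (of_int c * x + of_int d) = of_int a * x + of_int b" .
  qed
  have sign: "(\<forall>x\<in>{real_of_int n..of_int n + 1}. of_int c * x + of_int d > 0) \<or>
      (\<forall>x\<in>{real_of_int n..of_int n + 1}. of_int c * x + of_int d < 0)"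
    by (rule connected_constant_sign) (use nz in \<open>auto intro!: continuous_intros\<close>)
  have cast: "of_int (c * n + d) = of_int c * real_of_int n + of_int d"
    "of_int (c * (n + 1) + d) = of_int c * (real_of_int n + 1) + of_int d" by simp_all
  have "real_of_int (c * n + d) > 0 \<and> real_of_int (c * (n + 1) + d) > 0 \<or>
    real_of_int (c * n + d) < 0 \<and> real_of_int (c * (n + 1) + d) < 0"
    unfolding cast using sign by auto
  then consider "c * n + d > 0" "c * (n + 1) + d > 0" | "c * n + d < 0" "c * (n + 1) + d < 0"
    unfolding of_int_0_less_iff of_int_less_0_iff by blast
  then show ?thesis
  proof cases
    case 1
    show ?thesis
      by (intro exI[of _ a] exI[of _ b] exI[of _ c] exI[of _ d] conjI ballI) (use m(1) 1 eq in simp_all)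
  next
    case 2
    have "rf f x * (of_int (- c) * x + of_int (- d)) = of_int (- a) * x + of_int (- b)"
      if "of_int n \<le> x" "x \<le> of_int n + 1" for x
    proof -
      have "rf f x * (of_int (- c) * x + of_int (- d)) = - (rf f x * (of_int c * x + of_int d))"
        by (simp add: algebra_simps)
      then show ?thesis unfolding eq[OF that] by simp
    qed
    moreover have "- a * - d - - b * - c = 1" "- c * n + - d > 0" "- c * (n + 1) + - d > 0"
      using m(1) 2 by simp_all
    ultimately show ?thesis
      by (intro exI[of _ "- a"] exI[of _ "- b"] exI[of _ "- c"] exI[of _ "- d"] conjI ballI) simp_all
  qed
qed

text \<open>The end points n and n + 1 span a determinant one, and the matrix of \<open>f\<close>
  preserves it: the image is again a Farey interval, from p/q to r/s.\<close>

lemma lin_farey_interval: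
  fixes n :: int
  assumes f: "fixinf f" and lin: "lin f {of_int n..of_int n + 1}"
  obtains p q r s :: int where "q > 0" "s > 0" "r * q - p * s = 1"
    "rf f (of_int n) * of_int q = of_int p" "rf f (of_int n + 1) * of_int s = of_int r"
proof -
  obtain a b c d :: int where m: "a * d - b * c = 1" "c * n + d > 0" "c * (n + 1) + d > 0"
    "\<forall>x\<in>{of_int n..of_int n + 1}. rf f x * (of_int c * x + of_int d) = of_int a * x + of_int b"
    using lin_unit_matrix[OF assms] by blast
  show ?thesis
  proof
    show "(a * (n + 1) + b) * (c * n + d) - (a * n + b) * (c * (n + 1) + d) = 1"
      using m(1) by (simp add: algebra_simps)
  qed (use m(2,3) bspec[OF m(4), of "of_int n"] bspec[OF m(4), of "of_int n + 1"] in simp_all)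
qed

text \<open>By integrality the strict inequalities hold with a gap of 1. Multiplied by q and s and
  subtracted, they give 1 = r q - p s \<ge> q + s.\<close>

lemma farey_interval_no_int:
  fixes p q r s k :: int
  assumes "q > 0" "s > 0" "r * q - p * s = 1" "p < k * q" "k * s < r"
  shows False
proof -
  have "(k * s + 1) * q \<le> r * q" "p * s \<le> (k * q - 1) * s"
    using assms by (simp_all add: mult_right_mono)
  then have "q + s \<le> 1" using assms(3) by (simp add: algebra_simps)
  then show False using assms(1,2) by linarith
qed

text \<open>The same estimate with doubled numerators yields 2 \<ge> q + s. So a Farey interval with
  h/2 in its interior has integral end points.\<close>

lemma farey_interval_half_int:
  fixes p q r s h :: int
  assumes "q > 0" "s > 0" "r * q - p * s = 1" "2 * p < h * q" "h * s < 2 * r"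
  shows "q = 1 \<and> s = 1"
proof -
  have "(h * s + 1) * q \<le> (2 * r) * q" "(2 * p) * s \<le> (h * q - 1) * s"
    using assms by (simp_all add: mult_right_mono)
  then have "q + s \<le> 2 * (r * q - p * s)" by (simp add: algebra_simps)
  then have "q + s \<le> 2" unfolding assms(3) by simp
  then show ?thesis using assms(1,2) by presburger
qed

text \<open>No break of \<open>expa k\<close> falls inside the image of a unit interval. That image
  is a Farey interval, which contains no integer in its interior, and contains k + 1/2 there only if
  it equals [k, k + 1]. This is impossible because the integer \<open>n0\<close>, not strictly
  between n and n + 1, is mapped strictly between k and k + 1.\<close>

lemma lin_expa_interval:
  fixes n k n0 :: int
  assumes f: "fixinf f" and lin: "lin f {of_int n..of_int n + 1}"
    and n0: "of_int k < rf f (of_int n0)" "rf f (of_int n0) < of_int k + 1"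
  shows "lin (expa k) (rf f ` {of_int n..of_int n + 1})"
proof -
  let ?u = "rf f (of_int n)" and ?v = "rf f (of_int n + 1)"
  obtain p q r s :: int where pq: "q > 0" "s > 0" "r * q - p * s = 1"
    "?u * of_int q = of_int p" "?v * of_int s = of_int r"
    by (rule lin_farey_interval[OF f lin])
  have rq: "real_of_int q > 0" "real_of_int s > 0" using pq(1,2) by simp_all
  have no_int: "\<not> (?u < of_int j \<and> of_int j < ?v)" for j :: int
  proof
    assume "?u < of_int j \<and> of_int j < ?v"
    then have "?u * of_int q < of_int j * of_int q" "of_int j * of_int s < ?v * of_int s"
      using rq by simp_all
    then have "p < j * q" "j * s < r"
      unfolding pq(4,5) by (simp_all flip: of_int_mult)
    then show False by (rule farey_interval_no_int[OF pq(1-3)])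
  qed
  have no_half: "\<not> (?u < of_int k + 1 / 2 \<and> of_int k + 1 / 2 < ?v)"
  proof
    assume *: "?u < of_int k + 1 / 2 \<and> of_int k + 1 / 2 < ?v"
    then have "2 * (?u * of_int q) < of_int (2 * k + 1) * of_int q" "of_int (2 * k + 1) * of_int s < 2 * (?v * of_int s)"
    proof -
      have "?u * of_int q < (of_int k + 1 / 2) * of_int q" "(of_int k + 1 / 2) * of_int s < ?v * of_int s"
        using * rq by (simp_all only: mult_strict_right_mono)
      then show "2 * (?u * of_int q) < of_int (2 * k + 1) * of_int q" "of_int (2 * k + 1) * of_int s < 2 * (?v * of_int s)"
        by (simp_all add: algebra_simps)
    qed
    then have "real_of_int (2 * p) < of_int ((2 * k + 1) * q)" "real_of_int ((2 * k + 1) * s) < of_int (2 * r)"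
      unfolding pq(4,5) by simp_all
    then have "2 * p < (2 * k + 1) * q" "(2 * k + 1) * s < 2 * r"
      unfolding of_int_less_iff .
    then have "q = 1 \<and> s = 1" by (rule farey_interval_half_int[OF pq(1-3)])
    then have uv: "?u = of_int p" "?v = of_int r" "r = p + 1" using pq(3-5) by simp_all
    then have "p = k" using * by linarith
    then have "?u = of_int k" "?v = of_int k + 1" using uv by simp_all
    then have "real_of_int n < of_int n0" "real_of_int n0 < of_int n + 1"
      using n0 rf_strict_mono[OF f, of "of_int n" "of_int n0"] rf_strict_mono[OF f, of "of_int n0" "of_int n + 1"] by simp_all
    then show False by simp
  qed
  have im: "rf f ` {of_int n..of_int n + 1} \<subseteq> {?u..?v}"
    using rf_mono[OF f] by auto
  consider "?v \<le> of_int k" | "of_int k \<le> ?u" "?v \<le> of_int k + 1 / 2"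
    | "of_int k + 1 / 2 \<le> ?u" "?v \<le> of_int k + 1" | "of_int k + 1 \<le> ?u"
  proof -
    have "?v \<le> of_int k \<or> of_int k \<le> ?u" "?v \<le> of_int k + 1 / 2 \<or> of_int k + 1 / 2 \<le> ?u"
      "?v \<le> of_int k + 1 \<or> of_int k + 1 \<le> ?u"
      using no_int[of k] no_int[of "k + 1"] no_half by auto
    then show thesis using that by linarith
  qed
  then show ?thesis
  proof cases
    case 1
    then show ?thesis using im by (intro lin_subset[OF lin_expa(1)]) auto
  next
    case 2
    then show ?thesis using im by (intro lin_subset[OF lin_expa(2)]) auto
  next
    case 3
    then show ?thesis using im by (intro lin_subset[OF lin_expa(3)]) auto
  next
    case 4
    then show ?thesis using im by (intro lin_subset[OF lin_expa(4)]) auto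
  qed
qed

text \<open>If u and v are the integral values at the ends, the determinant condition reads (c n +
  d)(c (n + 1) + d)(v - u) = 1. The first two factors are positive, hence both are 1, which forces c
  = 0 and a = d = 1.\<close>

lemma lin_int_translation:
  fixes n :: int
  assumes f: "fixinf f" and lin: "lin f {of_int n..of_int n + 1}"
    and int: "rf f (of_int n) \<in> \<int>" "rf f (of_int n + 1) \<in> \<int>"
  shows "\<exists>m :: int. \<forall>x\<in>{of_int n..of_int n + 1}. rf f x = x + of_int m"
proof -
  obtain a b c d :: int where m: "a * d - b * c = 1" "c * n + d > 0" "c * (n + 1) + d > 0"
    "\<forall>x\<in>{of_int n..of_int n + 1}. rf f x * (of_int c * x + of_int d) = of_int a * x + of_int b"
    using lin_unit_matrix[OF f lin] by blast
  obtain u v :: int where uv: "rf f (of_int n) = of_int u" "rf f (of_int n + 1) = of_int v"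
    using int by (auto simp: Ints_def)
  have "real_of_int (u * (c * n + d)) = of_int (a * n + b)"
    using bspec[OF m(4), of "of_int n"] uv by simp
  then have u: "u * (c * n + d) = a * n + b"
    by (simp only: of_int_eq_iff)
  have "real_of_int (v * (c * (n + 1) + d)) = of_int (a * (n + 1) + b)"
    using bspec[OF m(4), of "of_int n + 1"] uv by simp
  then have v: "v * (c * (n + 1) + d) = a * (n + 1) + b"
    by (simp only: of_int_eq_iff)
  have "(a * (n + 1) + b) * (c * n + d) - (a * n + b) * (c * (n + 1) + d) = 1"
    using m(1) by (simp add: algebra_simps)
  then have "(c * n + d) * ((c * (n + 1) + d) * (v - u)) = 1"
    unfolding u[symmetric] v[symmetric] by (simp add: algebra_simps)
  then have "c * n + d = 1" "(c * (n + 1) + d) * (v - u) = 1"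
    using m(2) int_unit_cases[of "c * n + d"] by auto
  moreover from this(2) have "c * (n + 1) + d = 1"
    using m(3) int_unit_cases[of "c * (n + 1) + d"] by auto
  ultimately have "c = 0" "d = 1" by (auto simp: algebra_simps)
  then have "a = 1" using m(1) by simp
  show ?thesis
    using m(4) \<open>c = 0\<close> \<open>d = 1\<close> \<open>a = 1\<close> by (intro exI[of _ b]) simp
qed

lemma rational_pt: "pt x \<in> rational_points \<longleftrightarrow> x \<in> \<rat>"
proof
  assume "pt x \<in> rational_points"
  then obtain p q :: int where pq: "(real_of_int p, real_of_int q) \<noteq> (0, 0)" "pt x = cayley (of_int p) (of_int q)"
    using rational_pointsE by metis
  show "x \<in> \<rat>"
  proof (cases "q = 0")
    case True
    then have "pt x = ptinf" using pq cayley_inf[of "of_int p"] by simp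
    then show ?thesis by simp
  next
    case False
    then have "pt x = pt (of_int p / of_int q)" using pq(2) cayley_pt[of "of_int q"] by simp
    then show ?thesis by simp
  qed
next
  assume "x \<in> \<rat>"
  then obtain a b :: int where ab: "b > 0" "x = of_int a / of_int b"
    by (rule Rats_cases')
  then have "pt x = cayley (of_int a) (of_int b)"
    by (simp add: cayley_pt)
  then show "pt x \<in> rational_points"
    using rational_pointsI[of a b] ab(1) by simp
qed

lemma rf_rat: "fixinf f \<Longrightarrow> x \<in> \<rat> \<Longrightarrow> rf f x \<in> \<rat>"
  using piecewise_rational[OF carrier_continuous[OF fixinf_carrier], of f "pt x"] fixinf_carrier[of f]
  by (simp add: rf rational_pt carrier_PPSL2Z)

lemma expansion_ge_1: "1 \<le> x \<Longrightarrow> expansion x = x"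
  by (cases "x = 1") (simp_all add: expansion_def)

text \<open>Descent on the denominators of the values at the integers from -N to N. The bound N
  stays the same throughout: beyond it \<open>f\<close> is translation by an integer on each side,
  and \<open>expa k\<close> keeps the one on the right and lowers the one on the left by 1.\<close>

lemma integral_values_gen:
  fixes N :: nat
  assumes "fixinf f" "\<And>n::int. lin f {of_int n..of_int n + 1}"
    and "\<And>x. real N \<le> x \<Longrightarrow> rf f x = x + of_int m" "\<And>x. x \<le> - real N \<Longrightarrow> rf f x = x + of_int m'"
  shows "f \<in> gen"
  using assms
proof (induction "\<Sum>n\<in>{- int N..int N}. qden (rf f (of_int n))" arbitrary: f m m' rule: less_induct)
  case less
  note f = less.prems(1) and lin = less.prems(2) and top = less.prems(3) and bot = less.prems(4)
  show ?case
  proof (cases "\<forall>n\<in>{- int N..int N}. rf f (of_int n) \<in> \<int>")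
    case True
    have ints: "rf f (of_int n) \<in> \<int>" for n :: int
    proof -
      consider "n \<in> {- int N..int N}" | "int N \<le> n" | "n \<le> - int N" by fastforce
      then show ?thesis
      proof cases
        case 2
        then have "real N \<le> of_int n" by linarith
        then show ?thesis using top[of "of_int n"] by simp
      next
        case 3
        then have "of_int n \<le> - real N" by linarith
        then show ?thesis using bot[of "of_int n"] by simp
      qed (use True in blast)
    qed
    \<comment> \<open>The length of the translation on the unit interval starting at n. Neighbouring
      intervals share an end point, so all lengths agree.\<close>
    define t where "t n = rf f (of_int n) - of_int n" for n :: int
    have step: "rf f x = x + t n" "t (n + 1) = t n" if x: "of_int n \<le> x" "x \<le> of_int n + 1" for n x
    proof -
      have "rf f (of_int n + 1) \<in> \<int>" using ints[of "n + 1"] by simp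
      then obtain j :: int where j: "\<forall>x\<in>{of_int n..of_int n + 1}. rf f x = x + of_int j"
        using lin_int_translation[OF f lin ints[of n]] by blast
      have "t n = of_int j" "t (n + 1) = of_int j"
        unfolding t_def using bspec[OF j, of "of_int n"] bspec[OF j, of "of_int n + 1"] by simp_all
      then show "rf f x = x + t n" "t (n + 1) = t n"
        using bspec[OF j, of x] x by simp_all
    qed
    have t: "t n = t 0" for n
    proof (induction n rule: int_induct[where k = 0])
      case (step1 i)
      then show ?case using step(2)[of i "of_int i"] by simp
    next
      case (step2 i)
      then show ?case using step(2)[of "i - 1" "of_int i"] by simp
    qed simp
    obtain j :: int where j: "t 0 = of_int j"
      unfolding t_def using ints[of 0] by (auto simp: Ints_def)
    have "rf f x = x + of_int j" for x
      using step(1)[of "\<lfloor>x\<rfloor>" x] t[of "\<lfloor>x\<rfloor>"] j of_int_floor_le[of x] real_of_int_floor_add_one_ge[of x] by simp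
    then have "f = tr j"
    proof (intro carrier_eqI)
      fix z assume "z \<in> S1" "\<And>x. rf f x = x + of_int j"
      then show "f z = tr j z"
        using f fixinf_tr[of j] rf[OF f] tr_pt
        by (cases rule: S1_cases) (simp_all add: fixinf_def)
    qed (use f fixinf_tr in \<open>simp_all add: fixinf_carrier\<close>)
    then show ?thesis using tr_gen by simp
  next
    case False
    then obtain n0 where n0: "n0 \<in> {- int N..int N}" "rf f (of_int n0) \<notin> \<int>" by blast
    define k where "k = \<lfloor>rf f (of_int n0)\<rfloor>"
    have k: "of_int k < rf f (of_int n0)" "rf f (of_int n0) < of_int k + 1"
      using n0(2) unfolding k_def by (metis Ints_of_int of_int_floor_le order_le_less, linarith)
    let ?f = "expa k \<otimes>\<^bsub>PPSL2Z\<^esub> f"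
    have fix': "fixinf ?f" using fixinf_expa f by (rule fixinf_mult)
    have rf': "rf ?f x = rf (expa k) (rf f x)" for x
      using fixinf_expa f by (rule rf_mult)
    have lin': "lin ?f {of_int n..of_int n + 1}" for n :: int
      using lin_expa_interval[OF f lin k] by (rule lin_mult[OF fixinf_expa f lin])
    have top': "rf ?f x = x + of_int m" if "real N \<le> x" for x
    proof -
      have "rf f (of_int n0) \<le> rf f (real N)"
        using n0(1) unfolding rf_mono[OF f] by simp
      then have "of_int k < real_of_int (int N + m)"
        using k(1) top[of "real N"] by simp
      \<comment> \<open>Both sides are integers, and the unit gained reaches the ray on which
        \<open>expa k\<close> is the identity. On the left side integrality is used in the same
        way.\<close>
      then have "k + 1 \<le> int N + m"
        unfolding of_int_less_iff by simp
      then have "of_int k + 1 \<le> x + of_int m"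
        using that by linarith
      then have "expansion (x + of_int m - of_int k) = x + of_int m - of_int k"
        by (intro expansion_ge_1) simp
      then show ?thesis
        using top[OF that] by (simp add: rf' rf_expa)
    qed
    have bot': "rf ?f x = x + of_int (m' - 1)" if "x \<le> - real N" for x
    proof -
      have "rf f (- real N) \<le> rf f (of_int n0)"
        using n0(1) unfolding rf_mono[OF f] by simp
      then have "real_of_int (- int N + m') < of_int (k + 1)"
        using k(2) bot[of "- real N"] by simp
      then have "- int N + m' \<le> k"
        unfolding of_int_less_iff by simp
      then have "x + of_int m' - of_int k \<le> 0"
        using that by linarith
      then have "expansion (x + of_int m' - of_int k) = x + of_int m' - of_int k - 1"
        by (simp add: expansion_def)
      then show ?thesis
        using bot[OF that] by (simp add: rf' rf_expa)
    qed
    have "(\<Sum>n\<in>{- int N..int N}. qden (rf ?f (of_int n))) < (\<Sum>n\<in>{- int N..int N}. qden (rf f (of_int n)))"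
    proof (rule sum_strict_mono_ex1)
      show "\<forall>n\<in>{- int N..int N}. qden (rf ?f (of_int n)) \<le> qden (rf f (of_int n))"
        unfolding rf' using rf_expa_rat(2) rf_rat[OF f] by simp
      show "\<exists>n\<in>{- int N..int N}. qden (rf ?f (of_int n)) < qden (rf f (of_int n))"
        unfolding rf' using rf_expa_rat(3)[OF rf_rat[OF f] k] n0(1) by (metis Rats_of_int)
    qed simp
    then have "?f \<in> gen"
      by (rule less.hyps[OF _ fix' lin' top' bot'])
    then have "inv\<^bsub>PPSL2Z\<^esub> expa k \<otimes>\<^bsub>PPSL2Z\<^esub> ?f \<in> gen"
      by (rule gen_mult[OF gen_inv[OF expa_gen]])
    then show ?thesis
      using fixinf_carrier[OF f] fixinf_carrier[OF fixinf_expa] by (simp add: PPSL2Z.inv_cancel_left)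
  qed
qed

theorem carrier_gen: "carrier PPSL2Z = gen"
proof
  show "gen \<subseteq> carrier PPSL2Z" using gen_subset by blast
  have fixed: "f \<in> gen" if f: "fixinf f" for f
  proof -
    have "piecewise_PSL2Z f"
      using fixinf_carrier[OF f] by (simp add: carrier_PPSL2Z)
    then obtain R where R: "finite R" "pt ` R \<subseteq> rational_points" "\<forall>I. connected I \<longrightarrow> I \<inter> R = {} \<longrightarrow> lin f I"
      using piecewise_breakpoints[of f] unfolding agrees_pt_iff lin_def by blast
    have "R \<subseteq> \<rat>" using R(2) rational_pt by blast
    moreover have "breaks_in f R"
      unfolding breaks_in_def using R(3) connected_Ioo by (simp add: Int_Un_distrib)
    ultimately obtain g where g: "g \<in> gen" "fixinf g" "\<forall>n::int. lin (f \<otimes>\<^bsub>PPSL2Z\<^esub> g) {of_int n..of_int n + 1}"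
      using integral_breakpoints[OF f R(1)] by blast
    have fg: "fixinf (f \<otimes>\<^bsub>PPSL2Z\<^esub> g)" using f g(2) by (rule fixinf_mult)
    have "f \<otimes>\<^bsub>PPSL2Z\<^esub> g \<in> gen"
      by (rule fixinf_infinity[OF fg]) (rule integral_values_gen[OF fg spec[OF g(3)]])
    then have "f \<otimes>\<^bsub>PPSL2Z\<^esub> g \<otimes>\<^bsub>PPSL2Z\<^esub> inv\<^bsub>PPSL2Z\<^esub> g \<in> gen"
      by (rule gen_mult[OF _ gen_inv[OF g(1)]])
    then show ?thesis
      using fixinf_carrier[OF f] fixinf_carrier[OF g(2)] by (simp add: PPSL2Z.m_assoc)
  qed
  show "carrier PPSL2Z \<subseteq> gen"
  proof
    fix f assume f: "f \<in> carrier PPSL2Z"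
    have "ptinf \<in> rational_points"
      using rational_pointsI[of 1 0] by (simp add: ptinf_def)
    then have "f ptinf \<in> rational_points"
      using piecewise_rational[OF carrier_continuous[OF f]] f by (simp add: carrier_PPSL2Z)
    then obtain a b c d where m: "a * d - b * c = 1" "smob a b c d ptinf = f ptinf"
      by (rule rational_transitive)
    let ?m = "smob a b c d"
    have mg: "?m \<in> gen" using smob_gen[OF m(1)] .
    have "(inv\<^bsub>PPSL2Z\<^esub> ?m) (f ptinf) = ptinf"
      using inv_apply_cancel(1)[OF gen_subset[OF mg], of ptinf] m(2) by simp
    then have "fixinf (inv\<^bsub>PPSL2Z\<^esub> ?m \<otimes>\<^bsub>PPSL2Z\<^esub> f)"
      unfolding fixinf_def using f gen_subset[OF mg] by (simp add: mult_apply)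
    then have "?m \<otimes>\<^bsub>PPSL2Z\<^esub> (inv\<^bsub>PPSL2Z\<^esub> ?m \<otimes>\<^bsub>PPSL2Z\<^esub> f) \<in> gen"
      by (intro gen_mult[OF mg] fixed)
    then show "f \<in> gen"
      using f gen_subset[OF mg] by (simp add: PPSL2Z.inv_cancel_left)
  qed
qed

section \<open>The moves on the Farey tesselation\<close>

abbreviation ip :: "int \<Rightarrow> int \<Rightarrow> complex" where
  "ip p q \<equiv> cayley (real_of_int p) (real_of_int q)"

lemma det_nonzero: "\<bar>p * s - q * r\<bar> = (1::int) \<Longrightarrow>
    (real_of_int p, real_of_int q) \<noteq> (0, 0) \<and> (real_of_int r, real_of_int s) \<noteq> (0, 0)"
  by auto

lemma ip_eq_cases:
  assumes "coprime p q" "coprime p' q'" "ip p q = ip p' q'"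
  obtains "p' = p" "q' = q" | "p' = - p" "q' = - q"
proof -
  have nz: "(real_of_int p, real_of_int q) \<noteq> (0, 0)" "(real_of_int p', real_of_int q') \<noteq> (0, 0)"
    using assms(1,2) by auto
  have "real_of_int (p * q') = of_int (q * p')"
    using assms(3) unfolding cayley_eq_iff[OF nz] by simp
  then have eq: "p * q' = q * p'"
    unfolding of_int_eq_iff .
  have c: "coprime q p" "coprime q' p'"
    using assms(1,2) by (simp_all only: coprime_commute)
  have "p dvd q * p'" "p' dvd q' * p" "q dvd p * q'" "q' dvd p' * q"
  proof -
    have e: "q' * p = q * p'" "p' * q = p * q'" using eq by (simp_all only: mult.commute)
    show "p dvd q * p'" unfolding eq[symmetric] by simp
    show "p' dvd q' * p" unfolding e by simp
    show "q dvd p * q'" unfolding eq by simp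
    show "q' dvd p' * q" unfolding e by simp
  qed
  then have dvd: "p dvd p'" "p' dvd p" "q dvd q'" "q' dvd q"
    unfolding coprime_dvd_mult_right_iff[OF assms(1)] coprime_dvd_mult_right_iff[OF assms(2)]
      coprime_dvd_mult_right_iff[OF c(1)] coprime_dvd_mult_right_iff[OF c(2)] .
  have "\<bar>p\<bar> = \<bar>p'\<bar>" "\<bar>q\<bar> = \<bar>q'\<bar>"
    using zdvd_antisym_abs dvd by blast+
  then have "p' = p \<and> q' = q \<or> p' = - p \<and> q' = - q"
    using eq nz by (auto simp: abs_eq_iff)
  then show ?thesis using that by blast
qed

lemma det_coprime: "\<bar>p * s - q * r\<bar> = (1::int) \<Longrightarrow> coprime p q \<and> coprime r s"
proof -
  assume *: "\<bar>p * s - q * r\<bar> = 1"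
  have "d dvd 1" if "d dvd p \<and> d dvd q \<or> d dvd r \<and> d dvd s" for d
  proof -
    have "d dvd p * s - q * r" using that by auto
    then show ?thesis using * by (metis dvd_abs_iff)
  qed
  then show ?thesis by (intro conjI coprimeI) blast+
qed

lemma fareyI: "\<bar>p * s - q * r\<bar> = 1 \<Longrightarrow> {ip p q, ip r s} \<in> farey"
  unfolding farey_def by blast

text \<open>A reduced pair is unique up to a common sign, so the determinant test is valid for every
  choice of reduced coordinates and not only for those provided by the definition of
  \<open>farey\<close>.\<close>

lemma farey_det:
  assumes "{ip p q, ip r s} \<in> farey" "coprime p q" "coprime r s"
  shows "\<bar>p * s - q * r\<bar> = 1"
proof -
  obtain p1 q1 r1 s1 where *: "{ip p q, ip r s} = {ip p1 q1, ip r1 s1}" "\<bar>p1 * s1 - q1 * r1\<bar> = 1"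
    using assms(1) unfolding farey_def by blast
  have c: "coprime p1 q1" "coprime r1 s1" using det_coprime[OF *(2)] by simp_all
  from *(1) consider "ip p q = ip p1 q1" "ip r s = ip r1 s1" | "ip p q = ip r1 s1" "ip r s = ip p1 q1"
    by (auto simp: doubleton_eq_iff)
  then show ?thesis
  proof cases
    case 1
    show ?thesis
      by (rule ip_eq_cases[OF assms(2) c(1) 1(1)]; rule ip_eq_cases[OF assms(3) c(2) 1(2)])
        (use *(2) in \<open>simp_all add: abs_minus_commute\<close>)
  next
    case 2
    have "\<bar>r1 * q1 - s1 * p1\<bar> = 1" using *(2) by (simp add: abs_minus_commute mult.commute)
    then show ?thesis
      by - (rule ip_eq_cases[OF assms(2) c(2) 2(1)]; rule ip_eq_cases[OF assms(3) c(1) 2(2)];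
        simp add: abs_minus_commute)
  qed
qed

lemma farey_subset_S1: "g \<in> farey \<Longrightarrow> g \<subseteq> S1"
  unfolding farey_def using det_nonzero cayley_in_S1 by blast

definition left_of_edge :: "complex \<Rightarrow> complex \<Rightarrow> complex \<Rightarrow> bool" where
  "left_of_edge S N W \<longleftrightarrow> W \<in> S1 \<and> ccw S N W \<and> {N, W} \<in> farey \<and> {W, S} \<in> farey"

text \<open>The third vertex is the mediant. A common neighbour of both ends has determinants 1 or
  -1 with them; lying on the left makes these equal, and the pair is then the sum of the two given
  pairs up to sign.\<close>

lemma left_of_edge_iff:
  assumes "p * s - q * r = 1"
  shows "left_of_edge (ip p q) (ip r s) W \<longleftrightarrow> W = ip (p + r) (q + s)"
proof
  have d: "\<bar>r * (q + s) - s * (p + r)\<bar> = 1" "\<bar>(p + r) * q - (q + s) * p\<bar> = 1" "\<bar>p * s - q * r\<bar> = 1"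
    using assms by (simp_all add: algebra_simps)
  have nz: "(real_of_int p, real_of_int q) \<noteq> (0, 0)" "(real_of_int r, real_of_int s) \<noteq> (0, 0)"
    using det_nonzero[OF d(3)] by simp_all
  have nz': "(real_of_int (p + r), real_of_int (q + s)) \<noteq> (0, 0)"
    using det_nonzero[OF d(2)] by simp
  have ccw_det: "ccw (ip p q) (ip r s) (ip u v) \<longleftrightarrow> 0 < (r * v - s * u) * (u * q - v * p)"
    if "(real_of_int u, real_of_int v) \<noteq> (0, 0)" for u v
  proof -
    have "(of_int p * of_int s - of_int q * of_int r) * (of_int r * of_int v - of_int s * of_int u) *
        (of_int u * of_int q - of_int v * of_int p) =
        real_of_int ((p * s - q * r) * (r * v - s * u) * (u * q - v * p))"
      by simp
    also have "\<dots> = real_of_int ((r * v - s * u) * (u * q - v * p))"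
      unfolding assms by simp
    finally show ?thesis
      unfolding ccw_cayley[OF nz that] by (simp only: of_int_0_less_iff)
  qed
  have "(r * (q + s) - s * (p + r)) * ((p + r) * q - (q + s) * p) = (p * s - q * r) * (p * s - q * r)"
    by (simp add: algebra_simps)
  then have "left_of_edge (ip p q) (ip r s) (ip (p + r) (q + s))"
    using fareyI[OF d(1)] fareyI[OF d(2)] cayley_in_S1[OF nz'] unfolding left_of_edge_def ccw_det[OF nz'] assms by simp
  then show "W = ip (p + r) (q + s) \<Longrightarrow> left_of_edge (ip p q) (ip r s) W"
    by simp
  assume "left_of_edge (ip p q) (ip r s) W"
  then have W: "ccw (ip p q) (ip r s) W" "{ip r s, W} \<in> farey" "{W, ip p q} \<in> farey"
    by (simp_all add: left_of_edge_def)
  then obtain p1 q1 r1 s1 where *: "{ip r s, W} = {ip p1 q1, ip r1 s1}" "\<bar>p1 * s1 - q1 * r1\<bar> = 1"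
    unfolding farey_def by blast
  then obtain u v where uv: "W = ip u v" "coprime u v"
    using det_coprime[OF *(2)] by (auto simp: doubleton_eq_iff)
  have cop: "coprime p q" "coprime r s" using det_coprime[OF d(3)] by simp_all
  have "(real_of_int u, real_of_int v) \<noteq> (0, 0)" using uv(2) by auto
  then have pos: "0 < (r * v - s * u) * (u * q - v * p)"
    using ccw_det W(1) uv(1) by simp
  have "\<bar>r * v - s * u\<bar> = 1" "\<bar>u * q - v * p\<bar> = 1"
    using farey_det[OF W(2)[unfolded uv(1)] cop(2) uv(2)] farey_det[OF W(3)[unfolded uv(1)] uv(2) cop(1)] .
  then obtain e where e: "r * v - s * u = e" "u * q - v * p = e" "e = 1 \<or> e = - 1"
    using pos by (auto simp: abs_if split: if_splits)
  \<comment> \<open>Cramer's rule recovers u and v from the two determinants.\<close>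
  have "u * (p * s - q * r) = p * (r * v - (r * v - s * u)) - r * (u * q - v * p + v * p)"
    "v * (p * s - q * r) = s * (u * q - (u * q - v * p)) - q * (r * v - s * u + s * u)"
    by (simp_all add: algebra_simps)
  then have "u = - e * (p + r)" "v = - e * (q + s)"
    unfolding assms e by (simp_all add: algebra_simps)
  then show "W = ip (p + r) (q + s)"
    using e(3) cayley_minus[of "real_of_int (p + r)" "real_of_int (q + s)"] uv(1) by (auto simp: add.commute)
qed

lemma left_vertex_farey:
  assumes "p * s - q * r = 1"
  shows "left_vertex farey (ip p q) (ip r s) = ip (p + r) (q + s)"
  using left_of_edge_iff[OF assms] unfolding left_vertex_def left_of_edge_def by simp

definition img :: "(complex \<Rightarrow> complex) \<Rightarrow> geodesic set \<Rightarrow> geodesic set" where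
  "img h \<tau> = (\<lambda>g. h ` g) ` \<tau>"

lemma smob_farey_edge:
  assumes "a * d - b * c = 1" "g \<in> farey"
  shows "mob a b c d ` g \<in> farey"
proof -
  obtain p q r s where g: "g = {ip p q, ip r s}" "\<bar>p * s - q * r\<bar> = 1"
    using assms(2) unfolding farey_def by blast
  have "(a * p + b * q) * (c * r + d * s) - (c * p + d * q) * (a * r + b * s) = (a * d - b * c) * (p * s - q * r)"
    by (simp add: algebra_simps)
  then have "\<bar>(a * p + b * q) * (c * r + d * s) - (c * p + d * q) * (a * r + b * s)\<bar> = 1"
    using assms(1) g(2) by simp
  from fareyI[OF this] show ?thesis
    unfolding g(1) using det_nonzero[OF g(2)] by (simp add: mob_cayley)
qed

lemma image_mob_farey: "f ` g = mob a b c d ` g \<Longrightarrow> a * d - b * c = 1 \<Longrightarrow> g \<in> farey \<Longrightarrow> f ` g \<in> farey"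
  using smob_farey_edge by simp

lemma img_smob_farey:
  assumes "a * d - b * c = 1"
  shows "img (smob a b c d) farey = farey"
proof
  have eq: "smob a b c d ` g = mob a b c d ` g" if "g \<in> farey" for g a b c d
    using farey_subset_S1[OF that] by (intro image_cong) auto
  show "img (smob a b c d) farey \<subseteq> farey"
    unfolding img_def using smob_farey_edge[OF assms] eq by auto
  show "farey \<subseteq> img (smob a b c d) farey"
  proof
    fix g assume g: "g \<in> farey"
    have det: "d * a - - b * - c = 1" using assms by (simp add: mult.commute)
    have "mob a b c d ` (mob d (- b) (- c) a ` g) = g"
      using farey_subset_S1[OF g] mob_inverse(2)[OF assms] by (force simp: image_image)
    then show "g \<in> img (smob a b c d) farey"
      unfolding img_def using smob_farey_edge[OF det g] eq by (metis imageI)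
  qed
qed

lemma quad_turn_mob:
  "z = ptinf \<or> (\<exists>x\<le>-1. z = pt x) \<Longrightarrow> quad_turn z = mob 1 1 (-1) 0 z"
  "\<exists>x. -1 \<le> x \<and> x \<le> 0 \<and> z = pt x \<Longrightarrow> quad_turn z = mob 1 1 0 1 z"
  "\<exists>x. 0 \<le> x \<and> x \<le> 1 \<and> z = pt x \<Longrightarrow> quad_turn z = mob 0 1 (-1) 1 z"
  "z = ptinf \<or> (\<exists>x\<ge>1. z = pt x) \<Longrightarrow> quad_turn z = mob 1 0 (-1) 1 z"
proof -
  show "z = ptinf \<or> (\<exists>x\<le>-1. z = pt x) \<Longrightarrow> quad_turn z = mob 1 1 (-1) 0 z"
    by (auto simp: quad_turn_inf mob_inf quad_turn_pt(1) mob_pt field_simps)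
  show "\<exists>x. -1 \<le> x \<and> x \<le> 0 \<and> z = pt x \<Longrightarrow> quad_turn z = mob 1 1 0 1 z"
    by (auto simp: quad_turn_pt(2) mob_pt)
  have 3: "quad_turn (pt x) = mob 0 1 (-1) 1 (pt x)" if "0 \<le> x" "x \<le> 1" for x
    using that by (cases "x = 1") (simp_all add: quad_turn_pt(3,4) mob_pt mob_pt_inf)
  then show "\<exists>x. 0 \<le> x \<and> x \<le> 1 \<and> z = pt x \<Longrightarrow> quad_turn z = mob 0 1 (-1) 1 z"
    by blast
  have 4: "quad_turn (pt x) = mob 1 0 (-1) 1 (pt x)" if "1 \<le> x" for x
    using that by (cases "x = 1") (simp_all add: quad_turn_pt(4,5) mob_pt mob_pt_inf)
  then show "z = ptinf \<or> (\<exists>x\<ge>1. z = pt x) \<Longrightarrow> quad_turn z = mob 1 0 (-1) 1 z"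
    by (auto simp: quad_turn_inf mob_inf)
qed

lemma ip_simps: "ip 1 0 = ptinf" "ip 0 1 = pt 0" "ip 1 1 = pt 1" "ip (-1) 1 = pt (-1)"
  by (simp_all add: ptinf_def pt_def)

lemma pt_1_minus_1_not_farey: "{pt 1, pt (-1)} \<notin> farey"
  using farey_det[of 1 1 "-1" 1] unfolding ip_simps by auto

text \<open>An edge other than the doe does not cross the quadrilateral, so \<^const>\<open>quad_turn\<close> is a single
  Moebius transformation on it.\<close>

lemma quad_turn_edge:
  assumes "g \<in> farey" "g \<noteq> {ptinf, pt 0}"
  shows "quad_turn ` g \<in> farey \<and> quad_turn ` g \<noteq> {ptinf, pt 0}"
proof
  obtain p q r s where g: "g = {ip p q, ip r s}" and det: "\<bar>p * s - q * r\<bar> = 1"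
    using assms(1) unfolding farey_def by blast
  have inf_case: "quad_turn ` {ip p q, ip r s} \<in> farey"
    if "q = 0" "{ip p q, ip r s} \<noteq> {ptinf, pt 0}" "\<bar>p * s - q * r\<bar> = 1" for p q r s
  proof -
    have ps: "\<bar>p\<bar> = 1" "\<bar>s\<bar> = 1"
    proof -
      have "\<bar>p\<bar> * \<bar>s\<bar> = 1" using that(1,3) by (simp add: abs_mult)
      then show "\<bar>p\<bar> = 1" "\<bar>s\<bar> = 1" using int_unit_cases[of "\<bar>p\<bar>" "\<bar>s\<bar>"] by auto
    qed
    have inf: "ip p q = ptinf" using ps that(1) by (simp add: cayley_inf)
    have n: "ip r s = pt (of_int (r * s))" using ps by (auto simp: abs_if cayley_pt split: if_splits)
    have "r * s \<noteq> 0"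
      using that(2) unfolding inf n by auto
    then consider "r * s \<le> - 1" | "r * s \<ge> 1" by linarith
    then show ?thesis
    proof cases
      case 1
      then have "real_of_int (r * s) \<le> - 1" by linarith
      then have "quad_turn ` {ip p q, ip r s} = mob 1 1 (-1) 0 ` {ip p q, ip r s}"
        unfolding inf n using quad_turn_mob(1) by (intro image_cong) auto
      then show ?thesis by (rule image_mob_farey) (simp, rule fareyI[OF that(3)])
    next
      case 2
      then have "real_of_int (r * s) \<ge> 1" by linarith
      then have "quad_turn ` {ip p q, ip r s} = mob 1 0 (-1) 1 ` {ip p q, ip r s}"
        unfolding inf n using quad_turn_mob(4) by (intro image_cong) auto
      then show ?thesis by (rule image_mob_farey) (simp, rule fareyI[OF that(3)])
    qed
  qed
  have pos_case: "quad_turn ` {ip p q, ip r s} \<in> farey"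
    if qs: "q > 0" "s > 0" and det: "r * q - p * s = 1" for p q r s
  proof -
    define x y where "x = real_of_int p / of_int q" and "y = real_of_int r / of_int s"
    have xy: "ip p q = pt x" "ip r s = pt y"
      using qs by (simp_all add: cayley_pt x_def y_def)
    have "p * s < r * q" using det by simp
    then have "real_of_int (p * s) < of_int (r * q)" by (simp only: of_int_less_iff)
    then have "x < y" using qs by (simp add: x_def y_def field_simps)
    have no_int: "\<not> (x < of_int k \<and> of_int k < y)" for k
    proof
      assume "x < of_int k \<and> of_int k < y"
      then have "real_of_int p < of_int (k * q)" "of_int (k * s) < real_of_int r"
        using qs by (simp_all add: x_def y_def field_simps)
      then show False
        using farey_interval_no_int[OF qs det, of k] unfolding of_int_less_iff by blast
    qed
    have far: "{ip p q, ip r s} \<in> farey"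
      using det by (intro fareyI) (simp add: abs_minus_commute mult.commute)
    consider "y \<le> -1" | "-1 \<le> x" "y \<le> 0" | "0 \<le> x" "y \<le> 1" | "1 \<le> x"
      using no_int[of "-1"] no_int[of 0] no_int[of 1] by fastforce
    then show ?thesis
    proof cases
      case 1
      then have "quad_turn ` {ip p q, ip r s} = mob 1 1 (-1) 0 ` {ip p q, ip r s}"
        unfolding xy using quad_turn_mob(1) \<open>x < y\<close> by (intro image_cong) auto
      then show ?thesis by (rule image_mob_farey) (simp, rule far)
    next
      case 2
      then have "quad_turn ` {ip p q, ip r s} = mob 1 1 0 1 ` {ip p q, ip r s}"
        unfolding xy using quad_turn_mob(2) \<open>x < y\<close> by (intro image_cong) auto
      then show ?thesis by (rule image_mob_farey) (simp, rule far)
    next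
      case 3
      then have "quad_turn ` {ip p q, ip r s} = mob 0 1 (-1) 1 ` {ip p q, ip r s}"
        unfolding xy using quad_turn_mob(3) \<open>x < y\<close> by (intro image_cong) auto
      then show ?thesis by (rule image_mob_farey) (simp, rule far)
    next
      case 4
      then have "quad_turn ` {ip p q, ip r s} = mob 1 0 (-1) 1 ` {ip p q, ip r s}"
        unfolding xy using quad_turn_mob(4) \<open>x < y\<close> by (intro image_cong) auto
      then show ?thesis by (rule image_mob_farey) (simp, rule far)
    qed
  qed
  show "quad_turn ` g \<in> farey"
  proof (cases "q = 0 \<or> s = 0")
    case True
    then show ?thesis
    proof
      assume "q = 0"
      then show ?thesis using inf_case[of q p r s] assms(2) g det by simp
    next
      assume "s = 0"
      moreover have "{ip p q, ip r s} = {ip r s, ip p q}" by blast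
      moreover have "\<bar>r * q - s * p\<bar> = 1" using det by (simp add: abs_minus_commute mult.commute)
      ultimately show ?thesis using inf_case[of s r p q] assms(2) g by simp
    qed
  next
    case False
    \<comment> \<open>Homogeneous coordinates may be negated separately; this makes both
      denominators positive.\<close>
    define p' q' r' s' where "p' = p * sgn q" and "q' = q * sgn q" and "r' = r * sgn s" and "s' = s * sgn s"
    have pos: "q' > 0" "s' > 0"
      using False unfolding q'_def s'_def by (simp_all add: sgn_if)
    have "ip p' q' = ip p q" "ip r' s' = ip r s"
      using False unfolding p'_def q'_def r'_def s'_def by (simp_all add: sgn_if cayley_minus)
    then have g': "g = {ip p' q', ip r' s'}" using g by simp
    have "\<bar>p' * s' - q' * r'\<bar> = \<bar>(p * s - q * r) * (sgn q * sgn s)\<bar>"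
      unfolding p'_def q'_def r'_def s'_def by (simp add: algebra_simps)
    also have "\<dots> = 1"
      using det False by (simp add: abs_mult)
    finally consider "r' * q' - p' * s' = 1" | "p' * s' - r' * q' = 1"
      by (auto simp: abs_if mult.commute split: if_splits)
    then show ?thesis
    proof cases
      case 1
      then show ?thesis using pos_case[OF pos] g' by simp
    next
      case 2
      moreover have "{ip p' q', ip r' s'} = {ip r' s', ip p' q'}" by blast
      ultimately show ?thesis using pos_case[OF pos(2,1)] g' by simp
    qed
  qed
  \<comment> \<open>The preimage of the doe is the diagonal joining 1 and -1, whose determinant is 2
    in absolute value, so it is not an edge.\<close>
  show "quad_turn ` g \<noteq> {ptinf, pt 0}"
  proof
    assume "quad_turn ` g = {ptinf, pt 0}"
    then have "quad_turn ` g = quad_turn ` {pt 1, pt (-1)}"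
      by (simp add: quad_turn_pt(4) quad_turn_pt(2)[of "-1"])
    then have "g = {pt 1, pt (-1)}"
      using inj_on_image_eq_iff[OF circle_homeo_facts(6)[OF carrier_imp_homeo[OF quad_turn_carrier]], of g "{pt 1, pt (-1)}"]
        farey_subset_S1[OF assms(1)] by simp
    then show False using assms(1) pt_1_minus_1_not_farey by simp
  qed
qed

text \<open>The edges other than the doe are mapped among themselves. As \<open>quad_turn\<close>
  has order four, its cube provides their preimages, so this set of edges is preserved and only the
  doe is replaced.\<close>

lemma img_quad_turn_farey: "img quad_turn farey = insert {pt (-1), pt 1} (farey - {{ptinf, pt 0}})"
proof -
  let ?F = "farey - {{ptinf, pt 0}}"
  have edge: "quad_turn ` g \<in> ?F" if "g \<in> ?F" for g
    using quad_turn_edge[of g] that by simp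
  have "?F \<subseteq> img quad_turn ?F"
  proof
    fix g assume g: "g \<in> ?F"
    have "quad_turn (quad_turn (quad_turn (quad_turn z))) = z" if "z \<in> g" for z
    proof -
      have "z \<in> S1" using that g farey_subset_S1[of g] by auto
      then show ?thesis by (simp add: quad_turn_quad_turn quad_turn_closed half_turn_half_turn half_turn_closed)
    qed
    then have "(\<lambda>z. quad_turn (quad_turn (quad_turn (quad_turn z)))) ` g = (\<lambda>z. z) ` g"
      by (intro image_cong) simp_all
    then have "g = quad_turn ` (quad_turn ` quad_turn ` quad_turn ` g)"
      by (simp only: image_image image_ident)
    then show "g \<in> img quad_turn ?F"
      unfolding img_def by (rule image_eqI) (intro edge g)
  qed
  moreover have "img quad_turn ?F \<subseteq> ?F"
    unfolding img_def using edge by (rule image_subsetI)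
  ultimately have eq: "img quad_turn ?F = ?F"
    by (rule subset_antisym[rotated])
  have "{ptinf, pt 0} \<in> farey"
    using fareyI[of 1 1 0 0] unfolding ip_simps by simp
  then have "farey = insert {ptinf, pt 0} ?F"
    by (simp only: insert_Diff)
  then have "img quad_turn farey = img quad_turn (insert {ptinf, pt 0} ?F)"
    by (rule arg_cong)
  also have "\<dots> = insert (quad_turn ` {ptinf, pt 0}) (img quad_turn ?F)"
    unfolding img_def by (rule image_insert)
  also have "quad_turn ` {ptinf, pt 0} = {pt (-1), pt 1}"
    by (simp add: quad_turn_inf quad_turn_pt(2)[of 0])
  finally show ?thesis
    unfolding eq .
qed

text \<open>The matrix with columns (a, c) and (b, d) stands for the edge from a/c to b/d. One
  induction step reverses the edge; the other moves to the next side of the triangle on its left,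
  whose third vertex cannot move by \<open>left_of_edge_iff\<close>. All rational points are
  reached, and an increasing map of the line that fixes the rationals is the identity.\<close>

lemma farey_rigid:
  assumes h: "h \<in> carrier PPSL2Z" and fixed: "h ptinf = ptinf" "h (pt 0) = pt 0"
    and edges: "\<And>g. g \<in> farey \<Longrightarrow> h ` g \<in> farey"
  shows "h = \<one>\<^bsub>PPSL2Z\<^esub>"
proof -
  have vertices: "h (ip a c) = ip a c \<and> h (ip b d) = ip b d" if "a * d - b * c = 1" for a b c d
    using that
  proof (rule SL2Z_induct)
    show "h (ip 1 0) = ip 1 0 \<and> h (ip 0 1) = ip 0 1"
      unfolding ip_simps using fixed by simp
  next
    fix a b c d assume *: "a * d - b * c = 1" "h (ip a c) = ip a c \<and> h (ip b d) = ip b d"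
    then show "h (ip b d) = ip b d \<and> h (ip (- a) (- c)) = ip (- a) (- c)"
      by (simp add: cayley_minus)
    have nz: "\<bar>a * d - c * b\<bar> = 1" "\<bar>b * (c + d) - d * (a + b)\<bar> = 1" "\<bar>(a + b) * c - (c + d) * a\<bar> = 1"
      using *(1) by (simp_all add: algebra_simps)
    have "a * d - c * b = 1" using *(1) by (simp add: mult.commute)
    note left = left_of_edge_iff[OF this]
    have S1: "ip a c \<in> S1" "ip b d \<in> S1" "ip (a + b) (c + d) \<in> S1"
      using det_nonzero[OF nz(1)] det_nonzero[OF nz(3)] by (simp_all only: cayley_in_S1 simp_thms)
    let ?W = "ip (a + b) (c + d)"
    have "left_of_edge (ip a c) (ip b d) ?W"
      unfolding left ..
    then have "ccw (ip a c) (ip b d) ?W" and e: "{ip b d, ?W} \<in> farey" "{?W, ip a c} \<in> farey"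
      by (simp_all only: left_of_edge_def)
    then have "ccw (h (ip a c)) (h (ip b d)) (h ?W)"
      using circle_homeo_ccw[OF carrier_imp_homeo[OF h] S1] by blast
    moreover have "{h (ip b d), h ?W} \<in> farey" "{h ?W, h (ip a c)} \<in> farey"
      using edges[OF e(1)] edges[OF e(2)] by (simp_all only: image_insert image_empty)
    ultimately have "left_of_edge (ip a c) (ip b d) (h ?W)"
      using carrier_closed[OF h S1(3)] *(2) by (simp add: left_of_edge_def)
    then show "h (ip (- b) (- d)) = ip (- b) (- d) \<and> h ?W = ?W"
      unfolding left using *(2) by (simp add: cayley_minus)
  qed
  have rat: "h z = z" if z: "z \<in> rational_points" for z
  proof -
    obtain a b c d where m: "a * d - b * c = 1" "smob a b c d ptinf = z"
      by (rule rational_transitive[OF z])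
    then have "z = ip a c" using mob_ptinf_cayley by simp
    then show ?thesis using vertices[OF m(1)] by simp
  qed
  have fh: "fixinf h" using h fixed by (simp add: fixinf_def)
  have rf_rat_eq: "rf h x = x" if "x \<in> \<rat>" for x
    using rat[of "pt x"] that rational_pt by (intro rf_eqI) simp
  have rfx: "rf h x = x" for x
  proof (rule ccontr)
    assume "rf h x \<noteq> x"
    then consider "rf h x < x" | "x < rf h x" by linarith
    then show False
    proof cases
      case 1
      then obtain r where r: "r \<in> \<rat>" "rf h x < r" "r < x" using Rats_dense_in_real by blast
      then show False using rf_strict_mono[OF fh, of r x] rf_rat_eq[of r] by simp
    next
      case 2
      then obtain r where r: "r \<in> \<rat>" "x < r" "r < rf h x" using Rats_dense_in_real by blast
      then show False using rf_strict_mono[OF fh, of x r] rf_rat_eq[of r] by simp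
    qed
  qed
  have "h z = z" if "z \<in> S1" for z
    by (rule S1_cases[OF that]) (simp_all add: rf[OF fh] fixed(1) rfx)
  then show ?thesis
    using h by (intro carrier_eqI) (simp_all add: one_apply)
qed

section \<open>Marked tesselations and the elements that realize the moves\<close>

lemma map_marked_img: "map_marked h (\<tau>, (S, N)) = (img h \<tau>, (h S, h N))"
  by (simp add: img_def)

lemma img_cong:
  assumes "\<And>z. z \<in> S1 \<Longrightarrow> h z = k z" "\<And>g. g \<in> \<tau> \<Longrightarrow> g \<subseteq> S1"
  shows "img h \<tau> = img k \<tau>"
  unfolding img_def using assms by (intro image_cong) auto

lemma img_mult:
  assumes "f \<in> carrier PPSL2Z" "g \<in> carrier PPSL2Z" "\<And>e. e \<in> \<tau> \<Longrightarrow> e \<subseteq> S1"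
  shows "img (f \<otimes>\<^bsub>PPSL2Z\<^esub> g) \<tau> = img f (img g \<tau>)"
proof -
  have "(f \<otimes>\<^bsub>PPSL2Z\<^esub> g) ` e = f ` g ` e" if "e \<in> \<tau>" for e
    using assms(3)[OF that] mult_apply[OF assms(1,2)] unfolding image_image by (intro image_cong) auto
  then have "(\<lambda>e. (f \<otimes>\<^bsub>PPSL2Z\<^esub> g) ` e) ` \<tau> = (\<lambda>e. f ` g ` e) ` \<tau>"
    by (rule image_cong[OF refl])
  then show ?thesis
    unfolding img_def image_image[of "\<lambda>e. f ` e" "\<lambda>e. g ` e" \<tau>] .
qed

lemma is_doeE:
  assumes "is_doe farey e"
  obtains a b c d where "a * d - b * c = 1" "e = (ip a c, ip b d)"
proof -
  obtain S N where e: "e = (S, N)" by force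
  then have "{S, N} \<in> farey" using assms by simp
  then obtain p q r s where *: "{S, N} = {ip p q, ip r s}" "\<bar>p * s - q * r\<bar> = 1"
    unfolding farey_def by blast
  note thesisI = that
  have main: thesis if SN: "S = ip a c" "N = ip b d" and det: "\<bar>a * d - c * b\<bar> = 1" for a b c d
  proof (cases "a * d - c * b = 1")
    case True
    then show ?thesis using thesisI[of a d b c] e SN by (simp add: mult.commute)
  next
    case False
    \<comment> \<open>If the determinant is -1, negating the coordinates of one end corrects
      it.\<close>
    then have "a * (- d) - (- b) * c = 1" using det by (auto simp: abs_if mult.commute split: if_splits)
    moreover have "N = ip (- b) (- d)" using SN(2) by (simp add: cayley_minus)
    ultimately show ?thesis using thesisI[of a "- d" "- b" c] e SN(1) by simp
  qed
  from *(1) consider "S = ip p q" "N = ip r s" | "S = ip r s" "N = ip p q"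
    by (auto simp: doubleton_eq_iff)
  then show ?thesis
  proof cases
    case 1
    then show ?thesis using main *(2) by simp
  next
    case 2
    have "\<bar>r * q - s * p\<bar> = 1" using *(2) by (simp add: abs_minus_commute mult.commute)
    then show ?thesis using main 2 by simp
  qed
qed

text \<open>Uniqueness for the definite description: if f and g realize the same move, then g f^-1
  preserves the marked tesselation. Conjugation with the matrix of the doe transfers this to the doe
  from \<infinity> to 0, where \<open>farey_rigid\<close> applies.\<close>

lemma element_of_move_eqI:
  assumes f: "f \<in> carrier PPSL2Z" and e: "is_doe farey e"
    and mv: "map_marked (inv_into S1 f) (farey, e) = mv (farey, e)"
  shows "element_of_move mv e = f"
  unfolding element_of_move_def
proof (rule the_equality)
  show "f \<in> carrier PPSL2Z \<and> map_marked (inv_into S1 f) (farey, e) = mv (farey, e)"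
    using f mv by simp
  fix g assume g: "g \<in> carrier PPSL2Z \<and> map_marked (inv_into S1 g) (farey, e) = mv (farey, e)"
  obtain a b c d where m: "a * d - b * c = 1" "e = (ip a c, ip b d)"
    using e by (rule is_doeE)
  let ?m = "smob a b c d" and ?F = "inv\<^bsub>PPSL2Z\<^esub> f" and ?G = "inv\<^bsub>PPSL2Z\<^esub> g"
  have mc: "?m \<in> carrier PPSL2Z" and gc: "g \<in> carrier PPSL2Z" using smob_carrier[OF m(1)] g by auto
  have S1: "ip a c \<in> S1" "ip b d \<in> S1" and m_vals: "?m ptinf = ip a c" "?m (pt 0) = ip b d"
  proof -
    show *: "?m ptinf = ip a c" "?m (pt 0) = ip b d"
      using mob_ptinf_cayley mob_pt_cayley[of a b c d 0] by simp_all
    show "ip a c \<in> S1" "ip b d \<in> S1"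
      unfolding *[symmetric] using carrier_closed[OF mc] by simp_all
  qed
  have eq: "map_marked (inv_into S1 f) (farey, e) = map_marked (inv_into S1 g) (farey, e)"
    using mv g by simp
  have FG: "?F (ip a c) = ?G (ip a c)" "?F (ip b d) = ?G (ip b d)" "img ?F farey = img ?G farey"
  proof -
    have *: "img (inv_into S1 f) farey = img (inv_into S1 g) farey"
      "inv_into S1 f (ip a c) = inv_into S1 g (ip a c)" "inv_into S1 f (ip b d) = inv_into S1 g (ip b d)"
      using eq unfolding m(2) map_marked_img by simp_all
    show "?F (ip a c) = ?G (ip a c)" "?F (ip b d) = ?G (ip b d)"
      using * S1 inv_apply f gc by simp_all
    show "img ?F farey = img ?G farey"
      using *(1) img_cong[of ?F "inv_into S1 f" farey] img_cong[of ?G "inv_into S1 g" farey]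
        inv_apply[OF f] inv_apply[OF gc] farey_subset_S1 by simp
  qed
  let ?h = "inv\<^bsub>PPSL2Z\<^esub> ?m \<otimes>\<^bsub>PPSL2Z\<^esub> (g \<otimes>\<^bsub>PPSL2Z\<^esub> (?F \<otimes>\<^bsub>PPSL2Z\<^esub> ?m))"
  have hc: "?h \<in> carrier PPSL2Z" using f gc mc by simp
  have h_apply: "?h z = (inv\<^bsub>PPSL2Z\<^esub> ?m) (g (?F (?m z)))" if "z \<in> S1" for z
    using that f gc mc by (simp add: mult_apply carrier_closed del: smob_apply)
  have undo: "(inv\<^bsub>PPSL2Z\<^esub> ?m) (g (?G (?m z))) = z" if "z \<in> S1" for z
    using that inv_apply_cancel(1)[OF mc that] inv_apply_cancel(2)[OF gc carrier_closed[OF mc that]] by simp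
  have "?h = \<one>\<^bsub>PPSL2Z\<^esub>"
  proof (rule farey_rigid[OF hc])
    show "?h ptinf = ptinf" "?h (pt 0) = pt 0"
      using undo[of ptinf] undo[of "pt 0"] by (simp_all add: h_apply m_vals FG del: smob_apply)
    fix e' assume e': "e' \<in> farey"
    have "?m ` e' \<in> farey"
      using e' img_smob_farey[OF m(1)] unfolding img_def by blast
    then have "?F ` ?m ` e' \<in> img ?F farey"
      unfolding img_def by (rule imageI)
    then have "?F ` ?m ` e' \<in> img ?G farey"
      unfolding FG(3) .
    then obtain e'' where e'': "e'' \<in> farey" "?F ` ?m ` e' = ?G ` e''"
      unfolding img_def by blast
    have "g ` ?G ` e'' = e''"
    proof -
      have "(\<lambda>z. g (?G z)) ` e'' = (\<lambda>z. z) ` e''"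
        using farey_subset_S1[OF e''(1)] inv_apply_cancel(2)[OF gc] by (intro image_cong) auto
      then show ?thesis by (simp only: image_image image_ident)
    qed
    obtain k where k: "k \<in> farey" "e'' = ?m ` k"
      using e''(1) img_smob_farey[OF m(1)] unfolding img_def by blast
    have "(inv\<^bsub>PPSL2Z\<^esub> ?m) ` ?m ` k = k"
    proof -
      have "(\<lambda>z. (inv\<^bsub>PPSL2Z\<^esub> ?m) (?m z)) ` k = (\<lambda>z. z) ` k"
        using farey_subset_S1[OF k(1)] inv_apply_cancel(1)[OF mc] by (intro image_cong) auto
      then show ?thesis by (simp only: image_image image_ident)
    qed
    moreover have "?h ` e' = (inv\<^bsub>PPSL2Z\<^esub> ?m) ` g ` ?F ` ?m ` e'"
    proof -
      have "?h ` e' = (\<lambda>z. (inv\<^bsub>PPSL2Z\<^esub> ?m) (g (?F (?m z)))) ` e'"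
        using farey_subset_S1[OF e'] h_apply by (intro image_cong) auto
      then show ?thesis by (simp only: image_image)
    qed
    ultimately show "?h ` e' \<in> farey"
      using k e''(2) \<open>g ` ?G ` e'' = e''\<close> by simp
  qed
  then have "?m \<otimes>\<^bsub>PPSL2Z\<^esub> ?h \<otimes>\<^bsub>PPSL2Z\<^esub> inv\<^bsub>PPSL2Z\<^esub> ?m \<otimes>\<^bsub>PPSL2Z\<^esub> f = f"
    using mc f by simp
  moreover have "?m \<otimes>\<^bsub>PPSL2Z\<^esub> ?h \<otimes>\<^bsub>PPSL2Z\<^esub> inv\<^bsub>PPSL2Z\<^esub> ?m \<otimes>\<^bsub>PPSL2Z\<^esub> f = g"
    using mc f gc by (simp add: PPSL2Z.m_assoc PPSL2Z.inv_cancel_left)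
  ultimately show "g = f" by simp
qed

lemma inv_conj:
  assumes "m \<in> carrier PPSL2Z" "f \<in> carrier PPSL2Z" "z \<in> S1"
  shows "inv_into S1 (m \<otimes>\<^bsub>PPSL2Z\<^esub> f \<otimes>\<^bsub>PPSL2Z\<^esub> inv\<^bsub>PPSL2Z\<^esub> m) z =
    (m \<otimes>\<^bsub>PPSL2Z\<^esub> (inv\<^bsub>PPSL2Z\<^esub> f \<otimes>\<^bsub>PPSL2Z\<^esub> inv\<^bsub>PPSL2Z\<^esub> m)) z"
proof -
  have "inv\<^bsub>PPSL2Z\<^esub> (m \<otimes>\<^bsub>PPSL2Z\<^esub> f \<otimes>\<^bsub>PPSL2Z\<^esub> inv\<^bsub>PPSL2Z\<^esub> m) = m \<otimes>\<^bsub>PPSL2Z\<^esub> (inv\<^bsub>PPSL2Z\<^esub> f \<otimes>\<^bsub>PPSL2Z\<^esub> inv\<^bsub>PPSL2Z\<^esub> m)"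
    using assms(1,2) by (simp add: PPSL2Z.inv_mult_group PPSL2Z.m_assoc)
  then show ?thesis
    using inv_apply[of "m \<otimes>\<^bsub>PPSL2Z\<^esub> f \<otimes>\<^bsub>PPSL2Z\<^esub> inv\<^bsub>PPSL2Z\<^esub> m" z] assms by simp
qed

lemma smob_inverse:
  assumes "a * d - b * c = 1"
  shows "inv\<^bsub>PPSL2Z\<^esub> (smob a b c d) = smob d (- b) (- c) a"
proof (rule PPSL2Z.inv_equality)
  have det: "d * a - - b * - c = 1" using assms by (simp add: mult.commute)
  show "smob d (- b) (- c) a \<otimes>\<^bsub>PPSL2Z\<^esub> smob a b c d = \<one>\<^bsub>PPSL2Z\<^esub>"
    using smob_carrier[OF assms] smob_carrier[OF det] mob_inverse(1)[OF assms] assms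
    by (intro carrier_eqI) (simp_all add: mult_apply one_apply)
  show "smob a b c d \<in> carrier PPSL2Z" "smob d (- b) (- c) a \<in> carrier PPSL2Z"
    using smob_carrier[OF assms] smob_carrier[OF det] by simp_all
qed

lemma map_marked_conj:
  assumes det: "a * d - b * c = 1" and f: "f \<in> carrier PPSL2Z"
  defines "m \<equiv> smob a b c d"
  shows "map_marked (inv_into S1 (m \<otimes>\<^bsub>PPSL2Z\<^esub> f \<otimes>\<^bsub>PPSL2Z\<^esub> inv\<^bsub>PPSL2Z\<^esub> m)) (farey, (ip a c, ip b d)) =
    (img m (img (inv\<^bsub>PPSL2Z\<^esub> f) farey), (m ((inv\<^bsub>PPSL2Z\<^esub> f) ptinf), m ((inv\<^bsub>PPSL2Z\<^esub> f) (pt 0))))"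
proof -
  have mc: "m \<in> carrier PPSL2Z" unfolding m_def by (rule smob_carrier[OF det])
  have m_vals: "m ptinf = ip a c" "m (pt 0) = ip b d"
    unfolding m_def using mob_ptinf_cayley mob_pt_cayley[of a b c d 0] by simp_all
  have S1: "ip a c \<in> S1" "ip b d \<in> S1"
    unfolding m_vals[symmetric] using carrier_closed[OF mc] by simp_all
  have inv_vals: "(inv\<^bsub>PPSL2Z\<^esub> m) (ip a c) = ptinf" "(inv\<^bsub>PPSL2Z\<^esub> m) (ip b d) = pt 0"
    unfolding m_vals[symmetric] using inv_apply_cancel(1)[OF mc] by simp_all
  have "d * a - - b * - c = 1" using det by (simp add: mult.commute)
  then have "img (inv\<^bsub>PPSL2Z\<^esub> m) farey = farey"
    unfolding m_def smob_inverse[OF det] by (rule img_smob_farey)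
  moreover have "img (inv_into S1 (m \<otimes>\<^bsub>PPSL2Z\<^esub> f \<otimes>\<^bsub>PPSL2Z\<^esub> inv\<^bsub>PPSL2Z\<^esub> m)) farey =
      img (m \<otimes>\<^bsub>PPSL2Z\<^esub> (inv\<^bsub>PPSL2Z\<^esub> f \<otimes>\<^bsub>PPSL2Z\<^esub> inv\<^bsub>PPSL2Z\<^esub> m)) farey"
    using inv_conj[OF mc f] farey_subset_S1 by (rule img_cong)
  moreover have "img (m \<otimes>\<^bsub>PPSL2Z\<^esub> (inv\<^bsub>PPSL2Z\<^esub> f \<otimes>\<^bsub>PPSL2Z\<^esub> inv\<^bsub>PPSL2Z\<^esub> m)) farey =
      img m (img (inv\<^bsub>PPSL2Z\<^esub> f) (img (inv\<^bsub>PPSL2Z\<^esub> m) farey))"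
    using mc f farey_subset_S1 by (simp add: img_mult)
  ultimately show ?thesis
    unfolding map_marked_img using inv_conj[OF mc f S1(1)] inv_conj[OF mc f S1(2)] mc f S1
    by (simp add: mult_apply carrier_closed inv_vals)
qed

text \<open>The matrix takes the doe from \<infinity> to 0 to the given one and preserves the
  tesselation, so it conjugates one move into the other. The third vertices 1 and -1 go to the
  points given by the sum and the difference of its columns.\<close>

lemma alpha_conj:
  assumes det: "a * d - b * c = 1"
  shows "alpha (ip a c, ip b d) =
    smob a b c d \<otimes>\<^bsub>PPSL2Z\<^esub> alpha0 \<otimes>\<^bsub>PPSL2Z\<^esub> inv\<^bsub>PPSL2Z\<^esub> (smob a b c d)"
  unfolding alpha_def
proof (rule element_of_move_eqI)
  let ?m = "smob a b c d"
  have mc: "?m \<in> carrier PPSL2Z" by (rule smob_carrier[OF det])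
  show "?m \<otimes>\<^bsub>PPSL2Z\<^esub> alpha0 \<otimes>\<^bsub>PPSL2Z\<^esub> inv\<^bsub>PPSL2Z\<^esub> ?m \<in> carrier PPSL2Z"
    using mc by simp
  have d1: "a * d - c * b = 1" and d2: "b * (- c) - d * (- a) = 1"
    using det by (simp_all add: algebra_simps)
  show doe: "is_doe farey (ip a c, ip b d)"
    using fareyI[of a d c b] d1 by simp
  have W: "left_vertex farey (ip a c) (ip b d) = ip (a + b) (c + d)"
    by (rule left_vertex_farey[OF d1])
  \<comment> \<open>For the reversed edge the determinant is 1 only after negating the coordinates
    of one end.\<close>
  have "ip a c = ip (- a) (- c)" by (simp add: cayley_minus)
  then have E: "left_vertex farey (ip b d) (ip a c) = ip (b - a) (d - c)"
    using left_vertex_farey[OF d2] by simp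
  have m_vals: "?m ptinf = ip a c" "?m (pt 0) = ip b d" "?m (pt 1) = ip (a + b) (c + d)" "?m (pt (-1)) = ip (b - a) (d - c)"
    using mob_ptinf_cayley mob_pt_cayley[of a b c d 0] mob_pt_cayley[of a b c d 1] mob_pt_cayley[of a b c d "-1"]
    by (simp_all add: algebra_simps)
  have inv_alpha: "inv\<^bsub>PPSL2Z\<^esub> alpha0 = quad_turn"
    unfolding alpha0_def using quad_turn_carrier by simp
  have "?m ` {pt (-1), pt 1} = {ip (b - a) (d - c), ip (a + b) (c + d)}" "?m ` {ptinf, pt 0} = {ip a c, ip b d}"
    using m_vals by (simp_all del: smob_apply)
  moreover have "img ?m (farey - {{ptinf, pt 0}}) = img ?m farey - {?m ` {ptinf, pt 0}}"
  proof -
    have inj: "inj_on (\<lambda>g. ?m ` g) farey"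
    proof (rule inj_onI)
      fix g g' assume "g \<in> farey" "g' \<in> farey" "?m ` g = ?m ` g'"
      then show "g = g'"
        using inj_on_image_eq_iff[OF circle_homeo_facts(6)[OF carrier_imp_homeo[OF mc]]] farey_subset_S1 by blast
    qed
    have "{ptinf, pt 0} \<in> farey"
      using fareyI[of 1 1 0 0] unfolding ip_simps by simp
    then show ?thesis
      unfolding img_def using inj_on_image_set_diff[OF inj, of farey "{{ptinf, pt 0}}"] by simp
  qed
  ultimately have "img ?m (img quad_turn farey) =
      insert {ip (b - a) (d - c), ip (a + b) (c + d)} (farey - {{ip a c, ip b d}})"
    unfolding img_quad_turn_farey using img_smob_farey[OF det] by (simp add: img_def)
  then show "map_marked (inv_into S1 (?m \<otimes>\<^bsub>PPSL2Z\<^esub> alpha0 \<otimes>\<^bsub>PPSL2Z\<^esub> inv\<^bsub>PPSL2Z\<^esub> ?m)) (farey, ip a c, ip b d) =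
      flip_move (farey, ip a c, ip b d)"
    unfolding map_marked_conj[OF det alpha0_carrier] inv_alpha flip_move.simps Let_def W E
    using m_vals by (simp add: quad_turn_inf quad_turn_pt(2)[of 0] del: smob_apply)
qed

lemma beta_conj:
  assumes det: "a * d - b * c = 1"
  shows "beta (ip a c, ip b d) =
    smob a b c d \<otimes>\<^bsub>PPSL2Z\<^esub> beta0 \<otimes>\<^bsub>PPSL2Z\<^esub> inv\<^bsub>PPSL2Z\<^esub> (smob a b c d)"
  unfolding beta_def
proof (rule element_of_move_eqI)
  let ?m = "smob a b c d"
  have mc: "?m \<in> carrier PPSL2Z" by (rule smob_carrier[OF det])
  show "?m \<otimes>\<^bsub>PPSL2Z\<^esub> beta0 \<otimes>\<^bsub>PPSL2Z\<^esub> inv\<^bsub>PPSL2Z\<^esub> ?m \<in> carrier PPSL2Z"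
    using mc by simp
  have d1: "a * d - c * b = 1"
    using det by (simp add: algebra_simps)
  show "is_doe farey (ip a c, ip b d)"
    using fareyI[of a d c b] d1 by simp
  have m_vals: "?m (pt 0) = ip b d" "?m (pt 1) = ip (a + b) (c + d)"
    using mob_pt_cayley[of a b c d 0] mob_pt_cayley[of a b c d 1] by simp_all
  have inv_beta: "inv\<^bsub>PPSL2Z\<^esub> beta0 = tri_turn"
    unfolding beta0_def using tri_turn_carrier by simp
  have "img tri_turn farey = farey"
    unfolding tri_turn_def by (rule img_smob_farey) simp
  then show "map_marked (inv_into S1 (?m \<otimes>\<^bsub>PPSL2Z\<^esub> beta0 \<otimes>\<^bsub>PPSL2Z\<^esub> inv\<^bsub>PPSL2Z\<^esub> ?m)) (farey, ip a c, ip b d) =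
      rotate_move (farey, ip a c, ip b d)"
    unfolding map_marked_conj[OF det beta0_carrier] inv_beta rotate_move.simps left_vertex_farey[OF d1]
    using m_vals img_smob_farey[OF det] by (simp add: tri_turn_inf tri_turn_pt del: smob_apply)
qed

section \<open>Presentations\<close>

lemma one_free_group: "\<one>\<^bsub>free_group\<^esub> = free_class []"
  by (simp add: free_group_def)

lemma free_class_closed [simp]: "free_class w \<in> carrier free_group"
  by (simp add: carrier_free_group)

lemma normal_normal_closure:
  fixes G (structure)
  assumes "group G" "R \<subseteq> carrier G"
  shows "normal_closure G R \<lhd> G" "R \<subseteq> normal_closure G R"
proof -
  interpret group G by (rule assms(1))
  let ?N = "{N. N \<lhd> G \<and> R \<subseteq> N}"
  have car: "carrier G \<in> ?N"
    using assms(2) normal_inv_iff[of "carrier G"] subgroup_self by simp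
  have "subgroup (\<Inter>?N) G"
    by (rule subgroups_Inter) (use car normal_imp_subgroup in blast)+
  moreover have "x \<otimes> h \<otimes> inv x \<in> \<Inter>?N" if "x \<in> carrier G" "h \<in> \<Inter>?N" for x h
    using that unfolding normal_inv_iff by blast
  ultimately show "normal_closure G R \<lhd> G"
    unfolding normal_closure_def normal_inv_iff by blast
  show "R \<subseteq> normal_closure G R"
    unfolding normal_closure_def by blast
qed

section \<open>Evaluation of words and recognition of a presentation\<close>

context group
begin

primrec eval :: "('x \<Rightarrow> 'a) \<Rightarrow> 'x word \<Rightarrow> 'a" where
  "eval \<gamma> [] = \<one>"
| "eval \<gamma> (l # w) = (if snd l then \<gamma> (fst l) else inv \<gamma> (fst l)) \<otimes> eval \<gamma> w"

context
  fixes \<gamma> :: "'x \<Rightarrow> 'a" assumes \<gamma> [simp]: "\<And>x. \<gamma> x \<in> carrier G"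
begin

lemma eval_closed [simp]: "eval \<gamma> w \<in> carrier G"
  by (induction w) auto

lemma eval_append: "eval \<gamma> (u @ v) = eval \<gamma> u \<otimes> eval \<gamma> v"
  by (induction u) (auto simp: m_assoc)

lemma eval_cancels: "cancels u v \<Longrightarrow> eval \<gamma> u = eval \<gamma> v"
  by (induction rule: cancels.induct) (auto simp: eval_append inv_cancel_left)

lemma eval_equivclp: "equivclp cancels u v \<Longrightarrow> eval \<gamma> u = eval \<gamma> v"
  by (induction rule: equivclp_induct) (auto dest: eval_cancels)

lemma eval_word_inverse: "eval \<gamma> (word_inverse w) = inv (eval \<gamma> w)"
proof (induction w)
  case (Cons l w)
  have "word_inverse (l # w) = word_inverse w @ [(fst l, \<not> snd l)]"
    by (simp add: word_inverse_def case_prod_beta)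
  then show ?case
    by (simp add: eval_append Cons inv_mult_group)
qed (simp add: word_inverse_def)

lemma eval_word_power: "eval \<gamma> (word_power w n) = eval \<gamma> w [^] n"
  unfolding word_power_def
proof (induction n)
  case (Suc n)
  have "eval \<gamma> (concat (replicate (Suc n) w)) = eval \<gamma> w \<otimes> eval \<gamma> w [^] n"
    using Suc by (simp add: eval_append)
  then show ?case
    unfolding pow_Suc_left[OF eval_closed] .
qed simp

lemma eval_letter: "eval \<gamma> (letter x) = \<gamma> x"
  by (simp add: letter_def)

lemma eval_word_commutator:
  "eval \<gamma> (word_commutator u v) = \<one> \<longleftrightarrow> eval \<gamma> u \<otimes> eval \<gamma> v = eval \<gamma> v \<otimes> eval \<gamma> u"
proof -
  have "eval \<gamma> (word_commutator u v) = eval \<gamma> u \<otimes> eval \<gamma> v \<otimes> inv (eval \<gamma> v \<otimes> eval \<gamma> u)"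
    by (simp add: word_commutator_def eval_append eval_word_inverse inv_mult_group m_assoc)
  then show ?thesis
    using inv_equality[of "eval \<gamma> u \<otimes> eval \<gamma> v" "inv (eval \<gamma> v \<otimes> eval \<gamma> u)"]
    by (metis eval_closed inv_closed inv_inv m_closed r_inv)
qed

text \<open>The choice of the representative is immaterial by \<open>eval_equivclp\<close>;
  \<open>free_hom_class\<close> is the form in which this map is used.\<close>

definition free_hom :: "'x word set \<Rightarrow> 'a" where
  "free_hom X = eval \<gamma> (SOME w. w \<in> X)"

lemma free_hom_class: "free_hom (free_class w) = eval \<gamma> w"
proof -
  have "w \<in> free_class w" by (simp add: mem_free_class)
  then have "(SOME u. u \<in> free_class w) \<in> free_class w" by (rule someI)
  then show ?thesis
    unfolding free_hom_def mem_free_class by (rule eval_equivclp[symmetric])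
qed

lemma free_hom_hom: "free_hom \<in> hom free_group G"
  by (rule homI) (auto simp: carrier_free_group mult_free_class free_hom_class eval_append)

text \<open>The first isomorphism theorem, once the kernel is known to be the normal closure. The
  closure lies in the kernel because the relators evaluate to one; the other inclusion is the
  hypothesis on words with trivial value.\<close>

lemma has_presentationI:
  assumes surj: "\<And>g. g \<in> carrier G \<Longrightarrow> \<exists>w. eval \<gamma> w = g"
    and rels: "\<And>r. r \<in> R \<Longrightarrow> eval \<gamma> r = \<one>"
    and ker: "\<And>w. eval \<gamma> w = \<one> \<Longrightarrow> free_class w \<in> normal_closure free_group (free_class ` R)"
  shows "has_presentation G \<gamma> R"
proof -
  interpret F: group "free_group :: 'x word set monoid" by (rule group_free_group)
  interpret h: group_hom free_group G free_hom
    using free_hom_hom by unfold_locales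
  let ?K = "normal_closure free_group (free_class ` R)"
  let ?k = "kernel free_group G free_hom"
  have "free_class ` R \<subseteq> ?k"
    using rels by (auto simp: kernel_def free_hom_class)
  then have "?K \<subseteq> ?k"
    unfolding normal_closure_def using h.normal_kernel by blast
  moreover have "?k \<subseteq> ?K"
    using ker by (auto simp: kernel_def carrier_free_group free_hom_class)
  ultimately have K: "?K = ?k" by blast
  have onto: "free_hom ` carrier free_group = carrier G"
  proof
    show "free_hom ` carrier free_group \<subseteq> carrier G"
      by (auto simp: carrier_free_group free_hom_class)
    show "carrier G \<subseteq> free_hom ` carrier free_group"
      using surj free_hom_class by (metis free_class_closed image_eqI subsetI)
  qed
  have "(\<lambda>X. the_elem (free_hom ` X)) \<in> iso (free_group Mod ?k) G"
    by (rule h.FactGroup_iso_set[OF onto])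
  moreover have "the_elem (free_hom ` (?k #>\<^bsub>free_group\<^esub> free_class (letter x))) = \<gamma> x" for x
  proof -
    have "free_hom ` (?k #>\<^bsub>free_group\<^esub> free_class (letter x)) = {\<gamma> x}"
    proof -
      have "free_hom y = \<gamma> x" if "y \<in> ?k #>\<^bsub>free_group\<^esub> free_class (letter x)" for y
        using that by (auto simp: r_coset_def kernel_def free_hom_class eval_letter)
      moreover have "free_class (letter x) \<in> ?k #>\<^bsub>free_group\<^esub> free_class (letter x)"
        by (rule F.rcos_self[OF free_class_closed h.subgroup_kernel])
      ultimately show ?thesis
        by (intro equalityI image_subsetI singletonI subsetI) (auto intro: rev_image_eqI)
    qed
    then show ?thesis by simp
  qed
  ultimately show ?thesis
    unfolding has_presentation_def Let_def K
    by (intro bexI[of _ "\<lambda>X. the_elem (free_hom ` X)"] allI)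
qed

end

lemma eval_conj:
  assumes m: "m \<in> carrier G" and \<gamma>: "\<And>x. \<gamma> x \<in> carrier G"
  shows "eval (\<lambda>x. m \<otimes> \<gamma> x \<otimes> inv m) w = m \<otimes> eval \<gamma> w \<otimes> inv m"
proof (induction w)
  case (Cons l w)
  show ?case
    unfolding eval.simps Cons.IH using m \<gamma> eval_closed[of \<gamma> w]
    by (cases "snd l") (simp_all add: word_simps)
qed (use m in simp)

lemma eval_in_generate:
  assumes "\<And>x. \<gamma> x \<in> carrier G"
  shows "eval \<gamma> w \<in> generate G (range \<gamma>)"
  by (induction w) (auto intro: generate.intros)

lemma generate_eval:
  assumes "\<And>x. \<gamma> x \<in> carrier G" "g \<in> generate G (range \<gamma>)"
  shows "\<exists>w. eval \<gamma> w = g"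
  using assms(2)
proof (induction rule: generate.induct)
  case one
  show ?case by (rule exI[of _ "[]"]) simp
next
  case (incl h)
  then obtain x where "h = \<gamma> x" by blast
  then show ?case using assms(1) by (intro exI[of _ "[(x, True)]"]) simp
next
  case (inv h)
  then obtain x where "h = \<gamma> x" by blast
  then show ?case using assms(1) by (intro exI[of _ "[(x, False)]"]) simp
next
  case (eng h1 h2)
  then obtain u v where "eval \<gamma> u = h1" "eval \<gamma> v = h2" by blast
  then show ?case using eval_append[of \<gamma>, OF assms(1)] by blast
qed

lemma eval_relators:
  assumes \<gamma>: "\<And>x. \<gamma> x \<in> carrier G"
  shows "(\<forall>r\<in>PPSL2Z_relators. eval \<gamma> r = \<one>) \<longleftrightarrow> ppsl2z_relations (\<gamma> Gen_alpha) (\<gamma> Gen_beta)"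
proof -
  let ?x = "\<gamma> Gen_alpha" and ?y = "\<gamma> Gen_beta"
  have [simp]: "?x \<in> carrier G" "?y \<in> carrier G" using \<gamma> by simp_all
  have pow: "z [^] (4::nat) = z \<otimes> (z \<otimes> (z \<otimes> z))" "z [^] (3::nat) = z \<otimes> (z \<otimes> z)" "z [^] (2::nat) = z \<otimes> z"
    if "z \<in> carrier G" for z
    using that by (simp_all add: eval_nat_numeral m_assoc)
  show ?thesis
    unfolding PPSL2Z_relators_def ppsl2z_relations_def Let_def
    by (simp add: eval_word_commutator[OF \<gamma>] eval_word_power[OF \<gamma>] eval_append[OF \<gamma>] eval_letter[OF \<gamma>] pow m_assoc
        del: eval.simps)
qed

end

section \<open>The abstract group defined by the relators\<close>

lemma (in group) conj_inv_y:
  assumes x: "x \<in> carrier G" and y: "y \<in> carrier G" and r: "y \<otimes> (y \<otimes> y) = \<one>"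
  shows "inv (y \<otimes> (x \<otimes> x)) \<otimes> inv y \<otimes> (inv y \<otimes> x) = inv x"
proof -
  have "inv (y \<otimes> (x \<otimes> x)) \<otimes> inv y \<otimes> (inv y \<otimes> x) = inv x \<otimes> (inv x \<otimes> (inv (y \<otimes> (y \<otimes> y)) \<otimes> x))"
    using x y by (simp add: m_assoc inv_mult_group)
  also have "\<dots> = inv x"
    unfolding r using x by simp
  finally show ?thesis .
qed

text \<open>Finite order makes x the cube of its inverse and y the square of its inverse. These
  inverses are \<open>D 1\<close> and \<open>D 0\<close>, so left multiplication by x, y and their
  inverses preserves normal forms; applied to \<one> this reaches every generated element.\<close>

lemma (in thompson_relations) generate_normal_forms:
  assumes "x \<in> carrier G" "y \<in> carrier G" "x \<otimes> (x \<otimes> (x \<otimes> x)) = \<one>" "y \<otimes> (y \<otimes> y) = \<one>"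
    and D: "D 0 = inv y" "D 1 = inv x" and z: "z \<in> generate G {x, y}"
  shows "z \<in> normal_forms"
proof -
  have ix: "x = inv x \<otimes> (inv x \<otimes> inv x)" and iy: "y = inv y \<otimes> inv y"
  proof -
    have "inv x = x \<otimes> x \<otimes> x" "inv y = y \<otimes> y"
      using assms(1-4) by (simp_all add: inv_equality m_assoc)
    then have *: "x = inv (x \<otimes> x \<otimes> x)" "y = inv (y \<otimes> y)"
      using inv_inv[OF assms(1)] inv_inv[OF assms(2)] by simp_all
    have "inv (x \<otimes> x \<otimes> x) = inv x \<otimes> (inv x \<otimes> inv x)"
      using assms(1) by (simp only: inv_mult_group m_closed)
    with *(1) show "x = inv x \<otimes> (inv x \<otimes> inv x)"
      by (rule trans)
    from *(2) show "y = inv y \<otimes> inv y"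
      unfolding inv_mult_group[OF assms(2,2)] .
  qed
  have cl: "normal_forms \<subseteq> carrier G"
    unfolding normal_forms_def by auto
  have inv_step: "inv x \<otimes> t \<in> normal_forms" "inv y \<otimes> t \<in> normal_forms" if "t \<in> normal_forms" for t
    using D_mult_normal_form[OF that, of 1] D_mult_normal_form[OF that, of 0] D by simp_all
  have step: "x \<otimes> t \<in> normal_forms" "y \<otimes> t \<in> normal_forms" if t: "t \<in> normal_forms" for t
  proof -
    have tc: "t \<in> carrier G" using t cl by blast
    have "x \<otimes> t = inv x \<otimes> (inv x \<otimes> inv x) \<otimes> t" "y \<otimes> t = inv y \<otimes> inv y \<otimes> t"
      using ix iy by simp_all
    then have "x \<otimes> t = inv x \<otimes> (inv x \<otimes> (inv x \<otimes> t))" "y \<otimes> t = inv y \<otimes> (inv y \<otimes> t)"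
      using assms(1,2) tc by (simp_all only: m_assoc inv_closed m_closed)
    then show "x \<otimes> t \<in> normal_forms" "y \<otimes> t \<in> normal_forms"
      using inv_step(1)[OF inv_step(1)[OF inv_step(1)[OF t]]] inv_step(2)[OF inv_step(2)[OF t]] by (simp_all only:)
  qed
  have "\<forall>t\<in>normal_forms. z \<otimes> t \<in> normal_forms"
    using z
  proof (induction rule: generate.induct)
    case one
    then show ?case using cl by auto
  next
    case (incl h)
    then show ?case using step by auto
  next
    case (inv h)
    then show ?case using inv_step by auto
  next
    case (eng h1 h2)
    have "h1 \<in> carrier G" "h2 \<in> carrier G"
      using eng.hyps generate_in_carrier[of "{x, y}"] assms(1,2) by auto
    then have "h1 \<otimes> h2 \<otimes> t = h1 \<otimes> (h2 \<otimes> t)" if "t \<in> normal_forms" for t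
      using that cl by (intro m_assoc) auto
    then show ?case using eng.IH by simp
  qed
  moreover have "z \<in> carrier G"
    using z generate_in_carrier[of "{x, y}"] assms(1,2) by auto
  ultimately show ?thesis
    using one_normal_form by (metis r_one)
qed

text \<open>Every group generated by elements satisfying the relations and mapping onto the two moves is a
  faithful image of PPSL(2,Z): this applies to the group with the given presentation.\<close>

lemma relations_faithful:
  assumes "group G" and x: "x \<in> carrier G" and y: "y \<in> carrier G" and rels: "group.ppsl2z_relations G x y"
    and h: "h \<in> hom G PPSL2Z" "h x = alpha0" "h y = beta0"
    and z: "z \<in> generate G {x, y}" "h z = \<one>\<^bsub>PPSL2Z\<^esub>"
  shows "z = \<one>\<^bsub>G\<^esub>"
proof -
  interpret G: group G by (rule assms(1))
  interpret thompson_action G "y \<otimes>\<^bsub>G\<^esub> (x \<otimes>\<^bsub>G\<^esub> x)" "inv\<^bsub>G\<^esub> y \<otimes>\<^bsub>G\<^esub> x" "inv\<^bsub>G\<^esub> y" h S1 ptinf "pt 1"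
    by (rule thompson_action_PPSL2Z[OF assms(1) x y rels h])
  have r: "x \<otimes>\<^bsub>G\<^esub> (x \<otimes>\<^bsub>G\<^esub> (x \<otimes>\<^bsub>G\<^esub> x)) = \<one>\<^bsub>G\<^esub>" "y \<otimes>\<^bsub>G\<^esub> (y \<otimes>\<^bsub>G\<^esub> y) = \<one>\<^bsub>G\<^esub>"
    using rels unfolding G.ppsl2z_relations_def by simp_all
  have "D 1 = inv\<^bsub>G\<^esub> (y \<otimes>\<^bsub>G\<^esub> (x \<otimes>\<^bsub>G\<^esub> x)) \<otimes>\<^bsub>G\<^esub> inv\<^bsub>G\<^esub> y \<otimes>\<^bsub>G\<^esub> (inv\<^bsub>G\<^esub> y \<otimes>\<^bsub>G\<^esub> x)"
    by (simp only: One_nat_def D.simps)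
  also have "\<dots> = inv\<^bsub>G\<^esub> x"
    by (rule G.conj_inv_y[OF x y r(2)])
  finally have "D 1 = inv\<^bsub>G\<^esub> x" .
  then have "z \<in> normal_forms"
    using generate_normal_forms[OF x y r _ _ z(1)] by simp
  then show ?thesis
    using normal_form_faithful z(2) one_apply by simp
qed

definition gens0 :: "generator \<Rightarrow> complex \<Rightarrow> complex" where
  "gens0 x = (case x of Gen_alpha \<Rightarrow> alpha0 | Gen_beta \<Rightarrow> beta0)"

lemma gens0_simps [simp]: "gens0 Gen_alpha = alpha0" "gens0 Gen_beta = beta0"
  and gens0_closed [simp]: "gens0 x \<in> carrier PPSL2Z"
  by (simp_all add: gens0_def split: generator.split)

lemma range_generator: "range \<gamma> = {\<gamma> Gen_alpha, \<gamma> Gen_beta}"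
  by (auto intro: generator.exhaust) (metis generator.exhaust)

text \<open>\<open>relations_faithful\<close> for the quotient of the free group by the normal
  closure: it is generated by the classes of the letters, satisfies the relations by construction,
  and maps to PPSL(2,Z) compatibly with evaluation. A word with trivial value is thus trivial in the
  quotient, which means that it lies in the normal closure.\<close>

lemma kernel_relators:
  assumes "PPSL2Z.eval gens0 w = \<one>\<^bsub>PPSL2Z\<^esub>"
  shows "free_class w \<in> normal_closure free_group (free_class ` PPSL2Z_relators)"
proof -
  let ?F = "free_group :: generator word set monoid"
  let ?R = "free_class ` PPSL2Z_relators"
  define K where "K = normal_closure ?F ?R"
  interpret F: group ?F by (rule group_free_group)
  have R: "?R \<subseteq> carrier ?F"
    using free_class_closed by blast
  have nK: "K \<lhd> ?F" and RK: "?R \<subseteq> K"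
    unfolding K_def using normal_normal_closure[OF group_free_group R] .
  interpret K: normal K ?F by (rule nK)
  interpret Q: group "?F Mod K" by (rule K.factorgroup_is_group)
  let ?q = "\<lambda>u. K #>\<^bsub>?F\<^esub> free_class u"
  define \<gamma> where "\<gamma> x = ?q (letter x)" for x
  have q_closed: "?q u \<in> carrier (?F Mod K)" for u
    unfolding carrier_FactGroup by (rule imageI[OF free_class_closed])
  have q_mult: "?q u \<otimes>\<^bsub>?F Mod K\<^esub> ?q v = ?q (u @ v)" for u v
    using K.rcos_sum[of "free_class u" "free_class v"] by (simp add: mult_FactGroup mult_free_class)
  have q_one: "?q [] = \<one>\<^bsub>?F Mod K\<^esub>"
    using F.coset_mult_one[of K] K.subset by (simp add: one_free_group)
  have \<gamma>_closed: "\<gamma> x \<in> carrier (?F Mod K)" for x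
    unfolding \<gamma>_def by (rule q_closed)
  have q_eval: "Q.eval \<gamma> u = ?q u" for u
  proof (induction u)
    case Nil
    show ?case unfolding q_one by simp
  next
    case (Cons l u)
    obtain x s where l: "l = (x, s)" by force
    have "?q [(x, False)] \<otimes>\<^bsub>?F Mod K\<^esub> ?q (letter x) = \<one>\<^bsub>?F Mod K\<^esub>"
    proof -
      have "cancels ([] @ [(x, False), (x, \<not> False)] @ []) ([] @ [] :: generator word)"
        by (rule cancels.intros)
      then have "free_class ([(x, False)] @ letter x) = free_class []"
        by (simp add: free_class_eq_iff letter_def r_into_equivclp)
      then show ?thesis unfolding q_mult q_one[symmetric] by simp
    qed
    then have inv: "inv\<^bsub>?F Mod K\<^esub> \<gamma> x = ?q [(x, False)]"
      unfolding \<gamma>_def using Q.inv_equality q_closed by blast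
    have "(if s then \<gamma> x else inv\<^bsub>?F Mod K\<^esub> \<gamma> x) = ?q [(x, s)]"
      using inv by (simp add: \<gamma>_def letter_def)
    note letter_eq = this
    show ?case
      unfolding l Q.eval.simps fst_conv snd_conv letter_eq Cons.IH q_mult by simp
  qed
  have "Q.eval \<gamma> r = \<one>\<^bsub>?F Mod K\<^esub>" if "r \<in> PPSL2Z_relators" for r
  proof -
    have "free_class r \<in> K" using RK that by blast
    then have "?q r = K" by (rule F.coset_join2[OF _ K.is_subgroup, rotated]) simp
    then show ?thesis unfolding q_eval by simp
  qed
  then have rels: "Q.ppsl2z_relations (\<gamma> Gen_alpha) (\<gamma> Gen_beta)"
    using Q.eval_relators[of \<gamma>, OF \<gamma>_closed] by blast
  interpret h: group_hom ?F PPSL2Z "PPSL2Z.free_hom gens0"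
    using PPSL2Z.free_hom_hom[of gens0] by unfold_locales simp
  have "?R \<subseteq> kernel ?F PPSL2Z (PPSL2Z.free_hom gens0)"
    using PPSL2Z.eval_relators[of gens0] relations_alpha0_beta0
    by (auto simp: kernel_def PPSL2Z.free_hom_class)
  then have K_ker: "K \<subseteq> kernel ?F PPSL2Z (PPSL2Z.free_hom gens0)"
    unfolding K_def normal_closure_def using h.normal_kernel by blast
  \<comment> \<open>As the relators evaluate to one, evaluation factors through the
    quotient.\<close>
  have "\<exists>\<phi>\<in>hom (?F Mod K) PPSL2Z.
      \<forall>x\<in>carrier ?F. \<phi> (K #>\<^bsub>?F\<^esub> x) = PPSL2Z.free_hom gens0 x"
    by (rule h.FactGroup_universal_kernel[OF nK K_ker]) (intro bexI ballI; assumption)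
  then obtain \<phi> where \<phi>: "\<phi> \<in> hom (?F Mod K) PPSL2Z"
    "\<forall>x\<in>carrier ?F. \<phi> (K #>\<^bsub>?F\<^esub> x) = PPSL2Z.free_hom gens0 x" by blast
  have \<phi>_q: "\<phi> (?q u) = PPSL2Z.eval gens0 u" for u
    unfolding bspec[OF \<phi>(2) free_class_closed] by (rule PPSL2Z.free_hom_class) simp
  have "?q w = \<one>\<^bsub>?F Mod K\<^esub>"
  proof (rule relations_faithful[OF Q.is_group \<gamma>_closed \<gamma>_closed rels \<phi>(1)])
    show "\<phi> (\<gamma> Gen_alpha) = alpha0" "\<phi> (\<gamma> Gen_beta) = beta0"
      unfolding \<gamma>_def \<phi>_q by (simp_all add: PPSL2Z.eval_letter[of gens0])
    show "?q w \<in> generate (?F Mod K) {\<gamma> Gen_alpha, \<gamma> Gen_beta}"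
      using Q.eval_in_generate[of \<gamma> w, OF \<gamma>_closed] unfolding q_eval range_generator[of \<gamma>] .
    show "\<phi> (?q w) = \<one>\<^bsub>PPSL2Z\<^esub>"
      unfolding \<phi>_q by (rule assms)
  qed
  then have "?q w = K" by simp
  moreover have "free_class w \<in> ?q w"
    by (rule F.rcos_self[OF free_class_closed K.is_subgroup])
  ultimately show ?thesis unfolding K_def by simp
qed

theorem theoremA:
  fixes e :: oriented_geodesic
  assumes "is_doe farey e"
  shows "generate PPSL2Z {alpha e, beta e} = carrier PPSL2Z \<and>
         has_presentation PPSL2Z (\<lambda>x. case x of Gen_alpha \<Rightarrow> alpha e | Gen_beta \<Rightarrow> beta e)
           PPSL2Z_relators"
proof -
  obtain a b c d where det: "a * d - b * c = 1" and e: "e = (ip a c, ip b d)"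
    using assms by (rule is_doeE)
  define m where "m = smob a b c d"
  have mc: "m \<in> carrier PPSL2Z" unfolding m_def by (rule smob_carrier[OF det])
  let ?\<gamma> = "\<lambda>x. case x of Gen_alpha \<Rightarrow> alpha e | Gen_beta \<Rightarrow> beta e"
  \<comment> \<open>One matrix conjugates both standard generators into those of \<open>e\<close>.
    The values of every word are then conjugate as well, so surjectivity, relators and kernel carry
    over from the standard doe.\<close>
  have \<gamma>: "?\<gamma> = (\<lambda>x. m \<otimes>\<^bsub>PPSL2Z\<^esub> gens0 x \<otimes>\<^bsub>PPSL2Z\<^esub> inv\<^bsub>PPSL2Z\<^esub> m)"
    unfolding m_def e by (rule ext) (simp add: alpha_conj[OF det] beta_conj[OF det] split: generator.split)
  have closed: "?\<gamma> x \<in> carrier PPSL2Z" for x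
    unfolding \<gamma> using mc by simp
  have eval: "PPSL2Z.eval ?\<gamma> w = m \<otimes>\<^bsub>PPSL2Z\<^esub> PPSL2Z.eval gens0 w \<otimes>\<^bsub>PPSL2Z\<^esub> inv\<^bsub>PPSL2Z\<^esub> m" for w
    unfolding \<gamma> by (rule PPSL2Z.eval_conj[OF mc]) simp
  have eval0: "PPSL2Z.eval gens0 w \<in> carrier PPSL2Z" for w
    by (rule PPSL2Z.eval_closed) simp
  have surj: "\<exists>w. PPSL2Z.eval ?\<gamma> w = g" if g: "g \<in> carrier PPSL2Z" for g
  proof -
    have "inv\<^bsub>PPSL2Z\<^esub> m \<otimes>\<^bsub>PPSL2Z\<^esub> g \<otimes>\<^bsub>PPSL2Z\<^esub> m \<in> carrier PPSL2Z"
      using mc g by simp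
    then have "inv\<^bsub>PPSL2Z\<^esub> m \<otimes>\<^bsub>PPSL2Z\<^esub> g \<otimes>\<^bsub>PPSL2Z\<^esub> m \<in> generate PPSL2Z (range gens0)"
      unfolding range_generator[of gens0] gens0_simps carrier_gen .
    then obtain w where w: "PPSL2Z.eval gens0 w = inv\<^bsub>PPSL2Z\<^esub> m \<otimes>\<^bsub>PPSL2Z\<^esub> g \<otimes>\<^bsub>PPSL2Z\<^esub> m"
      using PPSL2Z.generate_eval[of gens0] by auto
    have "PPSL2Z.eval ?\<gamma> w = g"
      unfolding eval w using mc g by (simp add: PPSL2Z.m_assoc PPSL2Z.inv_cancel_left)
    then show ?thesis by blast
  qed
  have "generate PPSL2Z {alpha e, beta e} = carrier PPSL2Z"
  proof
    have range: "range ?\<gamma> = {alpha e, beta e}"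
      using range_generator[of ?\<gamma>] by simp
    show "generate PPSL2Z {alpha e, beta e} \<subseteq> carrier PPSL2Z"
      by (rule PPSL2Z.generate_incl) (use closed[of Gen_alpha] closed[of Gen_beta] in simp)
    show "carrier PPSL2Z \<subseteq> generate PPSL2Z {alpha e, beta e}"
    proof
      fix g assume "g \<in> carrier PPSL2Z"
      then obtain w where "PPSL2Z.eval ?\<gamma> w = g" using surj by blast
      then show "g \<in> generate PPSL2Z {alpha e, beta e}"
        using PPSL2Z.eval_in_generate[of ?\<gamma> w, OF closed] unfolding range by simp
    qed
  qed
  moreover have "has_presentation PPSL2Z ?\<gamma> PPSL2Z_relators"
  proof (rule PPSL2Z.has_presentationI[OF closed surj])
    fix r assume "r \<in> PPSL2Z_relators"
    then have "PPSL2Z.eval gens0 r = \<one>\<^bsub>PPSL2Z\<^esub>"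
      using PPSL2Z.eval_relators[of gens0] relations_alpha0_beta0 by simp
    then show "PPSL2Z.eval ?\<gamma> r = \<one>\<^bsub>PPSL2Z\<^esub>"
      unfolding eval using mc by simp
  next
    fix w assume "PPSL2Z.eval ?\<gamma> w = \<one>\<^bsub>PPSL2Z\<^esub>"
    then have "inv\<^bsub>PPSL2Z\<^esub> m \<otimes>\<^bsub>PPSL2Z\<^esub> (m \<otimes>\<^bsub>PPSL2Z\<^esub> PPSL2Z.eval gens0 w \<otimes>\<^bsub>PPSL2Z\<^esub> inv\<^bsub>PPSL2Z\<^esub> m) \<otimes>\<^bsub>PPSL2Z\<^esub> m =
        inv\<^bsub>PPSL2Z\<^esub> m \<otimes>\<^bsub>PPSL2Z\<^esub> \<one>\<^bsub>PPSL2Z\<^esub> \<otimes>\<^bsub>PPSL2Z\<^esub> m"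
      unfolding eval by simp
    then have "PPSL2Z.eval gens0 w = \<one>\<^bsub>PPSL2Z\<^esub>"
      using mc eval0 by (simp add: PPSL2Z.m_assoc PPSL2Z.inv_cancel_left)
    then show "free_class w \<in> normal_closure free_group (free_class ` PPSL2Z_relators)"
      by (rule kernel_relators)
  qed
  ultimately show ?thesis ..
qed

end
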